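(* Let $p\in\mathbb{R}$ with $p>1$, let $q$ be the real number with $\frac1p+\frac1q=1$, let $n\in\mathbb{N}$, and let $G$ be a group of type $FP_n$. Then for all $i\le n$ the reduced $l^p$-cohomology $\overline{H_{(p)}^i(G)}$ is dual to the reduced $l^q$-homology $\overline{H^{(q)}_i(G)}$, i.e. $\overline{H_{(p)}^i(G)}$ is isomorphic, as a topological vector space, to the continuous dual of $\overline{H^{(q)}_i(G)}$.
   Context: $\mathbb{Z}[G]$ is the integral group ring and $\mathbb{Z}$ is the trivial $\mathbb{Z}[G]$-module. A group $G$ is of type $FP_n$ if there is an exact sequence $F_n\to\dots\to F_0\to\mathbb{Z}\to 0$ of $\mathbb{Z}[G]$-modules with $F_0,\dots,F_n$ projective and finitely generated. For real $r\ge 1$, $l^r(G)$ is the Banach space of formal sums $f=\sum_{g\in G}f_g g$ with $f_g\in\mathbb{C}$, only countably many $f_g\ne 0$, and $\sum_{g}|f_g|^r=(|f|_r)^r<\infty$; it is a $\mathbb{Z}[G]$-module via translation by $G$. For a projective resolution $\cdots\to F_2\xrightarrow{\partial_2}F_1\xrightarrow{\partial_1}F_0\xrightarrow{\varepsilon}\mathbb{Z}\to 0$ over $\mathbb{Z}[G]$, consider the chain complex $F_i\otimes_{\mathbb{Z}[G]}l^r(G)$, $i\ge0$, with boundary maps $\partial_i\otimes 1$ (left modules being turned into right modules via $xg=g^{-1}x$ when forming tensor products), and the cochain complex $\operatorname{Hom}_{\mathbb{Z}[G]}(F_i,l^r(G))$, $i\ge 0$, with $\widetilde\partial_i(\varphi)=\varphi\circ\partial_i$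 (maps with index $0$ are zero). The reduced $l^r$-homology and $l^r$-cohomology are $\overline{H^{(r)}_i(G)}=\ker(\partial_i\otimes1)/\overline{\operatorname{im}(\partial_{i+1}\otimes 1)}$ and $\overline{H_{(r)}^i(G)}=\ker(\widetilde\partial_{i+1})/\overline{\operatorname{im}(\widetilde\partial_i)}$. For $G$ of type $FP_n$ the resolution is taken with $F_0,\dots,F_n$ finitely generated; then for $i\le n$ the spaces $F_i\otimes_{\mathbb{Z}[G]}l^r(G)$ and $\operatorname{Hom}_{\mathbb{Z}[G]}(F_i,l^r(G))$ carry natural Banach space topologies (both are $l^r(G)^{m_i}$ if $F_i$ is free of rank $m_i$), in which the closures are taken. *)

theory Defs
  imports
    "HOL-Analysis.Analysis"
    "HOL-Algebra.Free_Abelian_Groups"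
    "HOL-Algebra.QuotRing"
    "HOL-Algebra.Module"
    "HOL-Library.Extended_Nat"
begin

section \<open>Modules over a not necessarily commutative ring\<close>

text \<open>
  The locale \<open>module\<close> of HOL-Algebra requires a commutative ring.  The fields \<open>mult\<close> and \<open>one\<close> that
  the record type \<open>module\<close> inherits from \<open>ring\<close> play no role for modules and are left undefined.
\<close>

locale left_module = R?: ring R + M?: abelian_group M for R (structure) and M (structure) +
  assumes smult_closed:
      "\<lbrakk>a \<in> carrier R; x \<in> carrier M\<rbrakk> \<Longrightarrow> a \<odot>\<^bsub>M\<^esub> x \<in> carrier M"
    and smult_l_distr:
      "\<lbrakk>a \<in> carrier R; b \<in> carrier R; x \<in> carrier M\<rbrakk>
        \<Longrightarrow> (a \<oplus>\<^bsub>R\<^esub> b) \<odot>\<^bsub>M\<^esub> x = a \<odot>\<^bsub>M\<^esub> x \<oplus>\<^bsub>M\<^esub> b \<odot>\<^bsub>M\<^esub> x"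
    and smult_r_distr:
      "\<lbrakk>a \<in> carrier R; x \<in> carrier M; y \<in> carrier M\<rbrakk>
        \<Longrightarrow> a \<odot>\<^bsub>M\<^esub> (x \<oplus>\<^bsub>M\<^esub> y) = a \<odot>\<^bsub>M\<^esub> x \<oplus>\<^bsub>M\<^esub> a \<odot>\<^bsub>M\<^esub> y"
    and smult_assoc:
      "\<lbrakk>a \<in> carrier R; b \<in> carrier R; x \<in> carrier M\<rbrakk>
        \<Longrightarrow> (a \<otimes>\<^bsub>R\<^esub> b) \<odot>\<^bsub>M\<^esub> x = a \<odot>\<^bsub>M\<^esub> (b \<odot>\<^bsub>M\<^esub> x)"
    and smult_one: "x \<in> carrier M \<Longrightarrow> \<one>\<^bsub>R\<^esub> \<odot>\<^bsub>M\<^esub> x = x"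

text \<open>The first argument is the set of scalars.\<close>

definition module_maps ::
  "'r set \<Rightarrow> ('r, 'a, 'x) module_scheme \<Rightarrow> ('r, 'b, 'y) module_scheme \<Rightarrow> ('a \<Rightarrow> 'b) set" where
  "module_maps S M N =
     {h \<in> carrier M \<rightarrow> carrier N.
        (\<forall>x\<in>carrier M. \<forall>y\<in>carrier M. h (x \<oplus>\<^bsub>M\<^esub> y) = h x \<oplus>\<^bsub>N\<^esub> h y) \<and>
        (\<forall>a\<in>S. \<forall>x\<in>carrier M. h (a \<odot>\<^bsub>M\<^esub> x) = a \<odot>\<^bsub>N\<^esub> h x)}"

definition finitely_generated ::
  "('r, 'q) ring_scheme \<Rightarrow> ('r, 'a, 'x) module_scheme \<Rightarrow> bool" where
  "finitely_generated R M \<longleftrightarrow>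
     (\<exists>S. finite S \<and> S \<subseteq> carrier M \<and>
        (\<forall>x\<in>carrier M. \<exists>a\<in>S \<rightarrow> carrier R. x = (\<Oplus>\<^bsub>M\<^esub>s\<in>S. a s \<odot>\<^bsub>M\<^esub> s)))"

definition free_module :: "('r, 'q) ring_scheme \<Rightarrow> 'b set \<Rightarrow> ('r, 'b \<Rightarrow> 'r) module" where
  "free_module R X =
     \<lparr>carrier = {f. (\<forall>x\<in>X. f x \<in> carrier R) \<and> (\<forall>x. x \<notin> X \<longrightarrow> f x = \<zero>\<^bsub>R\<^esub>) \<and>
                    finite {x. f x \<noteq> \<zero>\<^bsub>R\<^esub>}},
      monoid.mult = undefined, one = undefined,
      zero = (\<lambda>x. \<zero>\<^bsub>R\<^esub>), add = (\<lambda>f g x. f x \<oplus>\<^bsub>R\<^esub> g x),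
      smult = (\<lambda>a f x. if x \<in> X then a \<otimes>\<^bsub>R\<^esub> f x else \<zero>\<^bsub>R\<^esub>)\<rparr>"

text \<open>
  Projective means: direct summand (that is, retract) of a free module.  It is no restriction to
  take the basis \<open>X\<close> of the free module among the elements of \<open>M\<close>: if \<open>M\<close> is projective, the
  canonical surjection from the free module on \<open>carrier M\<close> onto \<open>M\<close> splits.
\<close>

definition projective_module ::
  "('r, 'q) ring_scheme \<Rightarrow> ('r, 'a, 'x) module_scheme \<Rightarrow> bool" where
  "projective_module R M \<longleftrightarrow>
     left_module R M \<and>
     (\<exists>(X :: 'a set) s t.
        s \<in> module_maps (carrier R) M (free_module R X) \<and>
        t \<in> module_maps (carrier R) (free_module R X) M \<and>
        (\<forall>x\<in>carrier M. t (s x) = x))"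


section \<open>The integral group ring and resolutions of the trivial module\<close>

text \<open>
  Elements of the group ring are finitely supported functions with integer values, i.e. elements of
  the free abelian group on the group; \<open>frag_extend\<close> is additive extension from generators.
\<close>

definition group_ring :: "('g, 'm) monoid_scheme \<Rightarrow> ('g \<Rightarrow>\<^sub>0 int) ring" where
  "group_ring G =
     \<lparr>carrier = carrier (free_Abelian_group (carrier G)),
      monoid.mult = (\<lambda>a b. frag_extend (\<lambda>g. frag_extend (\<lambda>h. frag_of (g \<otimes>\<^bsub>G\<^esub> h)) b) a),
      one = frag_of \<one>\<^bsub>G\<^esub>,
      zero = 0, add = (+)\<rparr>"

definition trivial_module :: "('g \<Rightarrow>\<^sub>0 int, int) module" where
  "trivial_module =
     \<lparr>carrier = UNIV, monoid.mult = undefined, one = undefined, zero = 0, add = (+),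
      smult = (\<lambda>a k. (\<Sum>g\<in>Poly_Mapping.keys a. Poly_Mapping.lookup a g) * k)\<rparr>"

text \<open>
  Exact sequences \<open>F\<^sub>N \<rightarrow> \<dots> \<rightarrow> F\<^sub>0 \<rightarrow> \<int> \<rightarrow> 0\<close> of projective modules, with
  \<open>d i : F i \<rightarrow> F (i - 1)\<close> for \<open>i \<ge> 1\<close> (\<open>d 0\<close> is ignored) and augmentation \<open>\<epsilon>\<close>.  For finite \<open>N\<close>
  nothing is required of the kernel of \<open>d N\<close>; for \<open>N = \<infinity>\<close> this is a projective resolution.
\<close>

definition projective_resolution_upto ::
  "enat \<Rightarrow> ('g, 'm) monoid_scheme \<Rightarrow> (nat \<Rightarrow> ('g \<Rightarrow>\<^sub>0 int, 'a) module) \<Rightarrow>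
     (nat \<Rightarrow> 'a \<Rightarrow> 'a) \<Rightarrow> ('a \<Rightarrow> int) \<Rightarrow> bool" where
  "projective_resolution_upto N G F d \<epsilon> \<longleftrightarrow>
     (\<forall>i. enat i \<le> N \<longrightarrow> projective_module (group_ring G) (F i)) \<and>
     \<epsilon> \<in> module_maps (carrier (group_ring G)) (F 0) trivial_module \<and>
     (\<forall>i. enat (Suc i) \<le> N \<longrightarrow>
        d (Suc i) \<in> module_maps (carrier (group_ring G)) (F (Suc i)) (F i)) \<and>
     \<epsilon> ` carrier (F 0) = UNIV \<and>
     (1 \<le> N \<longrightarrow> d 1 ` carrier (F 1) = {x \<in> carrier (F 0). \<epsilon> x = 0}) \<and>
     (\<forall>i. enat (Suc (Suc i)) \<le> N \<longrightarrow>
        d (Suc (Suc i)) ` carrier (F (Suc (Suc i))) = a_kernel (F (Suc i)) (F i) (d (Suc i)))"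

abbreviation projective_resolution ::
  "('g, 'm) monoid_scheme \<Rightarrow> (nat \<Rightarrow> ('g \<Rightarrow>\<^sub>0 int, 'a) module) \<Rightarrow>
     (nat \<Rightarrow> 'a \<Rightarrow> 'a) \<Rightarrow> ('a \<Rightarrow> int) \<Rightarrow> bool" where
  "projective_resolution \<equiv> projective_resolution_upto \<infinity>"

text \<open>
  A finitely generated projective module is isomorphic to a submodule of a free module on finitely
  many generators, hence to one whose elements have type \<open>nat \<Rightarrow> 'g \<Rightarrow>\<^sub>0 int\<close>.
\<close>

definition type_FP :: "nat \<Rightarrow> ('g, 'm) monoid_scheme \<Rightarrow> bool" where
  "type_FP n G \<longleftrightarrow>
     (\<exists>(F :: nat \<Rightarrow> ('g \<Rightarrow>\<^sub>0 int, nat \<Rightarrow> 'g \<Rightarrow>\<^sub>0 int) module) d \<epsilon>.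
        projective_resolution_upto (enat n) G F d \<epsilon> \<and>
        (\<forall>i\<le>n. finitely_generated (group_ring G) (F i)))"


section \<open>Complex topological vector spaces\<close>

record 'v ctvs = "(complex, 'v) module" +
  topo :: "'v topology"

definition ctvs_isomorphic :: "'v ctvs \<Rightarrow> 'w ctvs \<Rightarrow> bool" where
  "ctvs_isomorphic V W \<longleftrightarrow>
     (\<exists>h. h \<in> module_maps UNIV V W \<and> bij_betw h (carrier V) (carrier W) \<and>
          homeomorphic_map (topo V) (topo W) h)"

text \<open>The finest topology on \<open>Y\<close> for which all \<open>f i : X i \<rightarrow> Y\<close>, \<open>i \<in> I\<close>, are continuous.\<close>

definition final_topology ::
  "'b set \<Rightarrow> 'i set \<Rightarrow> ('i \<Rightarrow> 'a topology) \<Rightarrow> ('i \<Rightarrow> 'a \<Rightarrow> 'b) \<Rightarrow> 'b topology" where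
  "final_topology Y I X f =
     topology (\<lambda>U. U \<subseteq> Y \<and> (\<forall>i\<in>I. openin (X i) {x \<in> topspace (X i). f i x \<in> U}))"

lemma openin_final_topology:
  "openin (final_topology Y I X f) U \<longleftrightarrow>
     U \<subseteq> Y \<and> (\<forall>i\<in>I. openin (X i) {x \<in> topspace (X i). f i x \<in> U})"
proof -
  have "istopology (\<lambda>U. U \<subseteq> Y \<and> (\<forall>i\<in>I. openin (X i) {x \<in> topspace (X i). f i x \<in> U}))"
    unfolding istopology_def
  proof (intro conjI allI impI ballI)
    fix S T i
    assume S: "S \<subseteq> Y \<and> (\<forall>i\<in>I. openin (X i) {x \<in> topspace (X i). f i x \<in> S})"
      and T: "T \<subseteq> Y \<and> (\<forall>i\<in>I. openin (X i) {x \<in> topspace (X i). f i x \<in> T})"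
      and i: "i \<in> I"
    have "{x \<in> topspace (X i). f i x \<in> S \<inter> T} =
        {x \<in> topspace (X i). f i x \<in> S} \<inter> {x \<in> topspace (X i). f i x \<in> T}"
      by auto
    with S T i show "openin (X i) {x \<in> topspace (X i). f i x \<in> S \<inter> T}"
      by auto
  next
    fix K i
    assume K: "\<forall>S\<in>K. S \<subseteq> Y \<and> (\<forall>i\<in>I. openin (X i) {x \<in> topspace (X i). f i x \<in> S})"
      and i: "i \<in> I"
    have "{x \<in> topspace (X i). f i x \<in> \<Union>K} = (\<Union>S\<in>K. {x \<in> topspace (X i). f i x \<in> S})"
      by auto
    with K i show "openin (X i) {x \<in> topspace (X i). f i x \<in> \<Union>K}"
      by auto
  qed blast+
  then show ?thesis
    by (simp add: final_topology_def)
qed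

definition subspace_ctvs :: "'v ctvs \<Rightarrow> 'v set \<Rightarrow> 'v ctvs" where
  "subspace_ctvs V K = V\<lparr>carrier := K, topo := subtopology (topo V) K\<rparr>"

text \<open>The quotient by a subspace \<open>N\<close>, with the quotient topology.\<close>

definition quotient_ctvs :: "'v ctvs \<Rightarrow> 'v set \<Rightarrow> 'v set ctvs" where
  "quotient_ctvs V N =
     \<lparr>carrier = a_rcosets\<^bsub>V\<^esub> N, monoid.mult = undefined, one = undefined,
      zero = N, add = set_add V,
      smult = (\<lambda>c A. \<Union>v\<in>A. N +>\<^bsub>V\<^esub> (c \<odot>\<^bsub>V\<^esub> v)),
      topo = final_topology (a_rcosets\<^bsub>V\<^esub> N) {()} (\<lambda>_. topo V) (\<lambda>_ v. N +>\<^bsub>V\<^esub> v)\<rparr>"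

definition complex_line :: "complex ctvs" where
  "complex_line =
     \<lparr>carrier = UNIV, monoid.mult = undefined, one = undefined, zero = 0, add = (+),
      smult = (*), topo = euclidean\<rparr>"

definition tvs_bounded :: "'v ctvs \<Rightarrow> 'v set \<Rightarrow> bool" where
  "tvs_bounded V B \<longleftrightarrow>
     B \<subseteq> carrier V \<and>
     (\<forall>U. openin (topo V) U \<and> \<zero>\<^bsub>V\<^esub> \<in> U \<longrightarrow>
        (\<exists>t>0. \<forall>c. t \<le> cmod c \<longrightarrow> B \<subseteq> (\<lambda>v. c \<odot>\<^bsub>V\<^esub> v) ` U))"

definition continuous_functionals :: "'v ctvs \<Rightarrow> ('v \<Rightarrow> complex) set" where
  "continuous_functionals V =
     {\<phi> \<in> module_maps UNIV V complex_line. \<phi> \<in> extensional (carrier V) \<and>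
        continuous_map (topo V) (topo complex_line) \<phi>}"

text \<open>
  The topology of uniform convergence on bounded sets; for a normed space it is the topology of the
  dual norm.
\<close>

definition strong_topology :: "'v ctvs \<Rightarrow> ('v \<Rightarrow> complex) topology" where
  "strong_topology V =
     topology (\<lambda>U. U \<subseteq> continuous_functionals V \<and>
       (\<forall>\<phi>\<in>U. \<exists>B e. tvs_bounded V B \<and> 0 < e \<and>
          (\<forall>\<psi>\<in>continuous_functionals V. (\<forall>v\<in>B. cmod (\<psi> v - \<phi> v) < e) \<longrightarrow> \<psi> \<in> U)))"

lemma tvs_bounded_Un: "tvs_bounded V A \<Longrightarrow> tvs_bounded V B \<Longrightarrow> tvs_bounded V (A \<union> B)"
  unfolding tvs_bounded_def
proof (intro conjI allI impI; elim conjE)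
  fix U assume U: "openin (topo V) U" "\<zero>\<^bsub>V\<^esub> \<in> U"
    and A: "\<forall>U. openin (topo V) U \<and> \<zero>\<^bsub>V\<^esub> \<in> U \<longrightarrow>
        (\<exists>t>0. \<forall>c. t \<le> cmod c \<longrightarrow> A \<subseteq> (\<lambda>v. c \<odot>\<^bsub>V\<^esub> v) ` U)"
    and B: "\<forall>U. openin (topo V) U \<and> \<zero>\<^bsub>V\<^esub> \<in> U \<longrightarrow>
        (\<exists>t>0. \<forall>c. t \<le> cmod c \<longrightarrow> B \<subseteq> (\<lambda>v. c \<odot>\<^bsub>V\<^esub> v) ` U)"
  obtain s where s: "s > 0" "\<And>c. s \<le> cmod c \<Longrightarrow> A \<subseteq> (\<lambda>v. c \<odot>\<^bsub>V\<^esub> v) ` U"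
    using A U by blast
  obtain t where t: "t > 0" "\<And>c. t \<le> cmod c \<Longrightarrow> B \<subseteq> (\<lambda>v. c \<odot>\<^bsub>V\<^esub> v) ` U"
    using B U by blast
  show "\<exists>t>0. \<forall>c. t \<le> cmod c \<longrightarrow> A \<union> B \<subseteq> (\<lambda>v. c \<odot>\<^bsub>V\<^esub> v) ` U"
    using s t by (intro exI[of _ "max s t"]) auto
qed blast

lemma openin_strong_topology:
  "openin (strong_topology V) U \<longleftrightarrow>
     U \<subseteq> continuous_functionals V \<and>
     (\<forall>\<phi>\<in>U. \<exists>B e. tvs_bounded V B \<and> 0 < e \<and>
        (\<forall>\<psi>\<in>continuous_functionals V. (\<forall>v\<in>B. cmod (\<psi> v - \<phi> v) < e) \<longrightarrow> \<psi> \<in> U))"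
proof -
  define nbhd where "nbhd = (\<lambda>\<phi> U. \<exists>B e. tvs_bounded V B \<and> 0 < e \<and>
        (\<forall>\<psi>\<in>continuous_functionals V. (\<forall>v\<in>B. cmod (\<psi> v - \<phi> v) < e) \<longrightarrow> \<psi> \<in> U))"
  have Int: "nbhd \<phi> (S \<inter> T)" if ST: "nbhd \<phi> S" "nbhd \<phi> T" for \<phi> S T
  proof -
    obtain A a where A: "tvs_bounded V A" "0 < a"
      "\<And>\<psi>. \<psi> \<in> continuous_functionals V \<Longrightarrow> (\<forall>v\<in>A. cmod (\<psi> v - \<phi> v) < a) \<Longrightarrow> \<psi> \<in> S"
      using ST(1) unfolding nbhd_def by blast
    obtain B b where B: "tvs_bounded V B" "0 < b"
      "\<And>\<psi>. \<psi> \<in> continuous_functionals V \<Longrightarrow> (\<forall>v\<in>B. cmod (\<psi> v - \<phi> v) < b) \<Longrightarrow> \<psi> \<in> T"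
      using ST(2) unfolding nbhd_def by blast
    show ?thesis
      unfolding nbhd_def using A B tvs_bounded_Un[OF A(1) B(1)]
      by (intro exI[of _ "A \<union> B"] exI[of _ "min a b"]) auto
  qed
  have mono: "nbhd \<phi> T" if "nbhd \<phi> S" "S \<subseteq> T" for \<phi> S T
    using that unfolding nbhd_def by (meson subsetD)
  have "istopology (\<lambda>U. U \<subseteq> continuous_functionals V \<and> (\<forall>\<phi>\<in>U. nbhd \<phi> U))"
    unfolding istopology_def
  proof (intro conjI allI impI ballI)
    fix K \<phi> assume "\<forall>S\<in>K. S \<subseteq> continuous_functionals V \<and> (\<forall>\<phi>\<in>S. nbhd \<phi> S)" "\<phi> \<in> \<Union>K"
    then show "nbhd \<phi> (\<Union>K)" using mono by blast
  qed (use Int in blast)+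
  then show ?thesis
    by (simp add: strong_topology_def nbhd_def)
qed

definition dual_ctvs :: "'v ctvs \<Rightarrow> ('v \<Rightarrow> complex) ctvs" where
  "dual_ctvs V =
     \<lparr>carrier = continuous_functionals V, monoid.mult = undefined, one = undefined,
      zero = (\<lambda>v\<in>carrier V. 0), add = (\<lambda>\<phi> \<psi>. \<lambda>v\<in>carrier V. \<phi> v + \<psi> v),
      smult = (\<lambda>c \<phi>. \<lambda>v\<in>carrier V. c * \<phi> v),
      topo = strong_topology V\<rparr>"


section \<open>The Banach space of \<open>r\<close>-summable functions on a group\<close>

text \<open>
  A formal sum is represented by its coefficient function, extended by zero outside the group.
  Summability forces all but countably many coefficients to vanish.
\<close>

definition lr_space :: "('g, 'm) monoid_scheme \<Rightarrow> real \<Rightarrow> ('g \<Rightarrow> complex) set" where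
  "lr_space G r =
     {f. (\<forall>g. g \<notin> carrier G \<longrightarrow> f g = 0) \<and> (\<lambda>g. cmod (f g) powr r) summable_on carrier G}"

definition lr_norm :: "('g, 'm) monoid_scheme \<Rightarrow> real \<Rightarrow> ('g \<Rightarrow> complex) \<Rightarrow> real" where
  "lr_norm G r f = (\<Sum>\<^sub>\<infinity>g\<in>carrier G. cmod (f g) powr r) powr (1 / r)"

definition lr_topology :: "('g, 'm) monoid_scheme \<Rightarrow> real \<Rightarrow> ('g \<Rightarrow> complex) topology" where
  "lr_topology G r =
     Metric_space.mtopology (lr_space G r) (\<lambda>f f'. lr_norm G r (\<lambda>g. f g - f' g))"

text \<open>Left translation: \<open>(h f)(g) = f(h\<^sup>-\<^sup>1 g)\<close>.\<close>

definition lr_module :: "('g, 'm) monoid_scheme \<Rightarrow> real \<Rightarrow> ('g \<Rightarrow>\<^sub>0 int, 'g \<Rightarrow> complex) module" where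
  "lr_module G r =
     \<lparr>carrier = lr_space G r, monoid.mult = undefined, one = undefined,
      zero = (\<lambda>g. 0), add = (\<lambda>f f' g. f g + f' g),
      smult = (\<lambda>a f g. if g \<in> carrier G
         then \<Sum>h\<in>Poly_Mapping.keys a.
                of_int (Poly_Mapping.lookup a h) * f (inv\<^bsub>G\<^esub> h \<otimes>\<^bsub>G\<^esub> g)
         else 0)\<rparr>"


section \<open>Cochains and chains with \<open>l\<^sup>r\<close>-coefficients\<close>

text \<open>
  The module maps from \<open>M\<close> to \<open>l\<^sup>r(G)\<close>, with the topology of pointwise convergence.  If \<open>M\<close> is
  finitely generated, evaluation at a finite generating set embeds this space topologically into a
  finite power of \<open>l\<^sup>r(G)\<close>; if \<open>M\<close> is free with basis \<open>S\<close>, it is a homeomorphism onto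
  \<open>l\<^sup>r(G)\<^sup>S\<close>.
\<close>

definition lr_hom ::
  "('g, 'm) monoid_scheme \<Rightarrow> real \<Rightarrow> ('g \<Rightarrow>\<^sub>0 int, 'a) module \<Rightarrow> ('a \<Rightarrow> 'g \<Rightarrow> complex) ctvs" where
  "lr_hom G r M =
    (let H = module_maps (carrier (group_ring G)) M (lr_module G r) \<inter> extensional (carrier M) in
     \<lparr>carrier = H, monoid.mult = undefined, one = undefined,
      zero = (\<lambda>x\<in>carrier M. \<lambda>g. 0),
      add = (\<lambda>\<phi> \<psi>. \<lambda>x\<in>carrier M. \<lambda>g. \<phi> x g + \<psi> x g),
      smult = (\<lambda>c \<phi>. \<lambda>x\<in>carrier M. \<lambda>g. c * \<phi> x g),
      topo = subtopology (product_topology (\<lambda>_. lr_topology G r) (carrier M)) H\<rparr>)"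

text \<open>
  The anti-automorphism of the group ring induced by \<open>g \<mapsto> g\<^sup>-\<^sup>1\<close>; a left module becomes a right
  module via \<open>x a = group_ring_conj G a \<odot> x\<close>.
\<close>

definition group_ring_conj :: "('g, 'm) monoid_scheme \<Rightarrow> ('g \<Rightarrow>\<^sub>0 int) \<Rightarrow> ('g \<Rightarrow>\<^sub>0 int)" where
  "group_ring_conj G = frag_extend (\<lambda>g. frag_of (inv\<^bsub>G\<^esub> g))"

text \<open>
  The tensor product \<open>M \<otimes>\<^bsub>\<int>[G]\<^esub> l\<^sup>r(G)\<close> is the quotient of the free abelian group on all pairs
  by the subgroup generated by the usual relations; its elements are cosets.
\<close>

definition tensor_relations ::
  "('g, 'm) monoid_scheme \<Rightarrow> real \<Rightarrow> ('g \<Rightarrow>\<^sub>0 int, 'a) module \<Rightarrow> ('a \<times> ('g \<Rightarrow> complex) \<Rightarrow>\<^sub>0 int) set"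
  where
  "tensor_relations G r M =
    (let L = lr_module G r in
     generate (free_Abelian_group (carrier M \<times> carrier L))
      ({frag_of (x \<oplus>\<^bsub>M\<^esub> x', f) - frag_of (x, f) - frag_of (x', f) | x x' f.
          x \<in> carrier M \<and> x' \<in> carrier M \<and> f \<in> carrier L} \<union>
       {frag_of (x, f \<oplus>\<^bsub>L\<^esub> f') - frag_of (x, f) - frag_of (x, f') | x f f'.
          x \<in> carrier M \<and> f \<in> carrier L \<and> f' \<in> carrier L} \<union>
       {frag_of (group_ring_conj G a \<odot>\<^bsub>M\<^esub> x, f) - frag_of (x, a \<odot>\<^bsub>L\<^esub> f) | a x f.
          a \<in> carrier (group_ring G) \<and> x \<in> carrier M \<and> f \<in> carrier L}))"

definition tensor_coset ::
  "('g, 'm) monoid_scheme \<Rightarrow> real \<Rightarrow> ('g \<Rightarrow>\<^sub>0 int, 'a) module \<Rightarrow>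
     ('a \<times> ('g \<Rightarrow> complex) \<Rightarrow>\<^sub>0 int) \<Rightarrow> ('a \<times> ('g \<Rightarrow> complex) \<Rightarrow>\<^sub>0 int) set" where
  "tensor_coset G r M z =
     tensor_relations G r M #>\<^bsub>free_Abelian_group (carrier M \<times> lr_space G r)\<^esub> z"

text \<open>
  The map \<open>u \<otimes> v\<close> from the tensor product of any module with \<open>l\<^sup>r(G)\<close> to that of \<open>N\<close>; for additive
  \<open>\<int>[G]\<close>-compatible \<open>u\<close>, \<open>v\<close> the cosets in the union coincide.
\<close>

definition tensor_map ::
  "('g, 'm) monoid_scheme \<Rightarrow> real \<Rightarrow> ('g \<Rightarrow>\<^sub>0 int, 'b) module \<Rightarrow>
     ('a \<Rightarrow> 'b) \<Rightarrow> (('g \<Rightarrow> complex) \<Rightarrow> 'g \<Rightarrow> complex) \<Rightarrow>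
     ('a \<times> ('g \<Rightarrow> complex) \<Rightarrow>\<^sub>0 int) set \<Rightarrow> ('b \<times> ('g \<Rightarrow> complex) \<Rightarrow>\<^sub>0 int) set" where
  "tensor_map G r N u v A =
     (\<Union>z\<in>A. tensor_coset G r N (frag_extend (\<lambda>(x, f). frag_of (u x, v f)) z))"

text \<open>
  The topology is the finest one making all maps \<open>l\<^sup>r(G)\<^sup>S \<rightarrow> M \<otimes> l\<^sup>r(G)\<close>,
  \<open>(f\<^sub>s) \<mapsto> \<Sum>s. s \<otimes> f\<^sub>s\<close>, for finite \<open>S \<subseteq> M\<close> continuous.  If \<open>M\<close> is finitely generated, it is
  the quotient topology from \<open>l\<^sup>r(G)\<^sup>S\<close> for any finite generating set \<open>S\<close>; if \<open>M\<close> is free with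
  finite basis \<open>S\<close>, this map is a homeomorphism.
\<close>

definition lr_tensor ::
  "('g, 'm) monoid_scheme \<Rightarrow> real \<Rightarrow> ('g \<Rightarrow>\<^sub>0 int, 'a) module \<Rightarrow>
     ('a \<times> ('g \<Rightarrow> complex) \<Rightarrow>\<^sub>0 int) set ctvs" where
  "lr_tensor G r M =
    (let A = free_Abelian_group (carrier M \<times> lr_space G r);
         T = rcosets\<^bsub>A\<^esub> (tensor_relations G r M) in
     \<lparr>carrier = T, monoid.mult = undefined, one = undefined,
      zero = tensor_relations G r M, add = set_mult A,
      smult = (\<lambda>c. tensor_map G r M id (\<lambda>f g. c * f g)),
      topo = final_topology T {S. finite S \<and> S \<subseteq> carrier M}
        (\<lambda>S. product_topology (\<lambda>_. lr_topology G r) S)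
        (\<lambda>S f. tensor_coset G r M (\<Sum>s\<in>S. frag_of (s, f s)))\<rparr>)"


section \<open>Reduced homology and cohomology\<close>

definition lr_cycles ::
  "('g, 'm) monoid_scheme \<Rightarrow> real \<Rightarrow> (nat \<Rightarrow> ('g \<Rightarrow>\<^sub>0 int, 'a) module) \<Rightarrow> (nat \<Rightarrow> 'a \<Rightarrow> 'a) \<Rightarrow>
     nat \<Rightarrow> ('a \<times> ('g \<Rightarrow> complex) \<Rightarrow>\<^sub>0 int) set set" where
  "lr_cycles G r F d i =
     (case i of
        0 \<Rightarrow> carrier (lr_tensor G r (F 0))
      | Suc j \<Rightarrow> a_kernel (lr_tensor G r (F i)) (lr_tensor G r (F j)) (tensor_map G r (F j) (d i) id))"

definition lr_boundaries ::
  "('g, 'm) monoid_scheme \<Rightarrow> real \<Rightarrow> (nat \<Rightarrow> ('g \<Rightarrow>\<^sub>0 int, 'a) module) \<Rightarrow> (nat \<Rightarrow> 'a \<Rightarrow> 'a) \<Rightarrow>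
     nat \<Rightarrow> ('a \<times> ('g \<Rightarrow> complex) \<Rightarrow>\<^sub>0 int) set set" where
  "lr_boundaries G r F d i =
     tensor_map G r (F i) (d (Suc i)) id ` carrier (lr_tensor G r (F (Suc i)))"

definition reduced_lr_homology ::
  "('g, 'm) monoid_scheme \<Rightarrow> real \<Rightarrow> (nat \<Rightarrow> ('g \<Rightarrow>\<^sub>0 int, 'a) module) \<Rightarrow> (nat \<Rightarrow> 'a \<Rightarrow> 'a) \<Rightarrow>
     nat \<Rightarrow> ('a \<times> ('g \<Rightarrow> complex) \<Rightarrow>\<^sub>0 int) set set ctvs" where
  "reduced_lr_homology G r F d i =
     quotient_ctvs (subspace_ctvs (lr_tensor G r (F i)) (lr_cycles G r F d i))
       (topo (lr_tensor G r (F i)) closure_of lr_boundaries G r F d i)"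

definition lr_cocycles ::
  "('g, 'm) monoid_scheme \<Rightarrow> real \<Rightarrow> (nat \<Rightarrow> ('g \<Rightarrow>\<^sub>0 int, 'a) module) \<Rightarrow> (nat \<Rightarrow> 'a \<Rightarrow> 'a) \<Rightarrow>
     nat \<Rightarrow> ('a \<Rightarrow> 'g \<Rightarrow> complex) set" where
  "lr_cocycles G r F d i =
     a_kernel (lr_hom G r (F i)) (lr_hom G r (F (Suc i)))
       (\<lambda>\<phi>. compose (carrier (F (Suc i))) \<phi> (d (Suc i)))"

definition lr_coboundaries ::
  "('g, 'm) monoid_scheme \<Rightarrow> real \<Rightarrow> (nat \<Rightarrow> ('g \<Rightarrow>\<^sub>0 int, 'a) module) \<Rightarrow> (nat \<Rightarrow> 'a \<Rightarrow> 'a) \<Rightarrow>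
     nat \<Rightarrow> ('a \<Rightarrow> 'g \<Rightarrow> complex) set" where
  "lr_coboundaries G r F d i =
     (case i of
        0 \<Rightarrow> {\<zero>\<^bsub>lr_hom G r (F 0)\<^esub>}
      | Suc j \<Rightarrow> (\<lambda>\<phi>. compose (carrier (F i)) \<phi> (d i)) ` carrier (lr_hom G r (F j)))"

definition reduced_lr_cohomology ::
  "('g, 'm) monoid_scheme \<Rightarrow> real \<Rightarrow> (nat \<Rightarrow> ('g \<Rightarrow>\<^sub>0 int, 'a) module) \<Rightarrow> (nat \<Rightarrow> 'a \<Rightarrow> 'a) \<Rightarrow>
     nat \<Rightarrow> ('a \<Rightarrow> 'g \<Rightarrow> complex) set ctvs" where
  "reduced_lr_cohomology G r F d i =
     quotient_ctvs (subspace_ctvs (lr_hom G r (F i)) (lr_cocycles G r F d i))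
       (topo (lr_hom G r (F i)) closure_of lr_coboundaries G r F d i)"

end

theory Submission
  imports Defs
begin

text \<open>
  A finitely generated projective module \<open>F\<^sub>i\<close> has a finite dual basis \<open>S\<close>.  It realises
  \<open>F\<^sub>i \<otimes> \<ell>\<^sup>q(G)\<close> and \<open>Hom(F\<^sub>i, \<ell>\<^sup>p(G))\<close> as complemented subspaces of \<open>\<ell>\<^sup>q(S \<times> G)\<close> and
  \<open>\<ell>\<^sup>p(S \<times> G)\<close>, in duality under \<open>\<langle>\<phi>, x \<otimes> f\<rangle> = \<Sum>g. \<phi>(x)(g) f(g)\<close>; the boundary and
  coboundary operators are adjoint.  Hence cocycles are the annihilator of the boundaries and cycles
  the annihilator of the coboundaries, and the theorem becomes the duality of subquotients
  \<open>B\<^sup>\<bottom> / cl C \<cong> (C\<^sup>\<bottom> / cl B)'\<close> for subspaces \<open>B\<close>, \<open>C\<close> that annihilate each other.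

  This needs the representation, with norm control, of functionals on closed subspaces, and the
  separation of points from closed subspaces, by elements of the dual \<open>\<ell>\<close>-space.  Both come from
  uniform convexity: a closed affine subspace has a point \<open>y\<close> of minimal norm, and
  \<open>|y|\<^bsup>r-2\<^esup> cnj y\<close> annihilates its direction.  No Hahn-Banach theorem is required.
\<close>

section \<open>The spaces of \<open>r\<close>-summable families\<close>

text \<open>What shapes the proof is that only \<open>F 0\<close>, ..., \<open>F n\<close> are
  finitely generated. For \<open>i = n\<close> the chains and cochains of \<open>F (Suc i)\<close>
  have no coordinates, so cocycles are recognised by testing boundaries of single tensors
  \<open>x \<otimes> f\<close>, using that the pairing of the two \<open>\<ell>\<close>-spaces of
  \<open>G\<close> is nondegenerate. Cycles, in contrast, are recognised through a dual basis of
  \<open>F (i - 1)\<close>. The topologies to be compared are defined without norms (a final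
  topology, pointwise convergence, uniform convergence on bounded sets); each has to be identified
  with a norm topology of coordinates or of the dual norm. Continuity of the inverse duality map is
  then read off from explicit constants: a functional of norm at most \<open>M\<close> is
  represented by an element of norm at most \<open>D * M\<close>, where \<open>D\<close> is the
  price of projecting \<open>\<ell>\<^sup>p(S \<times> G)\<close> onto the homomorphisms. All
  statements on conjugate exponents are available for \<open>(q, p)\<close> too: functionals on
  tensors are represented with the exponents exchanged, homomorphisms are separated with the
  original order.\<close>

definition ell :: "real \<Rightarrow> 'i set \<Rightarrow> ('i \<Rightarrow> complex) set" where
  "ell r I = {f. (\<forall>i. i \<notin> I \<longrightarrow> f i = 0) \<and> (\<lambda>i. cmod (f i) powr r) summable_on I}"

definition ell_norm :: "real \<Rightarrow> 'i set \<Rightarrow> ('i \<Rightarrow> complex) \<Rightarrow> real" where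
  "ell_norm r I f = (\<Sum>\<^sub>\<infinity>i\<in>I. cmod (f i) powr r) powr (1 / r)"

lemma ell_outside: "f \<in> ell r I \<Longrightarrow> i \<notin> I \<Longrightarrow> f i = 0"
  by (simp add: ell_def)

lemma ell_summable: "f \<in> ell r I \<Longrightarrow> (\<lambda>i. cmod (f i) powr r) summable_on I"
  by (simp add: ell_def)

lemma ell_norm_nonneg [simp]: "0 \<le> ell_norm r I f"
  by (simp add: ell_norm_def)

lemma ell_norm_powr: "r \<noteq> 0 \<Longrightarrow> ell_norm r I f powr r = (\<Sum>\<^sub>\<infinity>i\<in>I. cmod (f i) powr r)"
  by (simp add: ell_norm_def powr_powr infsum_nonneg)

lemma ell_zero [simp]: "(\<lambda>i. 0) \<in> ell r I"
  by (simp add: ell_def)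

lemma ell_norm_zero [simp]: "ell_norm r I (\<lambda>i. 0) = 0"
  by (simp add: ell_norm_def)

lemma ell_scale: "f \<in> ell r I \<Longrightarrow> (\<lambda>i. c * f i) \<in> ell r I"
  by (auto simp: ell_def norm_mult powr_mult intro!: summable_on_cmult_right)

lemma ell_norm_scale: "r \<noteq> 0 \<Longrightarrow> ell_norm r I (\<lambda>i. c * f i) = cmod c * ell_norm r I f"
proof -
  assume r: "r \<noteq> 0"
  have "(\<Sum>\<^sub>\<infinity>i\<in>I. cmod (c * f i) powr r) = cmod c powr r * (\<Sum>\<^sub>\<infinity>i\<in>I. cmod (f i) powr r)"
    by (simp add: norm_mult powr_mult infsum_cmult_right')
  then show ?thesis
    using r by (simp add: ell_norm_def powr_mult powr_powr infsum_nonneg)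
qed

lemma ell_norm_uminus: "ell_norm r I (\<lambda>i. - f i) = ell_norm r I f"
  by (simp add: ell_norm_def)

lemma ell_norm_minus_commute: "ell_norm r I (\<lambda>i. f i - g i) = ell_norm r I (\<lambda>i. g i - f i)"
  by (simp add: ell_norm_def norm_minus_commute)

lemma sum_le_ell_norm:
  assumes "f \<in> ell r I" "r \<noteq> 0" "finite F" "F \<subseteq> I"
  shows "(\<Sum>i\<in>F. cmod (f i) powr r) \<le> ell_norm r I f powr r"
  unfolding ell_norm_powr[OF assms(2)]
  by (rule finite_sum_le_infsum) (use assms ell_summable in auto)

lemma powr_le_cancel:
  fixes x y :: real
  assumes "x powr r \<le> y powr r" "0 \<le> x" "0 \<le> y" "0 < r" shows "x \<le> y"
  using assms by (smt (verit) powr_less_mono2)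

lemma norm_le_ell_norm:
  assumes "f \<in> ell r I" "0 < r"
  shows "cmod (f i) \<le> ell_norm r I f"
proof (cases "i \<in> I")
  case True
  then have "cmod (f i) powr r \<le> ell_norm r I f powr r"
    using sum_le_ell_norm[of f r I "{i}"] assms by simp
  then show ?thesis
    using assms by (auto intro: powr_le_cancel)
qed (use assms ell_outside in \<open>simp add: ell_outside\<close>)

lemma ell_norm_eq_0D: "f \<in> ell r I \<Longrightarrow> 0 < r \<Longrightarrow> ell_norm r I f = 0 \<Longrightarrow> f = (\<lambda>i. 0)"
  using norm_le_ell_norm[of f r I] by (simp add: fun_eq_iff)

text \<open>Bounds on all finite partial sums give membership and the norm estimate at once.
  Minkowski's inequality, completeness, slicing and assembling all enter through this form.\<close>

lemma ellI_bound:
  assumes "\<And>i. i \<notin> I \<Longrightarrow> f i = 0" "0 < r" "0 \<le> M"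
    and "\<And>F. finite F \<Longrightarrow> F \<subseteq> I \<Longrightarrow> (\<Sum>i\<in>F. cmod (f i) powr r) \<le> M powr r"
  shows "f \<in> ell r I" "ell_norm r I f \<le> M"
proof -
  have s: "(\<lambda>i. cmod (f i) powr r) summable_on I"
    by (rule nonneg_bdd_above_summable_on) (use assms in \<open>auto intro!: bdd_aboveI2\<close>)
  then show "f \<in> ell r I"
    using assms by (simp add: ell_def)
  have "ell_norm r I f powr r \<le> M powr r"
    using assms by (simp add: ell_norm_powr infsum_le_finite_sums[OF s])
  then show "ell_norm r I f \<le> M"
    using assms by (auto intro: powr_le_cancel)
qed

section \<open>Convexity of powers and the inequalities of Minkowski and Hoelder\<close>

text \<open>Young's inequality for the exponents \<open>r / (r - 1)\<close> and \<open>r\<close>.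
  Geometrically, the graph of \<open>t powr r\<close> lies above its tangent at
  \<open>x\<close>.\<close>

lemma powr_tangent:
  fixes x y r :: real
  assumes "1 < r" "0 \<le> x" "0 \<le> y"
  shows "r * (x powr (r - 1) * y) \<le> (r - 1) * x powr r + y powr r"
proof -
  have "1 / (r / (r - 1)) + 1 / r = 1" "1 < r / (r - 1)"
    using assms by (auto simp: field_simps)
  from Youngs_inequality[OF this(2) assms(1) this(1), of "x powr (r - 1)" y]
  have "x powr (r - 1) * y \<le> x powr r * (r - 1) / r + y powr r / r"
    using assms by (simp add: powr_powr)
  then have "r * (x powr (r - 1) * y) \<le> r * (x powr r * (r - 1) / r + y powr r / r)"
    using assms by (intro mult_left_mono) auto
  also have "\<dots> = (r - 1) * x powr r + y powr r"
    using assms by (simp add: field_simps)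
  finally show ?thesis .
qed

text \<open>The tangent inequality at the mean \<open>m\<close> is evaluated at \<open>x\<close> and
  \<open>y\<close> and averaged; on average the tangent takes the value
  \<open>m powr r\<close>.\<close>

lemma powr_convex_combination:
  fixes x y u v r :: real
  assumes "1 < r" "0 \<le> x" "0 \<le> y" "0 \<le> u" "0 \<le> v" "u + v = 1"
  shows "(u * x + v * y) powr r \<le> u * x powr r + v * y powr r"
proof -
  define m where "m = u * x + v * y"
  have m: "0 \<le> m" using assms by (simp add: m_def)
  have "r * m powr r = r * (m powr (r - 1) * m)"
    using m assms by (cases "m = 0") (auto simp: powr_mult_base mult.commute)
  also have "\<dots> = u * (r * (m powr (r - 1) * x)) + v * (r * (m powr (r - 1) * y))"
    by (simp add: m_def algebra_simps)
  also have "\<dots> \<le> u * ((r - 1) * m powr r + x powr r) + v * ((r - 1) * m powr r + y powr r)"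
    using assms m by (intro add_mono mult_left_mono powr_tangent) auto
  also have "\<dots> = (u + v) * (r - 1) * m powr r + (u * x powr r + v * y powr r)"
    by (simp add: algebra_simps)
  finally show ?thesis
    using assms by (simp add: m_def algebra_simps)
qed

text \<open>After division by the norms, \<open>f + g\<close> is compared pointwise with the convex
  combination of \<open>f / a\<close> and \<open>g / b\<close> with weights
  \<open>a / (a + b)\<close> and \<open>b / (a + b)\<close>; convexity of the power is then summed.
  Vanishing norms are settled separately because of the division.\<close>

lemma Minkowski:
  assumes "f \<in> ell r I" "g \<in> ell r I" "1 < r"
  shows "(\<lambda>i. f i + g i) \<in> ell r I"
    and "ell_norm r I (\<lambda>i. f i + g i) \<le> ell_norm r I f + ell_norm r I g"
proof -
  define a b where "a = ell_norm r I f" and "b = ell_norm r I g"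
  have ab: "0 \<le> a" "0 \<le> b" by (simp_all add: a_def b_def)
  have main: "(\<Sum>i\<in>F. cmod (f i + g i) powr r) \<le> (a + b) powr r" if F: "finite F" "F \<subseteq> I" for F
  proof (cases "a = 0 \<or> b = 0")
    case True
    then have "f = (\<lambda>i. 0) \<or> g = (\<lambda>i. 0)"
      using assms ell_norm_eq_0D[of f r I] ell_norm_eq_0D[of g r I] by (auto simp: a_def b_def)
    then show ?thesis
      using sum_le_ell_norm[OF assms(1) _ F] sum_le_ell_norm[OF assms(2) _ F] assms(3)
      by (auto simp: a_def b_def)
  next
    case False
    then have pos: "0 < a" "0 < b" using ab by auto
    let ?c = "a + b"
    have "cmod (f i + g i) powr r \<le> ?c powr r * (a / ?c * (cmod (f i) / a) powr r + b / ?c * (cmod (g i) / b) powr r)" for i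
    proof -
      have "cmod (f i + g i) \<le> cmod (f i) + cmod (g i)" by (rule norm_triangle_ineq)
      also have "\<dots> = ?c * (a / ?c * (cmod (f i) / a) + b / ?c * (cmod (g i) / b))"
      proof -
        have "a / ?c * (cmod (f i) / a) = cmod (f i) / ?c" "b / ?c * (cmod (g i) / b) = cmod (g i) / ?c"
          using pos by simp_all
        with pos show ?thesis by (simp flip: add_divide_distrib)
      qed
      finally have "cmod (f i + g i) powr r \<le> (?c * (a / ?c * (cmod (f i) / a) + b / ?c * (cmod (g i) / b))) powr r"
        using assms by (intro powr_mono2) auto
      also have "\<dots> = ?c powr r * (a / ?c * (cmod (f i) / a) + b / ?c * (cmod (g i) / b)) powr r"
        using pos by (simp add: powr_mult)
      also have "\<dots> \<le> ?c powr r * (a / ?c * (cmod (f i) / a) powr r + b / ?c * (cmod (g i) / b) powr r)"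
        using pos assms
        by (intro mult_left_mono powr_convex_combination) (simp_all flip: add_divide_distrib)
      finally show ?thesis .
    qed
    then have "(\<Sum>i\<in>F. cmod (f i + g i) powr r)
        \<le> (\<Sum>i\<in>F. ?c powr r * (a / ?c * (cmod (f i) / a) powr r + b / ?c * (cmod (g i) / b) powr r))"
      by (intro sum_mono) auto
    also have "\<dots> = ?c powr r * (a / ?c * ((\<Sum>i\<in>F. cmod (f i) powr r) / a powr r)
        + b / ?c * ((\<Sum>i\<in>F. cmod (g i) powr r) / b powr r))"
      using pos by (simp add: powr_divide sum_distrib_left sum.distrib sum_divide_distrib
          algebra_simps)
    also have "\<dots> \<le> ?c powr r * (a / ?c * 1 + b / ?c * 1)"
    proof -
      have "(\<Sum>i\<in>F. cmod (f i) powr r) / a powr r \<le> 1" "(\<Sum>i\<in>F. cmod (g i) powr r) / b powr r \<le> 1"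
        using sum_le_ell_norm[OF assms(1) _ F] sum_le_ell_norm[OF assms(2) _ F] assms(3) pos
        by (simp_all add: a_def b_def divide_le_eq)
      then show ?thesis
        using pos by (intro mult_left_mono add_mono) auto
    qed
    also have "\<dots> = ?c powr r"
      using pos by (simp flip: add_divide_distrib)
    finally show ?thesis .
  qed
  have "f i + g i = 0" if "i \<notin> I" for i
    using assms that by (simp add: ell_outside)
  from ellI_bound[OF this _ _ main] show "(\<lambda>i. f i + g i) \<in> ell r I"
    and "ell_norm r I (\<lambda>i. f i + g i) \<le> ell_norm r I f + ell_norm r I g"
    using assms ab by (auto simp: a_def b_def)
qed

lemmas ell_add = Minkowski(1)
lemmas ell_norm_add_le = Minkowski(2)

lemma ell_diff: "f \<in> ell r I \<Longrightarrow> g \<in> ell r I \<Longrightarrow> 1 < r \<Longrightarrow> (\<lambda>i. f i - g i) \<in> ell r I"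
  using ell_add[of f r I "\<lambda>i. - g i"] ell_scale[of g r I "-1"] by simp

lemma ell_norm_triangle:
  assumes "f \<in> ell r I" "g \<in> ell r I" "h \<in> ell r I" "1 < r"
  shows "ell_norm r I (\<lambda>i. f i - h i) \<le> ell_norm r I (\<lambda>i. f i - g i) + ell_norm r I (\<lambda>i. g i - h i)"
  using ell_norm_add_le[OF ell_diff[OF assms(1,2,4)] ell_diff[OF assms(2,3,4)] assms(4)] by simp

lemma ell_norm_le_diff:
  assumes "f \<in> ell r I" "g \<in> ell r I" "1 < r"
  shows "ell_norm r I f \<le> ell_norm r I (\<lambda>i. f i - g i) + ell_norm r I g"
  using ell_norm_add_le[OF ell_diff[OF assms] assms(2,3)] by simp

lemma ell_sum:
  assumes "\<And>s. s \<in> S \<Longrightarrow> f s \<in> ell r I" "1 < r"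
  shows "(\<lambda>i. \<Sum>s\<in>S. f s i) \<in> ell r I"
    and "ell_norm r I (\<lambda>i. \<Sum>s\<in>S. f s i) \<le> (\<Sum>s\<in>S. ell_norm r I (f s))"
proof -
  have "(\<lambda>i. \<Sum>s\<in>S. f s i) \<in> ell r I \<and>
    ell_norm r I (\<lambda>i. \<Sum>s\<in>S. f s i) \<le> (\<Sum>s\<in>S. ell_norm r I (f s))"
    using assms(1)
  proof (induction S rule: infinite_finite_induct)
    case (insert s S)
    then have "f s \<in> ell r I" "(\<lambda>i. \<Sum>s\<in>S. f s i) \<in> ell r I"
      "ell_norm r I (\<lambda>i. \<Sum>s\<in>S. f s i) \<le> (\<Sum>s\<in>S. ell_norm r I (f s))"
      by auto
    with insert(1,2) Minkowski[OF this(1,2) assms(2)] show ?case by simp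
  qed auto
  then show "(\<lambda>i. \<Sum>s\<in>S. f s i) \<in> ell r I"
    and "ell_norm r I (\<lambda>i. \<Sum>s\<in>S. f s i) \<le> (\<Sum>s\<in>S. ell_norm r I (f s))" by auto
qed

text \<open>Both families are normalised and Young's inequality is summed over finite sets;
  \<open>1 / p + 1 / q\<close> is the resulting total.\<close>

lemma Hoelder:
  assumes f: "f \<in> ell p I" and g: "g \<in> ell q I" and pq: "1 < p" "1 < q" "1 / p + 1 / q = 1"
  shows "(\<lambda>i. cmod (f i * g i)) summable_on I"
    and "(\<Sum>\<^sub>\<infinity>i\<in>I. cmod (f i * g i)) \<le> ell_norm p I f * ell_norm q I g"
proof -
  define a b where "a = ell_norm p I f" and "b = ell_norm q I g"
  have ab: "0 \<le> a" "0 \<le> b" by (simp_all add: a_def b_def)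
  have main: "(\<Sum>i\<in>F. cmod (f i * g i)) \<le> a * b" if F: "finite F" "F \<subseteq> I" for F
  proof (cases "a = 0 \<or> b = 0")
    case True
    then have "f = (\<lambda>i. 0) \<or> g = (\<lambda>i. 0)"
      using assms ell_norm_eq_0D[of f p I] ell_norm_eq_0D[of g q I] by (auto simp: a_def b_def)
    then show ?thesis using ab by auto
  next
    case False
    then have pos: "0 < a" "0 < b" using ab by auto
    have "(\<Sum>i\<in>F. cmod (f i * g i)) = a * b * (\<Sum>i\<in>F. (cmod (f i) / a) * (cmod (g i) / b))"
      using pos by (simp add: norm_mult sum_distrib_left)
    also have "\<dots> \<le> a * b * (\<Sum>i\<in>F. (cmod (f i) / a) powr p / p + (cmod (g i) / b) powr q / q)"
      using pos by (intro mult_left_mono sum_mono Youngs_inequality pq) auto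
    also have "(\<Sum>i\<in>F. (cmod (f i) / a) powr p / p + (cmod (g i) / b) powr q / q)
        = (\<Sum>i\<in>F. cmod (f i) powr p) / a powr p / p + (\<Sum>i\<in>F. cmod (g i) powr q) / b powr q / q"
      using pos by (simp add: powr_divide sum.distrib sum_divide_distrib)
    also have "a * b * \<dots> \<le> a * b * (1 / p + 1 / q)"
    proof -
      have "(\<Sum>i\<in>F. cmod (f i) powr p) / a powr p \<le> 1" "(\<Sum>i\<in>F. cmod (g i) powr q) / b powr q \<le> 1"
        using sum_le_ell_norm[OF f _ F] sum_le_ell_norm[OF g _ F] pq pos
        by (simp_all add: a_def b_def divide_le_eq)
      then show ?thesis
        using pos pq by (intro mult_left_mono add_mono divide_right_mono) auto
    qed
    finally show ?thesis using pq by simp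
  qed
  show s: "(\<lambda>i. cmod (f i * g i)) summable_on I"
    by (rule nonneg_bdd_above_summable_on) (use main in \<open>auto intro!: bdd_aboveI2\<close>)
  show "(\<Sum>\<^sub>\<infinity>i\<in>I. cmod (f i * g i)) \<le> ell_norm p I f * ell_norm q I g"
    using main by (intro infsum_le_finite_sums[OF s]) (auto simp: a_def b_def)
qed

section \<open>The bilinear pairing for conjugate exponents\<close>

text \<open>Without complex conjugation the pairing is bilinear, and the duality it induces is
  linear rather than antilinear. The conjugate is instead built into
  \<open>dual_elt\<close>.\<close>

definition ell_pair :: "'i set \<Rightarrow> ('i \<Rightarrow> complex) \<Rightarrow> ('i \<Rightarrow> complex) \<Rightarrow> complex" where
  "ell_pair I f g = (\<Sum>\<^sub>\<infinity>i\<in>I. f i * g i)"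

lemma ell_pair_commute: "ell_pair I f g = ell_pair I g f"
  by (simp add: ell_pair_def mult.commute)

locale conjugate_exponents =
  fixes p q :: real
  assumes p1: "1 < p" and pq: "1 / p + 1 / q = 1"
begin

lemma q1: "1 < q"
proof -
  have "1 / q = 1 - 1 / p" "0 < 1 - 1 / p" "1 - 1 / p < 1" using pq p1 by auto
  then show ?thesis by (metis divide_less_eq_1_pos zero_less_divide_1_iff)
qed

text \<open>With commutativity of the pairing, this turns every fact about the right argument, or
  about functionals on one of the spaces, into its mirror image.\<close>

lemma swap: "conjugate_exponents q p"
  using pq q1 by unfold_locales auto

lemma q_eq: "(p - 1) * q = p" "q = p / (p - 1)"
  using pq p1 q1 by (auto simp: field_simps)

lemma pair_summable:
  assumes "f \<in> ell p I" "g \<in> ell q I"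
  shows "(\<lambda>i. f i * g i) summable_on I"
  using Hoelder(1)[OF assms p1 q1 pq] by (rule abs_summable_summable)

lemma pair_le:
  assumes "f \<in> ell p I" "g \<in> ell q I"
  shows "cmod (ell_pair I f g) \<le> ell_norm p I f * ell_norm q I g"
proof -
  have "cmod (ell_pair I f g) \<le> (\<Sum>\<^sub>\<infinity>i\<in>I. cmod (f i * g i))"
    unfolding ell_pair_def using Hoelder(1)[OF assms p1 q1 pq] by (rule norm_infsum_bound)
  with Hoelder(2)[OF assms p1 q1 pq] show ?thesis by linarith
qed

lemma pair_add_right:
  assumes "f \<in> ell p I" "g \<in> ell q I" "h \<in> ell q I"
  shows "ell_pair I f (\<lambda>i. g i + h i) = ell_pair I f g + ell_pair I f h"
  unfolding ell_pair_def
  using infsum_add[OF pair_summable[OF assms(1,2)] pair_summable[OF assms(1,3)]]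
  by (simp add: algebra_simps)

lemma pair_scale_right: "ell_pair I f (\<lambda>i. c * g i) = c * ell_pair I f g"
  unfolding ell_pair_def by (simp add: mult.left_commute infsum_cmult_right')

lemma pair_diff_right:
  assumes "f \<in> ell p I" "g \<in> ell q I" "h \<in> ell q I"
  shows "ell_pair I f (\<lambda>i. g i - h i) = ell_pair I f g - ell_pair I f h"
  using pair_add_right[OF assms(1,2) ell_scale[OF assms(3), of "-1"]]
    pair_scale_right[of I f "-1" h] by simp

lemma pair_sum_right:
  assumes "f \<in> ell p I" "\<And>s. s \<in> S \<Longrightarrow> g s \<in> ell q I"
  shows "ell_pair I f (\<lambda>i. \<Sum>s\<in>S. g s i) = (\<Sum>s\<in>S. ell_pair I f (g s))"
  using assms(2)
proof (induction S rule: infinite_finite_induct)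
  case (insert s S)
  then show ?case
    using pair_add_right[OF assms(1), of "g s" "\<lambda>i. \<Sum>s\<in>S. g s i"] ell_sum(1)[of S g q I] q1
    by simp
qed (simp_all add: ell_pair_def)

end

lemma ell_pair_zero [simp]: "ell_pair I (\<lambda>i. 0) g = 0" "ell_pair I f (\<lambda>i. 0) = 0"
  by (simp_all add: ell_pair_def)

text \<open>The pointwise limit exists because the norm dominates each coordinate. The Cauchy
  estimate survives in every finite partial sum and hence for the limit, as in Fatou's
  lemma.\<close>

lemma ell_complete:
  assumes x: "\<And>n::nat. x n \<in> ell r I" and r: "1 < r"
    and Cauchy: "\<And>e. 0 < e \<Longrightarrow> \<exists>N. \<forall>m\<ge>N. \<forall>n\<ge>N. ell_norm r I (\<lambda>i. x m i - x n i) < e"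
  obtains y where "y \<in> ell r I" "(\<lambda>n. ell_norm r I (\<lambda>i. x n i - y i)) \<longlonglongrightarrow> 0"
proof -
  define y where "y = (\<lambda>i. lim (\<lambda>n. x n i))"
  have y: "(\<lambda>n. x n i) \<longlonglongrightarrow> y i" for i
  proof -
    have "Cauchy (\<lambda>n. x n i)"
    proof (rule CauchyI)
      fix e :: real assume "0 < e"
      then obtain N where N: "\<forall>m\<ge>N. \<forall>n\<ge>N. ell_norm r I (\<lambda>i. x m i - x n i) < e"
        using Cauchy by blast
      have "cmod (x m i - x n i) \<le> ell_norm r I (\<lambda>i. x m i - x n i)" for m n
        using norm_le_ell_norm[OF ell_diff[OF x x r], where i = i] r by simp
      with N show "\<exists>N. \<forall>m\<ge>N. \<forall>n\<ge>N. norm (x m i - x n i) < e"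
        by (meson order_le_less_trans)
    qed
    then show ?thesis
      by (simp add: y_def Cauchy_convergent_iff convergent_LIMSEQ_iff)
  qed
  have tail: "\<exists>N. \<forall>n\<ge>N. (\<lambda>i. x n i - y i) \<in> ell r I \<and> ell_norm r I (\<lambda>i. x n i - y i) \<le> e"
    if e: "0 < e" for e
  proof -
    obtain N where N: "\<forall>m\<ge>N. \<forall>n\<ge>N. ell_norm r I (\<lambda>i. x m i - x n i) < e"
      using Cauchy e by blast
    have "(\<lambda>i. x n i - y i) \<in> ell r I \<and> ell_norm r I (\<lambda>i. x n i - y i) \<le> e" if n: "n \<ge> N" for n
    proof -
      have 1: "x n i - y i = 0" if "i \<notin> I" for i
      proof -
        have "x n i = 0" for n using x[of n] that by (rule ell_outside)
        then have "(\<lambda>n. x n i) = (\<lambda>n. 0)" by auto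
        then have "y i = 0" using y[of i] by (metis LIMSEQ_unique tendsto_const)
        then show ?thesis using ell_outside[OF x that, of n] by simp
      qed
      have 2: "(\<Sum>i\<in>F. cmod (x n i - y i) powr r) \<le> e powr r" if F: "finite F" "F \<subseteq> I" for F
      proof (rule tendsto_upperbound)
        show "(\<lambda>m. \<Sum>i\<in>F. cmod (x n i - x m i) powr r) \<longlonglongrightarrow> (\<Sum>i\<in>F. cmod (x n i - y i) powr r)"
          using r by (intro tendsto_sum tendsto_powr' tendsto_intros y) auto
        have "(\<Sum>i\<in>F. cmod (x n i - x m i) powr r) \<le> e powr r" if "m \<ge> N" for m
        proof -
          have "(\<Sum>i\<in>F. cmod (x n i - x m i) powr r) \<le> ell_norm r I (\<lambda>i. x n i - x m i) powr r"
            using sum_le_ell_norm[OF ell_diff[OF x x r] _ F] r by simp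
          also have "\<dots> \<le> e powr r"
            using N n that r by (intro powr_mono2) (auto intro: less_imp_le)
          finally show ?thesis .
        qed
        then show "\<forall>\<^sub>F m in sequentially. (\<Sum>i\<in>F. cmod (x n i - x m i) powr r) \<le> e powr r"
          by (auto simp: eventually_sequentially)
      qed simp
      show ?thesis using ellI_bound[OF 1 _ _ 2] r e by auto
    qed
    then show ?thesis by blast
  qed
  obtain n where n: "(\<lambda>i. x n i - y i) \<in> ell r I" using tail[of 1] by auto
  have "y \<in> ell r I" using ell_diff[OF x[of n] n r] by simp
  moreover have "(\<lambda>n. ell_norm r I (\<lambda>i. x n i - y i)) \<longlonglongrightarrow> 0"
  proof (rule LIMSEQ_I)
    fix e :: real assume "0 < e"
    with tail[of "e/2"] show "\<exists>N. \<forall>n\<ge>N. norm (ell_norm r I (\<lambda>i. x n i - y i) - 0) < e"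
      by fastforce
  qed
  ultimately show ?thesis by (rule that)
qed

section \<open>Uniform convexity and points of minimal norm\<close>

text \<open>Mean value theorem on both halves of the interval, and strict monotonicity of the
  derivative. Differentiability is used in the open intervals only, so \<open>x = 0\<close> is
  covered.\<close>

lemma powr_midpoint_strict:
  fixes x y r :: real
  assumes "1 < r" "0 \<le> x" "x < y"
  shows "((x + y) / 2) powr r < (x powr r + y powr r) / 2"
proof -
  define m where "m = (x + y) / 2"
  have m: "x < m" "m < y" using assms by (auto simp: m_def)
  have mvt: "\<exists>z. u < z \<and> z < v \<and> v powr r - u powr r = (v - u) * (r * z powr (r - 1))"
    if uv: "0 \<le> u" "u < v" for u v :: real
  proof -
    have d: "((\<lambda>t. t powr r) has_real_derivative r * t powr (r - 1)) (at t)" if "u < t" for t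
      using that uv by (intro has_real_derivative_powr) auto
    have "continuous_on {u..v} (\<lambda>t. t powr r)"
      using assms uv by (intro continuous_on_powr' continuous_intros) auto
    moreover have "(\<lambda>t. t powr r) differentiable (at t)" if "u < t" for t
      using d[OF that] real_differentiable_def by blast
    ultimately obtain l z where z: "u < z" "z < v" "((\<lambda>t. t powr r) has_real_derivative l) (at z)"
      "v powr r - u powr r = (v - u) * l"
      using MVT[OF uv(2)] by blast
    then have "l = r * z powr (r - 1)" using d by (blast intro: DERIV_unique)
    with z show ?thesis by blast
  qed
  obtain s where s: "x < s" "s < m" "m powr r - x powr r = (m - x) * (r * s powr (r - 1))"
    using mvt[of x m] m assms by auto
  obtain t where t: "m < t" "t < y" "y powr r - m powr r = (y - m) * (r * t powr (r - 1))"
    using mvt[of m y] m assms by auto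
  have "s powr (r - 1) < t powr (r - 1)"
    using s t assms by (intro powr_less_mono2) auto
  then have "(m - x) * (r * s powr (r - 1)) < (m - x) * (r * t powr (r - 1))"
    using m assms by auto
  moreover have "y - m = m - x" by (simp add: m_def field_simps)
  ultimately have "m powr r - x powr r < y powr r - m powr r"
    using s(3) t(3) by metis
  then show ?thesis by (simp add: m_def)
qed

text \<open>For equal moduli the parallelogram law makes the midpoint strictly shorter; for
  different moduli strictness comes from the real power function.\<close>

lemma cmod_midpoint_strict:
  fixes a b :: complex
  assumes "1 < r" "a \<noteq> b"
  shows "cmod ((a + b) / 2) powr r < (cmod a powr r + cmod b powr r) / 2"
proof (cases "cmod a = cmod b")
  case True
  have "(cmod (a + b))\<^sup>2 + (cmod (a - b))\<^sup>2 = 2 * (cmod a)\<^sup>2 + 2 * (cmod b)\<^sup>2"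
    unfolding cmod_power2 by (simp add: power2_eq_square algebra_simps)
  moreover have "0 < (cmod (a - b))\<^sup>2" using assms by simp
  ultimately have "(cmod (a + b))\<^sup>2 < 2 * (cmod a)\<^sup>2 + 2 * (cmod b)\<^sup>2"
    by linarith
  then have "(cmod (a + b))\<^sup>2 < (2 * cmod a)\<^sup>2"
    using True by (simp add: power_mult_distrib)
  then have "cmod (a + b) < 2 * cmod a"
    by (rule power_less_imp_less_base) simp
  then have "cmod ((a + b) / 2) powr r < cmod a powr r"
    using assms by (intro powr_less_mono2) (auto simp: norm_divide)
  then show ?thesis using True by simp
next
  case False
  have "cmod ((a + b) / 2) powr r \<le> ((cmod a + cmod b) / 2) powr r"
    using assms norm_triangle_ineq[of a b] by (intro powr_mono2) (auto simp: norm_divide)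
  also have "\<dots> < (cmod a powr r + cmod b powr r) / 2"
    using False powr_midpoint_strict[OF assms(1), of "cmod a" "cmod b"]
      powr_midpoint_strict[OF assms(1), of "cmod b" "cmod a"] by (cases "cmod a < cmod b") (auto simp: add.commute)
  finally show ?thesis .
qed

text \<open>
  By homogeneity it suffices to consider the unit sphere of \<open>\<complex>\<^sup>2\<close>, where the inequality is a
  matter of compactness and strict convexity.  Being pointwise, it sums up to uniform convexity.
\<close>

lemma powr_uniform_convexity:
  fixes r e :: real
  assumes r: "1 < r" and e: "0 < e"
  obtains C where "0 \<le> C" and "\<And>a b :: complex. cmod (a - b) powr r \<le>
    e * (cmod a powr r + cmod b powr r) + C * ((cmod a powr r + cmod b powr r) / 2 - cmod ((a + b) / 2) powr r)"
proof -
  define S where "S = (\<lambda>z :: complex \<times> complex. cmod (fst z) powr r + cmod (snd z) powr r)"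
  \<comment> \<open>\<open>D\<close> is the midpoint defect. Like \<open>S\<close> it is homogeneous
    of degree \<open>r\<close>, which permits the later reduction to \<open>S z = 1\<close>.\<close>
  define D where "D = (\<lambda>z :: complex \<times> complex. S z / 2 - cmod ((fst z + snd z) / 2) powr r)"
  \<comment> \<open>Outside this part of the sphere the \<open>e\<close>-term alone gives the
    estimate; on it the two components differ, so \<open>D\<close> is positive.\<close>
  define K where "K = {z :: complex \<times> complex. S z = 1 \<and> e \<le> cmod (fst z - snd z) powr r}"
  have cont: "continuous_on UNIV S" "continuous_on UNIV D"
    "continuous_on UNIV (\<lambda>z :: complex \<times> complex. cmod (fst z - snd z) powr r)"
    using r unfolding S_def D_def by (auto intro!: continuous_intros continuous_on_powr')
  have le1: "cmod (fst z) \<le> 1" "cmod (snd z) \<le> 1" if "S z = 1" for z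
  proof -
    have "cmod (fst z) powr r \<le> 1 powr r" "cmod (snd z) powr r \<le> 1 powr r"
      using that unfolding S_def by (smt (verit) powr_ge_zero powr_one_eq_one)+
    then show "cmod (fst z) \<le> 1" "cmod (snd z) \<le> 1"
      using r by (auto intro: powr_le_cancel)
  qed
  have K: "compact K"
    unfolding compact_eq_bounded_closed
  proof
    have "cmod (fst z) + cmod (snd z) \<le> 2" if "z \<in> K" for z
      using le1[of z] that by (simp add: K_def)
    then have "norm z \<le> 2" if "z \<in> K" for z
      using norm_Pair_le[of "fst z" "snd z"] that by (metis order_trans prod.collapse)
    then show "bounded K" unfolding bounded_iff by blast
    show "closed K"
      unfolding K_def by (intro closed_Collect_conj closed_Collect_eq closed_Collect_le cont continuous_intros)
  qed
  have D_nonneg: "0 \<le> D z" for z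
    using cmod_midpoint_strict[OF r, of "fst z" "snd z"]
    by (cases "fst z = snd z") (auto simp: D_def S_def)
  obtain C where C: "0 \<le> C" "\<And>z. z \<in> K \<Longrightarrow> 2 powr r \<le> C * D z"
  proof (cases "K = {}")
    case True
    then show ?thesis using that[of 0] by simp
  next
    case False
    obtain z0 where z0: "z0 \<in> K" "\<And>z. z \<in> K \<Longrightarrow> D z0 \<le> D z"
      using continuous_attains_inf[OF K False continuous_on_subset[OF cont(2)]] by auto
    have "fst z0 \<noteq> snd z0" using z0(1) e by (auto simp: K_def)
    then have "0 < D z0"
      using cmod_midpoint_strict[OF r, of "fst z0" "snd z0"] by (simp add: D_def S_def)
    \<comment> \<open>On the sphere both moduli are at most 1, so \<open>2 powr r\<close> bounds the
      left-hand side; dividing by the minimum of \<open>D\<close> on \<open>K\<close> gives the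
      constant.\<close>
    then show ?thesis
      using that[of "2 powr r / D z0"] z0(2) by (simp add: field_simps)
  qed
  have sphere: "cmod (fst z - snd z) powr r \<le> e + C * D z" if "S z = 1" for z
  proof (cases "z \<in> K")
    case True
    have "cmod (fst z - snd z) \<le> 2"
      using le1[OF that] norm_triangle_ineq4[of "fst z" "snd z"] by simp
    then have "cmod (fst z - snd z) powr r \<le> 2 powr r"
      using r by (intro powr_mono2) auto
    then show ?thesis using C(2)[OF True] e by linarith
  next
    case False
    then show ?thesis using that C(1) D_nonneg[of z] by (auto simp: K_def intro: add_increasing2)
  qed
  have "cmod (a - b) powr r \<le>
    e * (cmod a powr r + cmod b powr r) + C * ((cmod a powr r + cmod b powr r) / 2 - cmod ((a + b) / 2) powr r)"
    for a b :: complex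
  proof (cases "S (a, b) = 0")
    case True
    then have "cmod a powr r = 0" "cmod b powr r = 0"
      unfolding S_def fst_conv snd_conv by (smt (verit) powr_ge_zero)+
    then show ?thesis by simp
  next
    case False
    \<comment> \<open>The scaling factor that moves \<open>(a, b)\<close> to the sphere.\<close>
    define t where "t = S (a, b) powr (1 / r)"
    have Spos: "0 < S (a, b)" using False by (simp add: S_def less_le)
    then have t: "0 < t" "t powr r = S (a, b)" using r by (auto simp: t_def powr_powr)
    define a' b' where "a' = a / t" and "b' = b / t"
    have ab: "a = t * a'" "b = t * b'" using t by (auto simp: a'_def b'_def)
    have scale: "cmod (of_real t * z) powr r = S (a, b) * cmod z powr r" for z :: complex
      using t by (simp add: norm_mult powr_mult)
    have S1: "S (a, b) = S (a, b) * S (a', b')"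
    proof -
      have "S (a, b) = cmod (of_real t * a') powr r + cmod (of_real t * b') powr r"
        using ab by (simp add: S_def)
      also have "\<dots> = S (a, b) * S (a', b')" unfolding scale by (simp add: S_def distrib_left)
      finally show ?thesis .
    qed
    then have "cmod (a' - b') powr r \<le> e + C * D (a', b')"
      using sphere[of "(a', b')"] Spos by simp
    then have "S (a, b) * cmod (a' - b') powr r \<le> S (a, b) * (e + C * D (a', b'))"
      using Spos by (intro mult_left_mono) auto
    also have "\<dots> = e * S (a, b) + C * (S (a, b) * D (a', b'))" by (simp add: algebra_simps)
    also have "S (a, b) * D (a', b') = D (a, b)"
    proof -
      have "(a + b) / 2 = t * ((a' + b') / 2)" using ab by (simp add: algebra_simps add_divide_distrib)
      then have "D (a, b) = S (a, b) / 2 - S (a, b) * cmod ((a' + b') / 2) powr r"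
        by (simp only: D_def fst_conv snd_conv scale)
      also have "\<dots> = S (a, b) * D (a', b')"
        using S1 Spos by (simp add: D_def algebra_simps)
      finally show ?thesis by simp
    qed
    also have "S (a, b) * cmod (a' - b') powr r = cmod (a - b) powr r"
      using ab scale[of "a' - b'"] by (simp add: right_diff_distrib)
    finally show ?thesis by (simp add: D_def S_def)
  qed
  with C(1) show ?thesis by (rule that)
qed

text \<open>Stated for \<open>r\<close>-th powers with an error term instead of a modulus of
  convexity: along a minimising sequence the last bracket becomes negligible, while the
  \<open>e\<close>-term can be made as small as desired.\<close>

lemma ell_uniform_convexity:
  assumes r: "1 < r" and e: "0 < e"
  obtains C where "0 \<le> C" and "\<And>f g. f \<in> ell r I \<Longrightarrow> g \<in> ell r I \<Longrightarrow>
    ell_norm r I (\<lambda>i. f i - g i) powr r \<le>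
      e * (ell_norm r I f powr r + ell_norm r I g powr r)
      + C * ((ell_norm r I f powr r + ell_norm r I g powr r) / 2
             - ell_norm r I (\<lambda>i. (f i + g i) / 2) powr r)"
proof -
  obtain C where C: "0 \<le> C" "\<And>a b :: complex. cmod (a - b) powr r \<le>
    e * (cmod a powr r + cmod b powr r) + C * ((cmod a powr r + cmod b powr r) / 2 - cmod ((a + b) / 2) powr r)"
    using powr_uniform_convexity[OF assms] by blast
  have hs: "((\<lambda>i. cmod (f i) powr r) has_sum ell_norm r I f powr r) I" if "f \<in> ell r I" for f
    using ell_summable[OF that] r by (simp add: ell_norm_powr)
  show ?thesis
  proof (rule that[OF C(1)])
    fix f g assume fg: "f \<in> ell r I" "g \<in> ell r I"
    have d: "(\<lambda>i. f i - g i) \<in> ell r I" using ell_diff fg r by blast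
    have m: "(\<lambda>i. (f i + g i) / 2) \<in> ell r I"
      using ell_scale[OF ell_add[OF fg r], of "1/2"] by simp
    have "((\<lambda>i. e * (cmod (f i) powr r + cmod (g i) powr r)
        + C * ((1 / 2) * (cmod (f i) powr r + cmod (g i) powr r) + (- 1) * cmod ((f i + g i) / 2) powr r))
      has_sum (e * (ell_norm r I f powr r + ell_norm r I g powr r)
        + C * ((1 / 2) * (ell_norm r I f powr r + ell_norm r I g powr r)
               + (- 1) * ell_norm r I (\<lambda>i. (f i + g i) / 2) powr r))) I"
      by (intro has_sum_add has_sum_cmult_right hs fg m)
    from has_sum_mono[OF hs[OF d] this] C(2)
    show "ell_norm r I (\<lambda>i. f i - g i) powr r \<le>
      e * (ell_norm r I f powr r + ell_norm r I g powr r)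
      + C * ((ell_norm r I f powr r + ell_norm r I g powr r) / 2
             - ell_norm r I (\<lambda>i. (f i + g i) / 2) powr r)"
      by simp
  qed
qed

section \<open>Points of minimal norm in closed sets\<close>

text \<open>Spelled out by approximation, so that no topology on \<open>ell r I\<close> itself has
  to be formed.\<close>

definition ell_closed :: "real \<Rightarrow> 'i set \<Rightarrow> ('i \<Rightarrow> complex) set \<Rightarrow> bool" where
  "ell_closed r I K \<longleftrightarrow> K \<subseteq> ell r I \<and>
     (\<forall>x\<in>ell r I. (\<forall>e>0. \<exists>k\<in>K. ell_norm r I (\<lambda>i. x i - k i) < e) \<longrightarrow> x \<in> K)"

text \<open>Midpoints of members of \<open>K\<close> stay in \<open>K\<close> and have norm at least
  the infimum \<open>m\<close>. So late members of a minimising sequence have a small midpoint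
  defect, and uniform convexity makes the sequence Cauchy.\<close>

lemma min_norm_exists:
  assumes r: "1 < r" and K: "ell_closed r I K" "K \<noteq> {}"
    and mid: "\<And>x y. x \<in> K \<Longrightarrow> y \<in> K \<Longrightarrow> (\<lambda>i. (x i + y i) / 2) \<in> K"
  obtains y where "y \<in> K" "\<And>k. k \<in> K \<Longrightarrow> ell_norm r I y \<le> ell_norm r I k"
proof -
  define N where "N = ell_norm r I"
  define m where "m = Inf (N ` K)"
  have bdd: "bdd_below (N ` K)" by (rule bdd_belowI2[of _ 0]) (simp add: N_def)
  have m_le: "m \<le> N k" if "k \<in> K" for k
    unfolding m_def using that bdd by (rule cINF_lower[rotated])
  have m0: "0 \<le> m" unfolding m_def using K(2) by (intro cINF_greatest) (auto simp: N_def)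
  have "\<exists>x\<in>K. N x < m + 1 / real (Suc n)" for n
  proof -
    have "Inf (N ` K) < m + 1 / real (Suc n)" by (simp add: m_def)
    then show ?thesis using cInf_less_iff[of "N ` K"] bdd K(2) by auto
  qed
  then obtain x where x: "\<And>n. x n \<in> K" "\<And>n. N (x n) < m + 1 / real (Suc n)" by metis
  have xe: "x n \<in> ell r I" for n using x(1) K(1) by (auto simp: ell_closed_def)
  have lim: "(\<lambda>n. (m + 1 / real (Suc n)) powr r) \<longlonglongrightarrow> (m + 0) powr r"
    using r m0 by (intro tendsto_powr' tendsto_intros LIMSEQ_Suc[OF lim_1_over_n] ) auto
  have "\<exists>M. \<forall>j\<ge>M. \<forall>k\<ge>M. N (\<lambda>i. x j i - x k i) < \<eta>" if \<eta>: "0 < \<eta>" for \<eta>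
  proof -
    \<comment> \<open>Late norms are at most \<open>m + 1\<close>, so this \<open>e\<close> bounds
      the first term by \<open>\<eta> powr r / 2\<close>; \<open>M\<close> is then chosen so that
      the defect term stays below the other half.\<close>
    define e where "e = \<eta> powr r / (4 * (m + 1) powr r)"
    have e: "0 < e" using \<eta> m0 by (simp add: e_def)
    obtain C where C: "0 \<le> C" and ineq: "\<And>f g. f \<in> ell r I \<Longrightarrow> g \<in> ell r I \<Longrightarrow>
        N (\<lambda>i. f i - g i) powr r \<le> e * (N f powr r + N g powr r)
          + C * ((N f powr r + N g powr r) / 2 - N (\<lambda>i. (f i + g i) / 2) powr r)"
      using ell_uniform_convexity[OF r e, of I] unfolding N_def by blast
    have "(\<lambda>n. C * ((m + 1 / real (Suc n)) powr r - m powr r)) \<longlonglongrightarrow> C * ((m + 0) powr r - m powr r)"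
      by (intro tendsto_intros lim)
    then have "\<forall>\<^sub>F n in sequentially. C * ((m + 1 / real (Suc n)) powr r - m powr r) < \<eta> powr r / 2"
      using \<eta> by (intro order_tendstoD(2)) auto
    then obtain M where M: "C * ((m + 1 / real (Suc M)) powr r - m powr r) < \<eta> powr r / 2"
      by (auto simp: eventually_sequentially)
    have bd: "N (x j) powr r \<le> (m + 1 / real (Suc M)) powr r" "N (x j) powr r \<le> (m + 1) powr r"
      if "j \<ge> M" for j
    proof -
      have "N (x j) \<le> m + 1 / real (Suc j)" using x(2)[of j] by simp
      also have "1 / real (Suc j) \<le> 1 / real (Suc M)" using that by (intro divide_left_mono) auto
      finally have 1: "N (x j) \<le> m + 1 / real (Suc M)" by simp
      then show "N (x j) powr r \<le> (m + 1 / real (Suc M)) powr r"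
        using r by (intro powr_mono2) (auto simp: N_def)
      have "1 / real (Suc M) \<le> 1" by (simp del: of_nat_Suc)
      with 1 have "N (x j) \<le> m + 1" by linarith
      then show "N (x j) powr r \<le> (m + 1) powr r"
        using r by (intro powr_mono2) (auto simp: N_def)
    qed
    have "N (\<lambda>i. x j i - x k i) < \<eta>" if jk: "j \<ge> M" "k \<ge> M" for j k
    proof -
      have 1: "m powr r \<le> N (\<lambda>i. (x j i + x k i) / 2) powr r"
        using m_le[OF mid[OF x(1) x(1)], of j k] m0 r by (intro powr_mono2) auto
      have "N (\<lambda>i. x j i - x k i) powr r \<le> e * (N (x j) powr r + N (x k) powr r)
          + C * ((N (x j) powr r + N (x k) powr r) / 2 - N (\<lambda>i. (x j i + x k i) / 2) powr r)"
        by (rule ineq[OF xe xe])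
      also have "\<dots> \<le> e * ((m + 1) powr r + (m + 1) powr r) + C * ((m + 1 / real (Suc M)) powr r - m powr r)"
      proof (intro add_mono mult_left_mono)
        have "(N (x j) powr r + N (x k) powr r) / 2 \<le> (m + 1 / real (Suc M)) powr r"
          using add_mono[OF bd(1)[OF jk(1)] bd(1)[OF jk(2)]] by (simp only: field_simps mult_2_right)
        with 1 show "(N (x j) powr r + N (x k) powr r) / 2 - N (\<lambda>i. (x j i + x k i) / 2) powr r
            \<le> (m + 1 / real (Suc M)) powr r - m powr r" by (rule diff_mono[rotated])
      qed (use e C bd[OF jk(1)] bd[OF jk(2)] in auto)
      also have "\<dots> < e * ((m + 1) powr r + (m + 1) powr r) + \<eta> powr r / 2"
        using M by simp
      also have "\<dots> = \<eta> powr r" using m0 by (simp add: e_def field_simps)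
      finally show ?thesis
        using r \<eta> by (smt (verit, best) powr_mono2)
    qed
    then show ?thesis by blast
  qed
  then obtain y where y: "y \<in> ell r I" "(\<lambda>n. N (\<lambda>i. x n i - y i)) \<longlonglongrightarrow> 0"
    using ell_complete[of x r I, OF xe r] unfolding N_def by blast
  have "y \<in> K"
  proof -
    have "\<exists>k\<in>K. N (\<lambda>i. y i - k i) < e" if "0 < e" for e
    proof -
      have "\<forall>\<^sub>F n in sequentially. N (\<lambda>i. x n i - y i) < e"
        using y(2) that by (rule order_tendstoD(2))
      then obtain n where "N (\<lambda>i. x n i - y i) < e" by (auto simp: eventually_sequentially)
      then show ?thesis using x(1) by (metis N_def ell_norm_minus_commute)
    qed
    then show ?thesis using K(1) y(1) by (auto simp: ell_closed_def N_def)
  qed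
  moreover have "N y \<le> m"
  proof (rule tendsto_lowerbound)
    show "(\<lambda>n. N (\<lambda>i. x n i - y i) + (m + 1 / real (Suc n))) \<longlonglongrightarrow> m"
      using tendsto_add[OF y(2) tendsto_add[OF tendsto_const[of m] LIMSEQ_Suc[OF lim_1_over_n]]]
      by simp
    have "N y \<le> N (\<lambda>i. x n i - y i) + (m + 1 / real (Suc n))" for n
      using ell_norm_le_diff[OF y(1) xe r, of n] x(2)[of n]
        ell_norm_minus_commute[of r I y "x n"] by (simp add: N_def)
    then show "\<forall>\<^sub>F n in sequentially. N y \<le> N (\<lambda>i. x n i - y i) + (m + 1 / real (Suc n))"
      by simp
  qed simp
  ultimately show ?thesis
    using m_le by (intro that[of y]) (auto simp: N_def intro: order_trans)
qed

section \<open>Duality between closed subspaces\<close>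

lemma complex_eq_0_if_le:
  assumes "\<And>e. 0 < e \<Longrightarrow> cmod z \<le> C * e" "0 \<le> C"
  shows "z = 0"
proof -
  have "cmod z \<le> 0 + e" if e: "0 < e" for e
  proof -
    have "cmod z \<le> C * (e / (C + 1))" using assms(1)[of "e / (C + 1)"] assms(2) e by simp
    also have "\<dots> \<le> (C + 1) * (e / (C + 1))" using e assms by (intro mult_right_mono) auto
    also have "\<dots> = e" using assms by simp
    finally show ?thesis by simp
  qed
  then have "cmod z \<le> 0" using field_le_epsilon by blast
  then show ?thesis by simp
qed

text \<open>
  The derivative of \<open>|\<cdot>|\<^sup>r / r\<close>: up to a scalar, \<open>\<lambda>i. dual_elt r (y i)\<close> is the supporting
  functional of the ball at \<open>y\<close>.
\<close>

definition dual_elt :: "real \<Rightarrow> complex \<Rightarrow> complex" where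
  "dual_elt r a = of_real (cmod a powr (r - 2)) * cnj a"

lemma norm_dual_elt: "cmod (dual_elt r a) = cmod a powr (r - 1)"
proof (cases "a = 0")
  case False
  then have "cmod a powr (r - 2) * cmod a = cmod a powr (r - 2 + 1)"
    by (simp only: powr_add powr_one norm_ge_zero)
  then show ?thesis by (simp add: dual_elt_def norm_mult)
qed (simp add: dual_elt_def)

lemma dual_elt_mult_self: "dual_elt r a * a = of_real (cmod a powr r)"
proof (cases "a = 0")
  case False
  have "cmod a powr (r - 2) * (cmod a)\<^sup>2 = cmod a powr r"
    using False by (simp add: powr_diff powr_numeral)
  then show ?thesis
    by (simp add: dual_elt_def mult.assoc complex_norm_square[symmetric] mult.commute[of "cnj a"]
        flip: of_real_mult of_real_power)
qed (simp add: dual_elt_def)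

text \<open>At 0 the exponent \<open>r - 2\<close> may be negative and the defining formula gives no
  continuity; there the modulus \<open>cmod a powr (r - 1)\<close> is used instead.\<close>

lemma tendsto_dual_elt:
  assumes "(f \<longlongrightarrow> a) F" "1 < r"
  shows "((\<lambda>x. dual_elt r (f x)) \<longlongrightarrow> dual_elt r a) F"
proof (cases "a = 0")
  case True
  have "((\<lambda>x. cmod (f x) powr (r - 1)) \<longlongrightarrow> cmod 0 powr (r - 1)) F"
    using assms True by (intro tendsto_powr' tendsto_intros) auto
  then have "((\<lambda>x. cmod (dual_elt r (f x))) \<longlongrightarrow> 0) F"
    by (simp add: norm_dual_elt)
  then show ?thesis
    using True by (simp add: tendsto_norm_zero_iff dual_elt_def[of r 0])
next
  case False
  then show ?thesis
    unfolding dual_elt_def using assms by (intro tendsto_intros) auto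
qed

text \<open>The complex form of \<open>powr_tangent\<close>: up to the factor \<open>r\<close>, the
  real functional \<open>b \<mapsto> Re (dual_elt r a * b)\<close> is the derivative of the
  \<open>r\<close>-th power of the modulus at \<open>a\<close>.\<close>

lemma dual_elt_tangent:
  assumes "1 < r"
  shows "r * Re (dual_elt r a * b) \<le> (r - 1) * cmod a powr r + cmod b powr r"
proof -
  have "Re (dual_elt r a * b) \<le> cmod (dual_elt r a * b)" by (rule complex_Re_le_cmod)
  also have "\<dots> = cmod a powr (r - 1) * cmod b" by (simp add: norm_mult norm_dual_elt)
  finally have "r * Re (dual_elt r a * b) \<le> r * (cmod a powr (r - 1) * cmod b)"
    using assms by (intro mult_left_mono) auto
  also have "\<dots> \<le> (r - 1) * cmod a powr r + cmod b powr r"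
    using assms by (intro powr_tangent) auto
  finally show ?thesis .
qed

context conjugate_exponents
begin

lemma norm_dual_elt_powr: "cmod (dual_elt p a) powr q = cmod a powr p"
  using q_eq p1 by (simp add: norm_dual_elt powr_powr)

text \<open>Since \<open>(p - 1) * q = p\<close>, the \<open>q\<close>-th powers of the new moduli
  are the \<open>p\<close>-th powers of the old ones; the exponent \<open>p - 1\<close> of the norm
  is \<open>p / q\<close>.\<close>

lemma dual_elt_ell:
  assumes "y \<in> ell p I"
  shows "(\<lambda>i. dual_elt p (y i)) \<in> ell q I"
    and "ell_norm q I (\<lambda>i. dual_elt p (y i)) = ell_norm p I y powr (p - 1)"
proof -
  show "(\<lambda>i. dual_elt p (y i)) \<in> ell q I"
    using assms by (auto simp: ell_def norm_dual_elt_powr dual_elt_def[of p 0])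
  have "1 / q = 1 / p * (p - 1)" using pq p1 by (simp add: field_simps)
  then show "ell_norm q I (\<lambda>i. dual_elt p (y i)) = ell_norm p I y powr (p - 1)"
    by (simp only: ell_norm_def norm_dual_elt_powr powr_powr)
qed

lemma pair_dual_elt_self:
  assumes "y \<in> ell p I"
  shows "ell_pair I y (\<lambda>i. dual_elt p (y i)) = of_real (ell_norm p I y powr p)"
proof -
  have "ell_pair I y (\<lambda>i. dual_elt p (y i)) = (\<Sum>\<^sub>\<infinity>i\<in>I. of_real (cmod (y i) powr p))"
    by (simp add: ell_pair_def mult.commute[of "y _"] dual_elt_mult_self)
  also have "\<dots> = of_real (\<Sum>\<^sub>\<infinity>i\<in>I. cmod (y i) powr p)"
    using has_sum_of_real[OF has_sum_infsum[OF ell_summable[OF assms]]] by (rule infsumI)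
  finally show ?thesis using p1 by (simp add: ell_norm_powr)
qed

section \<open>First variation at a point of minimal norm\<close>

text \<open>The tangent inequality is taken at the displaced point \<open>y + s z\<close> and
  evaluated at \<open>y\<close>. Minimality at \<open>y\<close> then forces a sign without
  differentiating the norm; the limit \<open>s \<rightarrow> 0\<close> is left to the next
  lemma.\<close>

lemma Re_pair_dual_elt_ge:
  assumes y: "y \<in> ell p I" and z: "z \<in> ell p I"
    and le: "ell_norm p I y \<le> ell_norm p I (\<lambda>i. y i + of_real s * z i)" and s: "0 < s"
  shows "0 \<le> Re (ell_pair I z (\<lambda>i. dual_elt p (y i + of_real s * z i)))"
proof -
  define a where "a = (\<lambda>i. y i + of_real s * z i)"
  have a: "a \<in> ell p I" unfolding a_def using ell_add[OF y ell_scale[OF z] p1] .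
  have hs: "((\<lambda>i. cmod (f i) powr p) has_sum ell_norm p I f powr p) I" if "f \<in> ell p I" for f
    using ell_summable[OF that] p1 by (simp add: ell_norm_powr)
  have hp: "((\<lambda>i. Re (z i * dual_elt p (a i))) has_sum Re (ell_pair I z (\<lambda>i. dual_elt p (a i)))) I"
    unfolding ell_pair_def
    using pair_summable[OF z dual_elt_ell(1)[OF a]] by (intro has_sum_Re has_sum_infsum)
  have pt: "cmod (a i) powr p \<le> cmod (y i) powr p + (p * s) * Re (z i * dual_elt p (a i))" for i
  proof -
    have "dual_elt p (a i) * y i = dual_elt p (a i) * a i - of_real s * (z i * dual_elt p (a i))"
      by (simp add: a_def algebra_simps)
    then have "Re (dual_elt p (a i) * y i) = cmod (a i) powr p - s * Re (z i * dual_elt p (a i))"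
      by (simp only: dual_elt_mult_self) simp
    with dual_elt_tangent[OF p1, of "a i" "y i"]
    have "p * (cmod (a i) powr p - s * Re (z i * dual_elt p (a i))) \<le> (p - 1) * cmod (a i) powr p + cmod (y i) powr p"
      by simp
    moreover define R where "R = Re (z i * dual_elt p (a i))"
    ultimately show ?thesis
      unfolding R_def[symmetric] by (simp add: left_diff_distrib right_diff_distrib)
  qed
  have "ell_norm p I a powr p \<le> ell_norm p I y powr p + (p * s) * Re (ell_pair I z (\<lambda>i. dual_elt p (a i)))"
    by (rule has_sum_mono[OF hs[OF a] has_sum_add[OF hs[OF y] has_sum_cmult_right[OF hp]]]) (rule pt)
  moreover have "ell_norm p I y powr p \<le> ell_norm p I a powr p"
    using le p1 by (intro powr_mono2) (auto simp: a_def)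
  ultimately have "0 \<le> (p * s) * Re (ell_pair I z (\<lambda>i. dual_elt p (a i)))" by linarith
  moreover have "0 < p * s" using p1 s by simp
  ultimately show ?thesis by (simp only: a_def zero_le_mult_iff) linarith
qed

text \<open>Dominated convergence by hand: outside a finite set \<open>F\<close> the majorant
  \<open>M\<close> leaves at most \<open>e / 4\<close>, and on \<open>F\<close> continuity of
  \<open>dual_elt p\<close> is applied coordinate by coordinate.\<close>

lemma pair_dual_elt_tendsto:
  assumes y: "y \<in> ell p I" and z: "z \<in> ell p I"
  shows "(\<lambda>n. ell_pair I z (\<lambda>i. dual_elt p (y i + of_real (1 / real (Suc n)) * z i)))
    \<longlonglongrightarrow> ell_pair I z (\<lambda>i. dual_elt p (y i))"
proof (rule LIMSEQ_I)
  fix e :: real assume e: "0 < e"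
  \<comment> \<open>All displaced points have modulus at most \<open>w\<close>, and the modulus of
    \<open>dual_elt p\<close> grows with that of its argument. As \<open>w\<close> lies in
    \<open>ell p I\<close>, Hoelder's inequality makes the majorant \<open>M\<close>
    summable.\<close>
  define w where "w = (\<lambda>i. of_real (cmod (y i) + cmod (z i)) :: complex)"
  define D where "D = (\<lambda>n i. dual_elt p (y i + of_real (1 / real (Suc n)) * z i))"
  define M where "M = (\<lambda>i. cmod (z i) * cmod (dual_elt p (w i)))"
  have "(\<lambda>i. of_real (cmod (f i))) \<in> ell p I" if "f \<in> ell p I" for f
    using that by (auto simp: ell_def)
  from ell_add[OF this[OF y] this[OF z] p1] have w: "w \<in> ell p I" by (simp add: w_def)
  have M: "M summable_on I"
    using Hoelder(1)[OF z dual_elt_ell(1)[OF w] p1 q1 pq] by (simp add: M_def norm_mult)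
  have D: "D n \<in> ell q I" for n
    unfolding D_def by (intro dual_elt_ell(1) ell_add y ell_scale z p1)
  have Dy: "(\<lambda>i. dual_elt p (y i)) \<in> ell q I" using dual_elt_ell(1)[OF y] .
  have bound: "cmod (z i * dual_elt p c) \<le> M i" if "cmod c \<le> cmod (y i) + cmod (z i)" for c i
  proof -
    have "cmod (w i) = cmod (y i) + cmod (z i)"
      unfolding w_def norm_of_real by simp
    then show ?thesis
      unfolding M_def norm_mult norm_dual_elt using that p1
      by (intro mult_left_mono powr_mono2) auto
  qed
  have boundD: "cmod (z i * D n i) \<le> M i" for n i
    unfolding D_def
  proof (rule bound)
    have "cmod (y i + of_real (1 / real (Suc n)) * z i) \<le> cmod (y i) + cmod (of_real (1 / real (Suc n)) * z i)"
      by (rule norm_triangle_ineq)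
    also have "cmod (of_real (1 / real (Suc n)) * z i) \<le> 1 * cmod (z i)"
      unfolding norm_mult by (intro mult_right_mono) (auto simp: norm_divide simp del: of_nat_Suc)
    finally show "cmod (y i + of_real (1 / real (Suc n)) * z i) \<le> cmod (y i) + cmod (z i)" by simp
  qed
  obtain F where F: "finite F" "F \<subseteq> I" "dist (sum M F) (infsum M I) \<le> e / 4"
    using infsum_finite_approximation[OF M, of "e/4"] e by auto
  have MF: "M summable_on (I - F)" using M by (rule summable_on_subset_banach) auto
  have tail: "cmod (ell_pair I z g - (\<Sum>i\<in>F. z i * g i)) \<le> e / 4"
    if g: "g \<in> ell q I" "\<And>i. cmod (z i * g i) \<le> M i" for g
  proof -
    have s: "(\<lambda>i. z i * g i) summable_on I" using pair_summable[OF z g(1)] .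
    have "ell_pair I z g = (\<Sum>i\<in>F. z i * g i) + (\<Sum>\<^sub>\<infinity>i\<in>I - F. z i * g i)"
    proof -
      have "(\<Sum>\<^sub>\<infinity>i\<in>F \<union> (I - F). z i * g i) = (\<Sum>\<^sub>\<infinity>i\<in>F. z i * g i) + (\<Sum>\<^sub>\<infinity>i\<in>I - F. z i * g i)"
        using F by (intro infsum_Un_disjoint summable_on_subset_banach[OF s]) auto
      moreover have "F \<union> (I - F) = I" using F by auto
      ultimately show ?thesis using F by (simp add: ell_pair_def)
    qed
    then have "cmod (ell_pair I z g - (\<Sum>i\<in>F. z i * g i)) = cmod (\<Sum>\<^sub>\<infinity>i\<in>I - F. z i * g i)" by simp
    also have "\<dots> \<le> infsum M (I - F)"
      using g(2) by (intro norm_infsum_le[OF has_sum_infsum has_sum_infsum] MF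
          summable_on_subset_banach[OF s]) auto
    also have "infsum M I = sum M F + infsum M (I - F)"
    proof -
      have "infsum M (F \<union> (I - F)) = infsum M F + infsum M (I - F)"
        using F by (intro infsum_Un_disjoint summable_on_subset_banach[OF M]) auto
      moreover have "F \<union> (I - F) = I" using F by auto
      ultimately show ?thesis using F by simp
    qed
    then have "infsum M (I - F) \<le> e / 4" using F(3) by (simp add: dist_real_def)
    finally show ?thesis .
  qed
  have "(\<lambda>n. \<Sum>i\<in>F. z i * D n i) \<longlonglongrightarrow> (\<Sum>i\<in>F. z i * dual_elt p (y i))"
  proof (intro tendsto_sum tendsto_mult tendsto_const)
    fix i
    have "(\<lambda>n. y i + of_real (1 / real (Suc n)) * z i) \<longlonglongrightarrow> y i + of_real 0 * z i"
      by (intro tendsto_intros LIMSEQ_Suc[OF lim_1_over_n])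
    then show "(\<lambda>n. D n i) \<longlonglongrightarrow> dual_elt p (y i)"
      unfolding D_def using p1 by (intro tendsto_dual_elt) auto
  qed
  then obtain N where N: "\<And>n. n \<ge> N \<Longrightarrow> cmod ((\<Sum>i\<in>F. z i * D n i) - (\<Sum>i\<in>F. z i * dual_elt p (y i))) < e / 4"
    using LIMSEQ_D[of _ _ "e/4"] e by fastforce
  have "cmod (ell_pair I z (D n) - ell_pair I z (\<lambda>i. dual_elt p (y i))) < e" if "n \<ge> N" for n
  proof -
    have "cmod (a - d) \<le> cmod (a - b) + cmod (b - c) + cmod (d - c)" for a b c d :: complex
      using norm_triangle_ineq[of "a - b + (b - c)" "c - d"] norm_triangle_ineq[of "a - b" "b - c"]
      by (simp add: norm_minus_commute)
    note this[of "ell_pair I z (D n)" "ell_pair I z (\<lambda>i. dual_elt p (y i))"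
        "\<Sum>i\<in>F. z i * D n i" "\<Sum>i\<in>F. z i * dual_elt p (y i)"]
    moreover have "cmod (ell_pair I z (D n) - (\<Sum>i\<in>F. z i * D n i)) \<le> e / 4"
      by (rule tail[OF D boundD])
    moreover have "cmod (ell_pair I z (\<lambda>i. dual_elt p (y i)) - (\<Sum>i\<in>F. z i * dual_elt p (y i))) \<le> e / 4"
      by (rule tail[OF Dy bound]) simp
    ultimately show ?thesis using N[OF that] e by linarith
  qed
  then show "\<exists>N. \<forall>n\<ge>N. norm (ell_pair I z (\<lambda>i. dual_elt p (y i + of_real (1 / real (Suc n)) * z i))
      - ell_pair I z (\<lambda>i. dual_elt p (y i))) < e"
    unfolding D_def by blast
qed

text \<open>Minimality along a complex subspace gives a nonnegative real part not only for
  \<open>z\<close> but for all its complex multiples.\<close>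

lemma min_norm_orthogonal:
  assumes y: "y \<in> ell p I" and Z: "Z \<subseteq> ell p I"
    and scale: "\<And>c z. z \<in> Z \<Longrightarrow> (\<lambda>i. c * z i) \<in> Z"
    and le: "\<And>z. z \<in> Z \<Longrightarrow> ell_norm p I y \<le> ell_norm p I (\<lambda>i. y i + z i)"
    and z: "z \<in> Z"
  shows "ell_pair I z (\<lambda>i. dual_elt p (y i)) = 0"
proof -
  have ge: "0 \<le> Re (ell_pair I z (\<lambda>i. dual_elt p (y i)))" if z: "z \<in> Z" for z
  proof (rule tendsto_lowerbound)
    show "(\<lambda>n. Re (ell_pair I z (\<lambda>i. dual_elt p (y i + of_real (1 / real (Suc n)) * z i))))
      \<longlonglongrightarrow> Re (ell_pair I z (\<lambda>i. dual_elt p (y i)))"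
      using z Z by (intro tendsto_Re pair_dual_elt_tendsto y) auto
    have "0 \<le> Re (ell_pair I z (\<lambda>i. dual_elt p (y i + of_real (1 / real (Suc n)) * z i)))" for n
      using z Z by (intro Re_pair_dual_elt_ge y le scale) (auto simp del: of_nat_Suc)
    then show "\<forall>\<^sub>F n in sequentially.
        0 \<le> Re (ell_pair I z (\<lambda>i. dual_elt p (y i + of_real (1 / real (Suc n)) * z i)))" by simp
  qed simp
  have eq: "ell_pair I (\<lambda>i. c * z i) g = c * ell_pair I z g" for c g
    by (metis ell_pair_commute pair_scale_right)
  have "0 \<le> Re (c * ell_pair I z (\<lambda>i. dual_elt p (y i)))" for c
    using ge[OF scale[OF z, of c]] by (simp add: eq)
  \<comment> \<open>The four units force real and imaginary part to vanish.\<close>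
  from this[of 1] this[of "-1"] this[of \<i>] this[of "-\<i>"] show ?thesis
    by (simp add: complex_eq_iff)
qed

section \<open>Separation of points and representation of functionals\<close>

text \<open>\<open>k\<close> is the best approximation of \<open>x\<close> in \<open>K\<close>: the
  point of minimal norm is sought in the translate \<open>A = x - K\<close>, which is closed and has
  direction \<open>K\<close>.\<close>

lemma separation:
  assumes K: "ell_closed p I K" "K \<noteq> {}"
    and add: "\<And>x y. x \<in> K \<Longrightarrow> y \<in> K \<Longrightarrow> (\<lambda>i. x i + y i) \<in> K"
    and scale: "\<And>c x. x \<in> K \<Longrightarrow> (\<lambda>i. c * x i) \<in> K"
    and x: "x \<in> ell p I" "x \<notin> K"
  obtains k where "k \<in> K" "0 < ell_norm p I (\<lambda>i. x i - k i)"
    "\<And>z. z \<in> K \<Longrightarrow> ell_pair I z (\<lambda>i. dual_elt p (x i - k i)) = 0"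
proof -
  define A where "A = (\<lambda>k i. x i - k i) ` K"
  have Ke: "K \<subseteq> ell p I" using K by (simp add: ell_closed_def)
  have A_cl: "ell_closed p I A"
    unfolding ell_closed_def
  proof (intro conjI ballI impI)
    show "A \<subseteq> ell p I" using Ke x by (auto simp: A_def intro!: ell_diff p1)
    fix y assume y: "y \<in> ell p I" "\<forall>e>0. \<exists>k\<in>A. ell_norm p I (\<lambda>i. y i - k i) < e"
    have "\<exists>k\<in>K. ell_norm p I (\<lambda>i. (x i - y i) - k i) < e" if e: "0 < e" for e
    proof -
      obtain k where k: "k \<in> K" "ell_norm p I (\<lambda>i. y i - (x i - k i)) < e"
        using y(2) e by (auto simp: A_def)
      have "ell_norm p I (\<lambda>i. (x i - y i) - k i) = ell_norm p I (\<lambda>i. - (y i - (x i - k i)))"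
        by (simp add: algebra_simps)
      with k show ?thesis by (metis ell_norm_uminus)
    qed
    then have "(\<lambda>i. x i - y i) \<in> K"
      using K ell_diff[OF x(1) y(1) p1] by (simp add: ell_closed_def)
    then show "y \<in> A" unfolding A_def by (rule rev_image_eqI) simp
  qed
  have A_ne: "A \<noteq> {}" using K by (simp add: A_def)
  have mid: "(\<lambda>i. (u i + v i) / 2) \<in> A" if uv: "u \<in> A" "v \<in> A" for u v
  proof -
    obtain k l where k: "k \<in> K" "l \<in> K" "u = (\<lambda>i. x i - k i)" "v = (\<lambda>i. x i - l i)"
      using uv by (auto simp: A_def)
    have "(\<lambda>i. (1 / 2) * (k i + l i)) \<in> K" using k by (intro scale add)
    then show ?thesis unfolding A_def
      by (rule rev_image_eqI) (auto simp: k field_simps)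
  qed
  obtain y where y: "y \<in> A" "\<And>a. a \<in> A \<Longrightarrow> ell_norm p I y \<le> ell_norm p I a"
    using min_norm_exists[OF p1 A_cl A_ne mid] by blast
  obtain k where k: "k \<in> K" "y = (\<lambda>i. x i - k i)" using y(1) by (auto simp: A_def)
  have ye: "y \<in> ell p I" using k Ke x by (auto intro!: ell_diff p1)
  show ?thesis
  proof (rule that[OF k(1)])
    have "ell_norm p I y \<noteq> 0"
    proof
      assume "ell_norm p I y = 0"
      then have "y = (\<lambda>i. 0)" using ell_norm_eq_0D[OF ye] p1 by auto
      then have "x = k" using k by (auto simp: fun_eq_iff)
      with k x show False by simp
    qed
    then show "0 < ell_norm p I (\<lambda>i. x i - k i)" by (simp add: k(2) less_le)
    show "ell_pair I z (\<lambda>i. dual_elt p (x i - k i)) = 0" if z: "z \<in> K" for z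
    proof -
      have "ell_norm p I y \<le> ell_norm p I (\<lambda>i. y i + z' i)" if z': "z' \<in> K" for z'
      proof (rule y(2))
        have "(\<lambda>i. k i + (- 1) * z' i) \<in> K" using z' k by (intro add scale)
        then show "(\<lambda>i. y i + z' i) \<in> A" unfolding A_def by (rule rev_image_eqI) (simp add: k algebra_simps)
      qed
      from min_norm_orthogonal[OF ye Ke scale this z] show ?thesis by (simp add: k)
    qed
  qed
qed

text \<open>The supporting functional at \<open>y = x - k\<close> kills \<open>K\<close>, hence
  \<open>k\<close>, and so takes on \<open>x\<close> the same value as on \<open>y\<close>, namely
  the \<open>p\<close>-th power of the norm of \<open>y\<close>.\<close>

lemma separating_functional:
  assumes K: "ell_closed p I K" "K \<noteq> {}"
    and add: "\<And>x y. x \<in> K \<Longrightarrow> y \<in> K \<Longrightarrow> (\<lambda>i. x i + y i) \<in> K"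
    and scale: "\<And>c x. x \<in> K \<Longrightarrow> (\<lambda>i. c * x i) \<in> K"
    and x: "x \<in> ell p I" "x \<notin> K"
  obtains u where "u \<in> ell q I" "\<And>z. z \<in> K \<Longrightarrow> ell_pair I z u = 0" "ell_pair I x u \<noteq> 0"
proof -
  obtain k where k: "k \<in> K" and pos: "0 < ell_norm p I (\<lambda>i. x i - k i)"
    and orth: "\<And>z. z \<in> K \<Longrightarrow> ell_pair I z (\<lambda>i. dual_elt p (x i - k i)) = 0"
    using separation[OF assms] by blast
  have ke: "k \<in> ell p I" using k K by (auto simp: ell_closed_def)
  define y where "y = (\<lambda>i. x i - k i)"
  have y: "y \<in> ell p I" unfolding y_def using x(1) ke p1 by (rule ell_diff)
  define u where "u = (\<lambda>i. dual_elt p (y i))"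
  have u: "u \<in> ell q I" unfolding u_def using y by (rule dual_elt_ell)
  have "ell_pair I x u = ell_pair I y u + ell_pair I k u"
    using conjugate_exponents.pair_add_right[OF swap u y ke]
    by (simp add: y_def ell_pair_commute)
  also have "\<dots> = of_real (ell_norm p I y powr p)"
    using orth[OF k] pair_dual_elt_self[OF y] by (simp add: u_def y_def)
  also have "\<dots> \<noteq> 0" using pos by (simp add: y_def)
  finally show ?thesis
    using u orth by (intro that[of u]) (auto simp: u_def y_def)
qed

text \<open>
  If \<open>y\<close> is the point of minimal norm of the hyperplane \<open>f = 1\<close>, then \<open>f\<close> is a multiple of the
  supporting functional at \<open>y\<close>.
\<close>

lemma functional_represented:
  assumes Z: "ell_closed p I Z" "Z \<noteq> {}"
    and add: "\<And>x y. x \<in> Z \<Longrightarrow> y \<in> Z \<Longrightarrow> (\<lambda>i. x i + y i) \<in> Z"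
    and scale: "\<And>c x. x \<in> Z \<Longrightarrow> (\<lambda>i. c * x i) \<in> Z"
    and f_add: "\<And>x y. x \<in> Z \<Longrightarrow> y \<in> Z \<Longrightarrow> f (\<lambda>i. x i + y i) = f x + f y"
    and f_scale: "\<And>c x. x \<in> Z \<Longrightarrow> f (\<lambda>i. c * x i) = c * f x"
    and f_le: "\<And>x. x \<in> Z \<Longrightarrow> cmod (f x) \<le> C * ell_norm p I x"
    and C: "0 \<le> C"
  obtains u where "u \<in> ell q I" "ell_norm q I u \<le> C" "\<And>z. z \<in> Z \<Longrightarrow> ell_pair I z u = f z"
proof (cases "\<forall>z\<in>Z. f z = 0")
  case True
  then show ?thesis using that[of "\<lambda>i. 0"] C by simp
next
  case False
  then obtain x0 where x0: "x0 \<in> Z" "f x0 \<noteq> 0" by blast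
  \<comment> \<open>A point with \<open>f x = 1\<close>; the hyperplane \<open>f = 1\<close> inside
    \<open>Z\<close> is then \<open>x + K\<close> for the kernel \<open>K\<close> introduced
    below.\<close>
  define x where "x = (\<lambda>i. (1 / f x0) * x0 i)"
  have x: "x \<in> Z" "f x = 1" unfolding x_def using scale[OF x0(1)] f_scale[OF x0(1)] x0(2)
    by (simp_all del: times_divide_eq_left) simp
  have Ze: "Z \<subseteq> ell p I" using Z by (simp add: ell_closed_def)
  have diff: "(\<lambda>i. a i - b i) \<in> Z" "f (\<lambda>i. a i - b i) = f a - f b" if "a \<in> Z" "b \<in> Z" for a b
    using add[OF that(1) scale[OF that(2), of "-1"]] f_add[OF that(1) scale[OF that(2), of "-1"]]
      f_scale[OF that(2), of "-1"] by simp_all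
  define K where "K = {z \<in> Z. f z = 0}"
  have Kcl: "ell_closed p I K"
    unfolding ell_closed_def
  proof (intro conjI ballI impI)
    show "K \<subseteq> ell p I" using Ze by (auto simp: K_def)
    fix y assume y: "y \<in> ell p I" "\<forall>e>0. \<exists>k\<in>K. ell_norm p I (\<lambda>i. y i - k i) < e"
    have "K \<subseteq> Z" by (auto simp: K_def)
    with y have "\<forall>e>0. \<exists>k\<in>Z. ell_norm p I (\<lambda>i. y i - k i) < e" by blast
    with y(1) Z have yZ: "y \<in> Z" by (simp add: ell_closed_def)
    have "cmod (f y) \<le> C * e" if e: "0 < e" for e
    proof -
      obtain k where k: "k \<in> K" "ell_norm p I (\<lambda>i. y i - k i) < e" using y e by blast
      then have "cmod (f y) = cmod (f (\<lambda>i. y i - k i))" using diff(2)[OF yZ, of k] by (simp add: K_def)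
      also have "\<dots> \<le> C * ell_norm p I (\<lambda>i. y i - k i)" using diff(1)[OF yZ, of k] k by (intro f_le) (simp add: K_def)
      also have "\<dots> \<le> C * e" using k C by (intro mult_left_mono) auto
      finally show ?thesis .
    qed
    then have "f y = 0" using C by (rule complex_eq_0_if_le)
    then show "y \<in> K" using yZ by (simp add: K_def)
  qed
  have f0: "f (\<lambda>i. 0) = 0" using f_scale[OF x0(1), of 0] by simp
  have Kne: "K \<noteq> {}" using scale[OF x0(1), of 0] f0 by (auto simp: K_def)
  have Kadd: "(\<lambda>i. a i + b i) \<in> K" if "a \<in> K" "b \<in> K" for a b
    using that add f_add by (simp add: K_def)
  have Kscale: "(\<lambda>i. c * a i) \<in> K" if "a \<in> K" for a c
    using that scale f_scale by (simp add: K_def)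
  have xK: "x \<in> ell p I" "x \<notin> K" using x Ze by (auto simp: K_def)
  obtain k where k: "k \<in> K" and pos: "0 < ell_norm p I (\<lambda>i. x i - k i)"
    and orth: "\<And>z. z \<in> K \<Longrightarrow> ell_pair I z (\<lambda>i. dual_elt p (x i - k i)) = 0"
    using separation[OF Kcl Kne Kadd Kscale xK] by blast
  define y where "y = (\<lambda>i. x i - k i)"
  define N where "N = ell_norm p I y"
  have N: "0 < N" using pos by (simp add: N_def y_def)
  have y: "y \<in> Z" "f y = 1" using diff[OF x(1), of k] k x by (auto simp: y_def K_def)
  then have ye: "y \<in> ell p I" using Ze by auto
  \<comment> \<open>Chosen so that \<open>u\<close> takes the value 1 on \<open>y\<close>, as
    \<open>f\<close> does.\<close>
  define t :: complex where "t = of_real (1 / N powr p)"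
  define u where "u = (\<lambda>i. t * dual_elt p (y i))"
  have De: "(\<lambda>i. dual_elt p (y i)) \<in> ell q I" using ye by (rule dual_elt_ell)
  have u: "u \<in> ell q I" unfolding u_def using De by (rule ell_scale)
  show ?thesis
  proof (rule that[OF u])
    have "ell_norm q I u = 1 / N powr p * N powr (p - 1)"
      unfolding u_def using q1
      by (simp add: ell_norm_scale dual_elt_ell(2)[OF ye]) (simp add: t_def N_def norm_divide)
    also have "\<dots> = 1 / N" using N by (simp add: powr_diff)
    also have "\<dots> \<le> C"
    proof -
      \<comment> \<open>As \<open>f y = 1\<close>, the bound on \<open>f\<close> compares
        \<open>C\<close> with \<open>1 / N\<close>, which is the norm of \<open>u\<close>.\<close>
      have "1 \<le> C * N" using f_le[OF y(1)] y(2) by (simp add: N_def)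
      then show ?thesis using N by (simp add: divide_le_eq)
    qed
    finally show "ell_norm q I u \<le> C" .
    show "ell_pair I z u = f z" if z: "z \<in> Z" for z
    proof -
      \<comment> \<open>Subtracting \<open>f z * y\<close> moves \<open>z\<close> into the kernel of
        \<open>f\<close>, which \<open>u\<close> annihilates.\<close>
      define w where "w = (\<lambda>i. z i - f z * y i)"
      have "w \<in> Z" "f w = f z - f z * f y"
        unfolding w_def using diff[OF z scale[OF y(1)]] f_scale[OF y(1)] by simp_all
      then have wK: "w \<in> K" using y by (simp add: K_def)
      have "ell_pair I z u = ell_pair I (\<lambda>i. w i + f z * y i) u" by (simp add: w_def)
      also have "\<dots> = ell_pair I w u + f z * ell_pair I y u"
        using conjugate_exponents.pair_add_right[OF swap u, of w "\<lambda>i. f z * y i"] wK Ze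
          conjugate_exponents.pair_scale_right[OF swap, of I u "f z" y] ell_scale[OF ye]
        by (simp add: ell_pair_commute K_def subset_iff)
      also have "ell_pair I w u = 0"
        using orth[OF wK] pair_scale_right[of I w] by (simp add: u_def y_def)
      also have "ell_pair I y u = t * of_real (N powr p)"
        using pair_dual_elt_self[OF ye] pair_scale_right[of I y] by (simp add: u_def N_def)
      also have "\<dots> = 1"
        using N by (simp add: t_def)
      finally show ?thesis by simp
    qed
  qed
qed

end

section \<open>Topological vector spaces embedded in \<open>\<ell>\<^sup>r\<close>\<close>

definition csubspace :: "'v ctvs \<Rightarrow> 'v set \<Rightarrow> bool" where
  "csubspace V K \<longleftrightarrow> K \<subseteq> carrier V \<and> \<zero>\<^bsub>V\<^esub> \<in> K \<and>
     (\<forall>u\<in>K. \<forall>v\<in>K. u \<oplus>\<^bsub>V\<^esub> v \<in> K) \<and> (\<forall>c. \<forall>v\<in>K. c \<odot>\<^bsub>V\<^esub> v \<in> K)"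

lemma csubspaceD:
  assumes "csubspace V K"
  shows "v \<in> K \<Longrightarrow> v \<in> carrier V" "\<zero>\<^bsub>V\<^esub> \<in> K" "u \<in> K \<Longrightarrow> v \<in> K \<Longrightarrow> u \<oplus>\<^bsub>V\<^esub> v \<in> K"
    "v \<in> K \<Longrightarrow> c \<odot>\<^bsub>V\<^esub> v \<in> K"
  using assms by (auto simp: csubspace_def)

text \<open>An abstract form of what coordinates provide: \<open>V\<close> is a bare record whose
  operations and topology are induced by the injection \<open>J\<close>. Vector space identities in
  \<open>V\<close> are then checked in coordinates, and \<open>openin_topo\<close> is the fact that
  chains and cochains have to supply for their own topologies.\<close>

locale ell_ctvs =
  fixes V :: "'v ctvs" and J :: "'v \<Rightarrow> 'i \<Rightarrow> complex" and r :: real and I :: "'i set"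
  assumes r1: "1 < r"
    and J_ell: "v \<in> carrier V \<Longrightarrow> J v \<in> ell r I"
    and J_inj: "inj_on J (carrier V)"
    and zero_closed: "\<zero>\<^bsub>V\<^esub> \<in> carrier V" and J_zero: "J \<zero>\<^bsub>V\<^esub> = (\<lambda>i. 0)"
    and add_closed: "u \<in> carrier V \<Longrightarrow> v \<in> carrier V \<Longrightarrow> u \<oplus>\<^bsub>V\<^esub> v \<in> carrier V"
    and J_add: "u \<in> carrier V \<Longrightarrow> v \<in> carrier V \<Longrightarrow> J (u \<oplus>\<^bsub>V\<^esub> v) = (\<lambda>i. J u i + J v i)"
    and smult_closed: "v \<in> carrier V \<Longrightarrow> c \<odot>\<^bsub>V\<^esub> v \<in> carrier V"
    and J_smult: "v \<in> carrier V \<Longrightarrow> J (c \<odot>\<^bsub>V\<^esub> v) = (\<lambda>i. c * J v i)"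
    and openin_topo: "openin (topo V) U \<longleftrightarrow> U \<subseteq> carrier V \<and>
      (\<forall>u\<in>U. \<exists>e>0. \<forall>v\<in>carrier V. ell_norm r I (\<lambda>i. J v i - J u i) < e \<longrightarrow> v \<in> U)"
begin

definition nrm :: "'v \<Rightarrow> real" where "nrm v = ell_norm r I (J v)"

text \<open>Built from the two operations whose behaviour under \<open>J\<close> is assumed.\<close>

definition sub :: "'v \<Rightarrow> 'v \<Rightarrow> 'v" where "sub u v = u \<oplus>\<^bsub>V\<^esub> (- 1) \<odot>\<^bsub>V\<^esub> v"

lemma J_eq_iff: "u \<in> carrier V \<Longrightarrow> v \<in> carrier V \<Longrightarrow> u = v \<longleftrightarrow> J u = J v"
  using J_inj by (auto dest: inj_onD)

lemma sub_closed: "u \<in> carrier V \<Longrightarrow> v \<in> carrier V \<Longrightarrow> sub u v \<in> carrier V"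
  by (simp add: sub_def add_closed smult_closed)

lemma J_sub: "u \<in> carrier V \<Longrightarrow> v \<in> carrier V \<Longrightarrow> J (sub u v) = (\<lambda>i. J u i - J v i)"
  by (simp add: sub_def J_add J_smult smult_closed)

lemmas J_simps = J_zero J_add J_smult J_sub
lemmas closeds = zero_closed add_closed smult_closed sub_closed

lemma subspace_sub: "csubspace V K \<Longrightarrow> u \<in> K \<Longrightarrow> v \<in> K \<Longrightarrow> sub u v \<in> K"
  by (simp add: csubspace_def sub_def)

lemma nrm_nonneg [simp]: "0 \<le> nrm v" by (simp add: nrm_def)

lemma nrm_zero: "nrm \<zero>\<^bsub>V\<^esub> = 0" by (simp add: nrm_def J_zero)

lemma nrm_smult: "v \<in> carrier V \<Longrightarrow> nrm (c \<odot>\<^bsub>V\<^esub> v) = cmod c * nrm v"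
  using r1 by (simp add: nrm_def J_smult ell_norm_scale)

lemma nrm_add_le: "u \<in> carrier V \<Longrightarrow> v \<in> carrier V \<Longrightarrow> nrm (u \<oplus>\<^bsub>V\<^esub> v) \<le> nrm u + nrm v"
  using r1 by (simp add: nrm_def J_add ell_norm_add_le J_ell)

lemma nrm_sub_commute: "u \<in> carrier V \<Longrightarrow> v \<in> carrier V \<Longrightarrow> nrm (sub u v) = nrm (sub v u)"
  using ell_norm_minus_commute[of r I "J u" "J v"] by (simp add: nrm_def J_sub)

lemma nrm_sub_triangle:
  "u \<in> carrier V \<Longrightarrow> v \<in> carrier V \<Longrightarrow> w \<in> carrier V \<Longrightarrow> nrm (sub u w) \<le> nrm (sub u v) + nrm (sub v w)"
  using ell_norm_triangle[OF J_ell J_ell J_ell r1, of u v w] by (simp add: nrm_def J_sub)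

lemma sub_self: "v \<in> carrier V \<Longrightarrow> sub v v = \<zero>\<^bsub>V\<^esub>"
  by (simp add: J_eq_iff closeds J_simps)

lemma sub_zero: "v \<in> carrier V \<Longrightarrow> sub v \<zero>\<^bsub>V\<^esub> = v"
  by (simp add: J_eq_iff closeds J_simps)

lemma openin_iff: "openin (topo V) U \<longleftrightarrow> U \<subseteq> carrier V \<and>
    (\<forall>u\<in>U. \<exists>e>0. \<forall>v\<in>carrier V. nrm (sub v u) < e \<longrightarrow> v \<in> U)"
proof -
  have "nrm (sub v u) = ell_norm r I (\<lambda>i. J v i - J u i)" if "U \<subseteq> carrier V" "u \<in> U" "v \<in> carrier V" for u v
    using that by (simp add: nrm_def J_sub subset_iff)
  then show ?thesis unfolding openin_topo by (intro conj_cong refl ball_cong ex_cong1) auto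
qed

lemma topspace_topo: "topspace (topo V) = carrier V"
proof -
  have "openin (topo V) (carrier V)"
    unfolding openin_iff by (auto intro: exI[of _ 1])
  moreover have "topspace (topo V) \<subseteq> carrier V"
    using openin_topspace[of "topo V"] unfolding openin_iff by (rule conjunct1)
  ultimately show ?thesis by (intro equalityI openin_subset)
qed

lemma openin_ball: "u \<in> carrier V \<Longrightarrow> openin (topo V) {v \<in> carrier V. nrm (sub v u) < e}"
  unfolding openin_iff
proof safe
  fix v assume u: "u \<in> carrier V" and v: "v \<in> carrier V" "nrm (sub v u) < e"
  have "nrm (sub w u) < e" if "w \<in> carrier V" "nrm (sub w v) < e - nrm (sub v u)" for w
    using nrm_sub_triangle[of w v u] that u v by simp
  then show "\<exists>d>0. \<forall>w\<in>carrier V. nrm (sub w v) < d \<longrightarrow> w \<in> {v \<in> carrier V. nrm (sub v u) < e}"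
    using v by (intro exI[of _ "e - nrm (sub v u)"]) auto
qed

lemma closure_of_iff:
  assumes K: "K \<subseteq> carrier V"
  shows "v \<in> topo V closure_of K \<longleftrightarrow> v \<in> carrier V \<and> (\<forall>e>0. \<exists>k\<in>K. nrm (sub v k) < e)"
proof (cases "v \<in> carrier V")
  case False
  then show ?thesis by (simp add: in_closure_of topspace_topo)
next
  case v: True
  have comm: "nrm (sub v k) = nrm (sub k v)" if "k \<in> K" for k
    using that v K by (intro nrm_sub_commute) auto
  have "(\<forall>T. v \<in> T \<and> openin (topo V) T \<longrightarrow> (\<exists>y. y \<in> K \<and> y \<in> T))
    \<longleftrightarrow> (\<forall>e>0. \<exists>k\<in>K. nrm (sub v k) < e)"
  proof (rule iffI)
    assume *: "\<forall>T. v \<in> T \<and> openin (topo V) T \<longrightarrow> (\<exists>y. y \<in> K \<and> y \<in> T)"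
    show "\<forall>e>0. \<exists>k\<in>K. nrm (sub v k) < e"
    proof (rule allI, rule impI)
      fix e :: real assume "0 < e"
      then have "v \<in> {w \<in> carrier V. nrm (sub w v) < e}" using v by (simp add: sub_self nrm_zero)
      with *[rule_format, OF conjI, OF _ openin_ball[OF v]]
      obtain k where "k \<in> K" "nrm (sub k v) < e" by blast
      then show "\<exists>k\<in>K. nrm (sub v k) < e" using comm by auto
    qed
  next
    assume *: "\<forall>e>0. \<exists>k\<in>K. nrm (sub v k) < e"
    show "\<forall>T. v \<in> T \<and> openin (topo V) T \<longrightarrow> (\<exists>y. y \<in> K \<and> y \<in> T)"
    proof (rule allI, rule impI, elim conjE)
      fix T assume T: "v \<in> T" "openin (topo V) T"
      then obtain e where e: "0 < e" "\<forall>w\<in>carrier V. nrm (sub w v) < e \<longrightarrow> w \<in> T"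
        unfolding openin_iff by meson
      obtain k where k: "k \<in> K" "nrm (sub v k) < e" using * e(1) by meson
      then have "k \<in> T" using e(2) K comm[OF k(1)] by auto
      with k(1) show "\<exists>y. y \<in> K \<and> y \<in> T" by (intro exI conjI)
    qed
  qed
  with v show ?thesis by (simp only: in_closure_of topspace_topo simp_thms)
qed

lemma subset_closure: "K \<subseteq> carrier V \<Longrightarrow> K \<subseteq> topo V closure_of K"
  using topspace_topo by (intro closure_of_subset) auto

lemma closure_closed:
  assumes "K \<subseteq> carrier V" "v \<in> carrier V" "\<And>e. 0 < e \<Longrightarrow> \<exists>k\<in>topo V closure_of K. nrm (sub v k) < e"
  shows "v \<in> topo V closure_of K"
proof -
  have "topo V closure_of K \<subseteq> carrier V" using topspace_topo by (metis closure_of_subset_topspace)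
  then have "v \<in> topo V closure_of (topo V closure_of K)"
    unfolding closure_of_iff[OF \<open>topo V closure_of K \<subseteq> carrier V\<close>]
    using assms by blast
  then show ?thesis by (simp only: closure_of_closure_of)
qed

lemma csubspace_closure:
  assumes K: "csubspace V K" shows "csubspace V (topo V closure_of K)"
proof -
  have KV: "K \<subseteq> carrier V" using K by (simp add: csubspace_def)
  note iff = closure_of_iff[OF KV]
  show ?thesis
    unfolding csubspace_def
  proof (intro conjI ballI allI)
    show "topo V closure_of K \<subseteq> carrier V" using iff by auto
    show "\<zero>\<^bsub>V\<^esub> \<in> topo V closure_of K" using subset_closure[OF KV] K by (auto simp: csubspace_def)
  next
    fix u v assume u: "u \<in> topo V closure_of K" and v: "v \<in> topo V closure_of K"
    have uv: "u \<in> carrier V" "v \<in> carrier V" using u v iff by auto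
    have "\<exists>k\<in>K. nrm (sub (u \<oplus>\<^bsub>V\<^esub> v) k) < e" if "0 < e" for e
    proof -
      obtain k l where kl: "k \<in> K" "nrm (sub u k) < e / 2" "l \<in> K" "nrm (sub v l) < e / 2"
        using u v \<open>0 < e\<close> iff by (meson half_gt_zero)
      have klV: "k \<in> carrier V" "l \<in> carrier V" using kl KV by auto
      have "sub (u \<oplus>\<^bsub>V\<^esub> v) (k \<oplus>\<^bsub>V\<^esub> l) = sub u k \<oplus>\<^bsub>V\<^esub> sub v l"
        using uv klV by (simp add: J_eq_iff closeds J_simps algebra_simps)
      then have "nrm (sub (u \<oplus>\<^bsub>V\<^esub> v) (k \<oplus>\<^bsub>V\<^esub> l)) \<le> nrm (sub u k) + nrm (sub v l)"
        using uv klV by (simp add: nrm_add_le closeds)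
      also have "\<dots> < e" using kl by linarith
      finally show ?thesis using kl K by (auto simp: csubspace_def)
    qed
    then show "u \<oplus>\<^bsub>V\<^esub> v \<in> topo V closure_of K" using iff uv closeds by blast
  next
    fix c v assume v: "v \<in> topo V closure_of K"
    have vV: "v \<in> carrier V" using v iff by auto
    have "\<exists>k\<in>K. nrm (sub (c \<odot>\<^bsub>V\<^esub> v) k) < e" if "0 < e" for e
    proof -
      \<comment> \<open>The summand 1 covers \<open>c = 0\<close>.\<close>
      have "0 < e / (cmod c + 1)" using that by (intro divide_pos_pos add_nonneg_pos) auto
      then obtain k where k: "k \<in> K" "nrm (sub v k) < e / (cmod c + 1)"
        using v iff by blast
      have kV: "k \<in> carrier V" using k KV by auto
      have "sub (c \<odot>\<^bsub>V\<^esub> v) (c \<odot>\<^bsub>V\<^esub> k) = c \<odot>\<^bsub>V\<^esub> sub v k"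
        using vV kV by (simp add: J_eq_iff closeds J_simps algebra_simps)
      then have "nrm (sub (c \<odot>\<^bsub>V\<^esub> v) (c \<odot>\<^bsub>V\<^esub> k)) = cmod c * nrm (sub v k)"
        using vV kV by (simp add: nrm_smult closeds)
      also have "\<dots> \<le> (cmod c + 1) * nrm (sub v k)" by (intro mult_right_mono) auto
      also have "\<dots> < (cmod c + 1) * (e / (cmod c + 1))"
        using k by (intro mult_strict_left_mono) (auto intro: add_nonneg_pos)
      also have "\<dots> = e" using norm_ge_zero[of c] by (simp add: add_nonneg_eq_0_iff)
      finally show ?thesis using k K by (auto simp: csubspace_def)
    qed
    then show "c \<odot>\<^bsub>V\<^esub> v \<in> topo V closure_of K" using iff vV closeds by blast
  qed
qed

lemma openin_subspace:
  assumes "K \<subseteq> carrier V"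
  shows "openin (subtopology (topo V) K) U \<longleftrightarrow>
    U \<subseteq> K \<and> (\<forall>u\<in>U. \<exists>e>0. \<forall>v\<in>K. nrm (sub v u) < e \<longrightarrow> v \<in> U)"
proof
  assume "openin (subtopology (topo V) K) U"
  then obtain T where T: "openin (topo V) T" "U = T \<inter> K" by (auto simp: openin_subtopology)
  show "U \<subseteq> K \<and> (\<forall>u\<in>U. \<exists>e>0. \<forall>v\<in>K. nrm (sub v u) < e \<longrightarrow> v \<in> U)"
    using T assms unfolding openin_iff by (metis IntD1 IntD2 IntI inf_le2 subsetD)
next
  assume U: "U \<subseteq> K \<and> (\<forall>u\<in>U. \<exists>e>0. \<forall>v\<in>K. nrm (sub v u) < e \<longrightarrow> v \<in> U)"
  then obtain e where e: "\<And>u. u \<in> U \<Longrightarrow> 0 < e u"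
    "\<And>u v. u \<in> U \<Longrightarrow> v \<in> K \<Longrightarrow> nrm (sub v u) < e u \<Longrightarrow> v \<in> U" by metis
  define T where "T = (\<Union>u\<in>U. {v \<in> carrier V. nrm (sub v u) < e u})"
  have UV: "U \<subseteq> carrier V" using U assms by auto
  have "openin (topo V) T" unfolding T_def using UV by (intro openin_Union) (auto intro: openin_ball)
  moreover have "U = T \<inter> K"
  proof
    show "U \<subseteq> T \<inter> K" using U UV e(1) by (auto simp: T_def sub_self nrm_zero subset_iff intro!: bexI)
    show "T \<inter> K \<subseteq> U" using e(2) by (auto simp: T_def)
  qed
  ultimately show "openin (subtopology (topo V) K) U" by (auto simp: openin_subtopology)
qed

end

section \<open>Quotients of subspaces\<close>

text \<open>In the application \<open>K\<close> consists of the cycles or cocycles and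
  \<open>N\<close> is the closure of the boundaries or coboundaries.\<close>

locale ell_subquotient = ell_ctvs V J r I
  for V :: "'v ctvs" and J :: "'v \<Rightarrow> 'i \<Rightarrow> complex" and r :: real and I :: "'i set" +
  fixes K N :: "'v set"
  assumes K: "csubspace V K" and N: "csubspace V N" and NK: "N \<subseteq> K"
begin

definition coset :: "'v \<Rightarrow> 'v set" where "coset v = N +>\<^bsub>V\<^esub> v"

definition Q :: "'v set ctvs" where "Q = quotient_ctvs (subspace_ctvs V K) N"

lemma KV: "v \<in> K \<Longrightarrow> v \<in> carrier V" and NV: "v \<in> N \<Longrightarrow> v \<in> carrier V"
  using K N by (auto simp: csubspace_def)

lemmas K_simps = csubspaceD(2-4)[OF K] subspace_sub[OF K]
lemmas N_simps = csubspaceD(2-4)[OF N] subspace_sub[OF N]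

lemma coset_def': "coset v = (\<lambda>n. n \<oplus>\<^bsub>V\<^esub> v) ` N"
  by (auto simp: coset_def a_r_coset_def r_coset_def)

lemma mem_coset_iff: "v \<in> carrier V \<Longrightarrow> u \<in> coset v \<longleftrightarrow> u \<in> carrier V \<and> sub u v \<in> N"
proof
  assume v: "v \<in> carrier V" and "u \<in> coset v"
  then obtain n where n: "n \<in> N" "u = n \<oplus>\<^bsub>V\<^esub> v" by (auto simp: coset_def')
  moreover have "sub u v = n" using n NV v by (simp add: J_eq_iff closeds J_simps)
  ultimately show "u \<in> carrier V \<and> sub u v \<in> N" using NV v closeds by simp
next
  assume v: "v \<in> carrier V" and u: "u \<in> carrier V \<and> sub u v \<in> N"
  then have "u = sub u v \<oplus>\<^bsub>V\<^esub> v" by (simp add: J_eq_iff closeds J_simps)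
  with u show "u \<in> coset v" by (auto simp: coset_def')
qed

lemma self_mem_coset: "v \<in> carrier V \<Longrightarrow> v \<in> coset v"
  using N_simps(1) by (simp add: mem_coset_iff sub_self)

lemma coset_eq_iff:
  assumes uv: "u \<in> carrier V" "v \<in> carrier V"
  shows "coset u = coset v \<longleftrightarrow> sub u v \<in> N"
proof
  show "sub u v \<in> N" if "coset u = coset v" using self_mem_coset[of u] that uv mem_coset_iff by auto
  assume N1: "sub u v \<in> N"
  show "coset u = coset v"
  proof (rule Set.set_eqI)
    fix x
    show "x \<in> coset u \<longleftrightarrow> x \<in> coset v"
    proof (cases "x \<in> carrier V")
      case True
      have "sub x v = sub x u \<oplus>\<^bsub>V\<^esub> sub u v" "sub x u = sub (sub x v) (sub u v)"
        using True uv by (simp_all add: J_eq_iff closeds J_simps)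
      then show ?thesis using N1 N_simps(2,4) uv True by (auto simp: mem_coset_iff) metis+
    qed (use uv in \<open>auto simp: mem_coset_iff\<close>)
  qed
qed

lemma carrier_Q: "carrier Q = coset ` K"
  by (auto simp: Q_def quotient_ctvs_def subspace_ctvs_def coset_def A_RCOSETS_def RCOSETS_def
      a_r_coset_def r_coset_def)

lemma zero_Q: "\<zero>\<^bsub>Q\<^esub> = coset \<zero>\<^bsub>V\<^esub>"
proof -
  have "coset \<zero>\<^bsub>V\<^esub> = N" using NV by (auto simp: mem_coset_iff zero_closed sub_zero)
  then show ?thesis by (simp add: Q_def quotient_ctvs_def)
qed

lemma add_Q: assumes "u \<in> K" "v \<in> K" shows "coset u \<oplus>\<^bsub>Q\<^esub> coset v = coset (u \<oplus>\<^bsub>V\<^esub> v)"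
proof -
  have uv: "u \<in> carrier V" "v \<in> carrier V" using assms KV by auto
  have "coset u \<oplus>\<^bsub>Q\<^esub> coset v = {a \<oplus>\<^bsub>V\<^esub> b |a b. a \<in> coset u \<and> b \<in> coset v}"
    by (auto simp: Q_def quotient_ctvs_def subspace_ctvs_def set_add_def set_mult_def)
  also have "\<dots> = coset (u \<oplus>\<^bsub>V\<^esub> v)"
  proof (intro equalityI subsetI; (elim CollectE exE conjE)?)
    fix x a b assume ab: "x = a \<oplus>\<^bsub>V\<^esub> b" "a \<in> coset u" "b \<in> coset v"
    then have abV: "a \<in> carrier V" "b \<in> carrier V" "sub a u \<in> N" "sub b v \<in> N"
      using uv by (auto simp: mem_coset_iff)
    have "sub (a \<oplus>\<^bsub>V\<^esub> b) (u \<oplus>\<^bsub>V\<^esub> v) = sub a u \<oplus>\<^bsub>V\<^esub> sub b v"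
      using abV uv by (simp add: J_eq_iff closeds J_simps algebra_simps)
    then show "x \<in> coset (u \<oplus>\<^bsub>V\<^esub> v)"
      using ab abV uv N_simps by (simp add: mem_coset_iff closeds)
  next
    fix x assume x: "x \<in> coset (u \<oplus>\<^bsub>V\<^esub> v)"
    then have xV: "x \<in> carrier V" "sub x (u \<oplus>\<^bsub>V\<^esub> v) \<in> N" using uv by (auto simp: mem_coset_iff closeds)
    have "x = sub x v \<oplus>\<^bsub>V\<^esub> v" "sub (sub x v) u = sub x (u \<oplus>\<^bsub>V\<^esub> v)"
      using xV(1) uv by (simp_all add: J_eq_iff closeds J_simps algebra_simps)
    moreover from this have "sub x v \<in> coset u" "v \<in> coset v"
      using xV uv self_mem_coset by (simp_all add: mem_coset_iff closeds)
    ultimately show "x \<in> {a \<oplus>\<^bsub>V\<^esub> b |a b. a \<in> coset u \<and> b \<in> coset v}"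
      by blast
  qed
  finally show ?thesis .
qed

lemma smult_Q: assumes "v \<in> K" shows "c \<odot>\<^bsub>Q\<^esub> coset v = coset (c \<odot>\<^bsub>V\<^esub> v)"
proof -
  have v: "v \<in> carrier V" using assms KV by auto
  have "c \<odot>\<^bsub>Q\<^esub> coset v = (\<Union>u\<in>coset v. coset (c \<odot>\<^bsub>V\<^esub> u))"
    by (auto simp: Q_def quotient_ctvs_def subspace_ctvs_def coset_def a_r_coset_def r_coset_def)
  also have "\<dots> = (\<Union>u\<in>coset v. coset (c \<odot>\<^bsub>V\<^esub> v))"
  proof (intro SUP_cong refl)
    fix u assume "u \<in> coset v"
    then have u: "u \<in> carrier V" "sub u v \<in> N" using v by (auto simp: mem_coset_iff)
    have "sub (c \<odot>\<^bsub>V\<^esub> u) (c \<odot>\<^bsub>V\<^esub> v) = c \<odot>\<^bsub>V\<^esub> sub u v"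
      using u v by (simp add: J_eq_iff closeds J_simps algebra_simps)
    then show "coset (c \<odot>\<^bsub>V\<^esub> u) = coset (c \<odot>\<^bsub>V\<^esub> v)"
      using u v N_simps by (simp add: coset_eq_iff closeds)
  qed
  also have "\<dots> = coset (c \<odot>\<^bsub>V\<^esub> v)" using self_mem_coset[OF v] by auto
  finally show ?thesis .
qed

text \<open>No norm is put on the quotient. Its topology is accessed from here on by testing balls
  of \<open>K\<close> around all representatives.\<close>

lemma openin_Q: "openin (topo Q) U \<longleftrightarrow>
    U \<subseteq> carrier Q \<and> (\<forall>v\<in>K. coset v \<in> U \<longrightarrow> (\<exists>e>0. \<forall>w\<in>K. nrm (sub w v) < e \<longrightarrow> coset w \<in> U))"
proof -
  have ts: "topspace (subtopology (topo V) K) = K"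
    using topspace_topo KV by auto
  have 1: "N +>\<^bsub>subspace_ctvs V K\<^esub> v = coset v" for v
    by (simp add: coset_def subspace_ctvs_def a_r_coset_def r_coset_def)
  have "openin (topo Q) U \<longleftrightarrow> U \<subseteq> carrier Q \<and> openin (subtopology (topo V) K) {v \<in> K. coset v \<in> U}"
    unfolding Q_def quotient_ctvs_def using ts
    by (simp add: openin_final_topology 1) (simp add: subspace_ctvs_def)
  also have "openin (subtopology (topo V) K) {v \<in> K. coset v \<in> U} \<longleftrightarrow>
      (\<forall>v\<in>K. coset v \<in> U \<longrightarrow> (\<exists>e>0. \<forall>w\<in>K. nrm (sub w v) < e \<longrightarrow> coset w \<in> U))"
    using KV by (subst openin_subspace) auto
  finally show ?thesis .
qed

lemma topspace_Q: "topspace (topo Q) = carrier Q"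
proof -
  have "openin (topo Q) (carrier Q)"
    unfolding openin_Q by (auto simp: carrier_Q intro: exI[of _ 1])
  moreover have "topspace (topo Q) \<subseteq> carrier Q"
    using openin_topspace[of "topo Q"] unfolding openin_Q by (rule conjunct1)
  ultimately show ?thesis by (intro equalityI openin_subset)
qed

section \<open>Functionals, bounded sets and the strong topology on a quotient\<close>

text \<open>The last clause is where continuity enters: the modulus of \<open>\<phi>\<close> is
  below 1 on a ball of radius \<open>e\<close>, and rescaling representatives to norm
  \<open>e / 2\<close> gives the constant \<open>2 / e\<close>.\<close>

lemma functional_properties:
  assumes "\<phi> \<in> continuous_functionals Q"
  shows "\<phi> \<in> extensional (carrier Q)"
    and "u \<in> K \<Longrightarrow> v \<in> K \<Longrightarrow> \<phi> (coset (u \<oplus>\<^bsub>V\<^esub> v)) = \<phi> (coset u) + \<phi> (coset v)"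
    and "v \<in> K \<Longrightarrow> \<phi> (coset (c \<odot>\<^bsub>V\<^esub> v)) = c * \<phi> (coset v)"
    and "\<exists>C\<ge>0. \<forall>v\<in>K. cmod (\<phi> (coset v)) \<le> C * nrm v"
proof -
  show "\<phi> \<in> extensional (carrier Q)" using assms by (simp add: continuous_functionals_def)
  have mm: "\<phi> \<in> module_maps UNIV Q complex_line" using assms by (simp add: continuous_functionals_def)
  show add: "\<phi> (coset (u \<oplus>\<^bsub>V\<^esub> v)) = \<phi> (coset u) + \<phi> (coset v)" if "u \<in> K" "v \<in> K" for u v
    using mm that by (simp add: module_maps_def complex_line_def carrier_Q add_Q[symmetric])
  show scale: "\<phi> (coset (c \<odot>\<^bsub>V\<^esub> v)) = c * \<phi> (coset v)" if "v \<in> K" for c v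
    using mm that by (simp add: module_maps_def complex_line_def carrier_Q smult_Q[symmetric])
  have z: "\<phi> (coset \<zero>\<^bsub>V\<^esub>) = 0"
  proof -
    have "0 \<odot>\<^bsub>V\<^esub> \<zero>\<^bsub>V\<^esub> = \<zero>\<^bsub>V\<^esub>" by (simp add: J_eq_iff closeds J_simps)
    then show ?thesis using scale[OF K_simps(1), of 0] by simp
  qed
  have "continuous_map (topo Q) euclidean \<phi>"
    using assms by (simp add: continuous_functionals_def complex_line_def)
  then have "openin (topo Q) {A \<in> topspace (topo Q). \<phi> A \<in> ball 0 1}"
    by (rule openin_continuous_map_preimage) simp
  then have "openin (topo Q) {A \<in> carrier Q. cmod (\<phi> A) < 1}" by (simp add: topspace_Q)
  moreover have "coset \<zero>\<^bsub>V\<^esub> \<in> {A \<in> carrier Q. cmod (\<phi> A) < 1}"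
    using z K_simps(1) by (simp add: carrier_Q)
  ultimately obtain e where e: "0 < e" "\<And>w. w \<in> K \<Longrightarrow> nrm (sub w \<zero>\<^bsub>V\<^esub>) < e \<Longrightarrow> cmod (\<phi> (coset w)) < 1"
    unfolding openin_Q using K_simps(1) by blast
  have "cmod (\<phi> (coset v)) \<le> (2 / e) * nrm v" if v: "v \<in> K" for v
  proof (cases "nrm v = 0")
    case True
    then have "J v = J \<zero>\<^bsub>V\<^esub>"
      using ell_norm_eq_0D[OF J_ell[OF KV[OF v]]] r1 by (simp add: J_zero nrm_def)
    then have "v = \<zero>\<^bsub>V\<^esub>" using KV v zero_closed by (simp add: J_eq_iff)
    then show ?thesis using z e by simp
  next
    case False
    then have pos: "0 < nrm v" by (simp add: less_le)
    define t where "t = e / (2 * nrm v)"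
    have t: "0 < t" using e pos by (simp add: t_def)
    have "nrm (of_real t \<odot>\<^bsub>V\<^esub> v) = e / 2" using KV[OF v] t pos by (simp add: nrm_smult) (simp add: t_def)
    then have "cmod (\<phi> (coset (of_real t \<odot>\<^bsub>V\<^esub> v))) < 1"
      using e v K_simps KV by (intro e) (simp_all add: sub_zero)
    then have "t * cmod (\<phi> (coset v)) < 1" using t by (simp add: scale[OF v] norm_mult)
    then show ?thesis using e(1) pos by (simp add: t_def field_simps)
  qed
  then show "\<exists>C\<ge>0. \<forall>v\<in>K. cmod (\<phi> (coset v)) \<le> C * nrm v"
    using e(1) by (intro exI[of _ "2 / e"]) auto
qed

text \<open>The converse direction: a linear functional bounded on representatives is continuous.
  The radius divides by \<open>C + 1\<close> because \<open>C\<close> may be 0.\<close>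

lemma functionalI:
  assumes ext: "\<phi> \<in> extensional (carrier Q)"
    and add: "\<And>u v. u \<in> K \<Longrightarrow> v \<in> K \<Longrightarrow> \<phi> (coset (u \<oplus>\<^bsub>V\<^esub> v)) = \<phi> (coset u) + \<phi> (coset v)"
    and scale: "\<And>c v. v \<in> K \<Longrightarrow> \<phi> (coset (c \<odot>\<^bsub>V\<^esub> v)) = c * \<phi> (coset v)"
    and le: "\<And>v. v \<in> K \<Longrightarrow> cmod (\<phi> (coset v)) \<le> C * nrm v" and C: "0 \<le> C"
  shows "\<phi> \<in> continuous_functionals Q"
proof -
  have "\<phi> \<in> module_maps UNIV Q complex_line"
    using add scale by (auto simp: module_maps_def complex_line_def carrier_Q add_Q smult_Q)
  moreover have "continuous_map (topo Q) euclidean \<phi>"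
    unfolding continuous_map topspace_Q
  proof (intro conjI allI impI)
    fix U :: "complex set" assume "openin euclidean U"
    then have U: "open U" by simp
    show "openin (topo Q) {x \<in> carrier Q. \<phi> x \<in> U}"
      unfolding openin_Q
    proof (intro conjI ballI impI)
      fix v assume v: "v \<in> K" "coset v \<in> {x \<in> carrier Q. \<phi> x \<in> U}"
      then obtain e where e: "0 < e" "ball (\<phi> (coset v)) e \<subseteq> U"
        using U by (auto simp: open_contains_ball)
      have "coset w \<in> {x \<in> carrier Q. \<phi> x \<in> U}" if w: "w \<in> K" "nrm (sub w v) < e / (C + 1)" for w
      proof -
        have "\<phi> (coset (sub w v)) = \<phi> (coset w) - \<phi> (coset v)"
          using w v K_simps by (simp add: sub_def add scale)
        then have "cmod (\<phi> (coset w) - \<phi> (coset v)) \<le> C * nrm (sub w v)"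
          using le[of "sub w v"] w v K_simps by simp
        also have "\<dots> \<le> (C + 1) * nrm (sub w v)" by (intro mult_right_mono) auto
        also have "\<dots> < e" using w(2) C by (simp add: field_simps)
        finally show ?thesis
          using e(2) w(1) by (auto simp: carrier_Q dist_norm norm_minus_commute)
      qed
      then show "\<exists>e>0. \<forall>w\<in>K. nrm (sub w v) < e \<longrightarrow> coset w \<in> {x \<in> carrier Q. \<phi> x \<in> U}"
        using e C by (intro exI[of _ "e / (C + 1)"]) auto
    qed auto
  qed simp
  ultimately show ?thesis
    using ext by (simp add: continuous_functionals_def complex_line_def)
qed

lemma tvs_bounded_image_ball: "tvs_bounded Q (coset ` {v \<in> K. nrm v \<le> 1})"
  unfolding tvs_bounded_def
proof (intro conjI allI impI; (elim conjE)?)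
  show "coset ` {v \<in> K. nrm v \<le> 1} \<subseteq> carrier Q" by (auto simp: carrier_Q)
  fix U assume U: "openin (topo Q) U" "\<zero>\<^bsub>Q\<^esub> \<in> U"
  then obtain e where e: "0 < e" "\<And>w. w \<in> K \<Longrightarrow> nrm (sub w \<zero>\<^bsub>V\<^esub>) < e \<Longrightarrow> coset w \<in> U"
    unfolding openin_Q zero_Q using K_simps(1) by blast
  have "coset v \<in> (\<lambda>A. c \<odot>\<^bsub>Q\<^esub> A) ` U" if v: "v \<in> K" "nrm v \<le> 1" and c: "2 / e \<le> cmod c" for v c
  proof (rule image_eqI)
    have c0: "0 < cmod c" using c e by (meson divide_pos_pos less_le_trans zero_less_numeral)
    \<comment> \<open>Splitting off \<open>c\<close> leaves a vector of norm at most
      \<open>e / 2\<close>, inside the ball that is mapped into \<open>U\<close>.\<close>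
    have "c \<odot>\<^bsub>V\<^esub> ((1 / c) \<odot>\<^bsub>V\<^esub> v) = v"
      using v KV c0 by (simp add: J_eq_iff closeds J_simps)
    then show "coset v = c \<odot>\<^bsub>Q\<^esub> coset ((1 / c) \<odot>\<^bsub>V\<^esub> v)" using v K_simps by (simp add: smult_Q)
    have "nrm ((1 / c) \<odot>\<^bsub>V\<^esub> v) = nrm v / cmod c" using v KV by (simp add: nrm_smult norm_divide)
    also have "\<dots> \<le> 1 / cmod c" using v c0 by (simp add: divide_right_mono)
    also have "\<dots> < e" using c c0 e by (simp add: field_simps)
    finally show "coset ((1 / c) \<odot>\<^bsub>V\<^esub> v) \<in> U"
      using v K_simps KV closeds by (intro e) (simp_all add: sub_zero)
  qed
  then show "\<exists>t>0. \<forall>c. t \<le> cmod c \<longrightarrow> coset ` {v \<in> K. nrm v \<le> 1} \<subseteq> (\<lambda>A. c \<odot>\<^bsub>Q\<^esub> A) ` U"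
    using e(1) by (intro exI[of _ "2 / e"]) auto
qed

text \<open>The quotient map is open, so the image \<open>U\<close> of the open unit ball is a
  neighbourhood of 0; it absorbs \<open>B\<close>, and its elements have representatives of norm
  below 1.\<close>

lemma tvs_bounded_representatives:
  assumes B: "tvs_bounded Q B"
  obtains R where "0 < R" "\<And>A. A \<in> B \<Longrightarrow> \<exists>v\<in>K. A = coset v \<and> nrm v \<le> R"
proof -
  define U where "U = coset ` {v \<in> K. nrm v < 1}"
  have "openin (topo Q) U"
    unfolding openin_Q
  proof (intro conjI ballI impI)
    show "U \<subseteq> carrier Q" by (auto simp: U_def carrier_Q)
    fix v assume v: "v \<in> K" "coset v \<in> U"
    then obtain v' where v': "v' \<in> K" "nrm v' < 1" "coset v = coset v'" by (auto simp: U_def)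
    have "coset w \<in> U" if w: "w \<in> K" "nrm (sub w v) < 1 - nrm v'" for w
      unfolding U_def
    proof (rule image_eqI)
      have V: "v \<in> carrier V" "v' \<in> carrier V" "w \<in> carrier V" using v v' w KV by auto
      \<comment> \<open>The short representative \<open>v'\<close> is shifted by
        \<open>w - v\<close>; the result lies in the coset of \<open>w\<close> and still has norm
        below 1.\<close>
      have "sub w (v' \<oplus>\<^bsub>V\<^esub> sub w v) = sub v v'"
        using V by (simp add: J_eq_iff closeds J_simps)
      then show "coset w = coset (v' \<oplus>\<^bsub>V\<^esub> sub w v)"
        using v'(3) V by (simp add: coset_eq_iff closeds)
      have "nrm (v' \<oplus>\<^bsub>V\<^esub> sub w v) < 1" using nrm_add_le[of v' "sub w v"] V w by (simp add: closeds)
      then show "v' \<oplus>\<^bsub>V\<^esub> sub w v \<in> {v \<in> K. nrm v < 1}" using v v' w K_simps by simp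
    qed
    then show "\<exists>e>0. \<forall>w\<in>K. nrm (sub w v) < e \<longrightarrow> coset w \<in> U"
      using v'(2) by (intro exI[of _ "1 - nrm v'"]) auto
  qed
  moreover have "\<zero>\<^bsub>Q\<^esub> \<in> U" using K_simps(1) by (auto simp: U_def zero_Q nrm_zero)
  ultimately obtain t where t: "0 < t" "\<And>c. t \<le> cmod c \<Longrightarrow> B \<subseteq> (\<lambda>A. c \<odot>\<^bsub>Q\<^esub> A) ` U"
    using B unfolding tvs_bounded_def by blast
  show ?thesis
  proof (rule that[OF t(1)])
    fix A assume "A \<in> B"
    then have "A \<in> (\<lambda>A. of_real t \<odot>\<^bsub>Q\<^esub> A) ` U" using t(2)[of "of_real t"] t(1) by auto
    then obtain v where v: "v \<in> K" "nrm v < 1" "A = of_real t \<odot>\<^bsub>Q\<^esub> coset v" by (auto simp: U_def)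
    have "nrm (of_real t \<odot>\<^bsub>V\<^esub> v) = t * nrm v" using v KV t by (simp add: nrm_smult)
    also have "\<dots> \<le> t * 1" using v t by (intro mult_left_mono) auto
    finally show "\<exists>v\<in>K. A = coset v \<and> nrm v \<le> t"
      using v K_simps by (auto simp: smult_Q)
  qed
qed

text \<open>Bounded sets lie in multiples of the image of the unit ball, and that image is itself
  bounded, so this single set determines the topology: it is that of the dual norm.\<close>

lemma openin_strong_Q:
  "openin (strong_topology Q) U \<longleftrightarrow> U \<subseteq> continuous_functionals Q \<and>
    (\<forall>\<phi>\<in>U. \<exists>e>0. \<forall>\<psi>\<in>continuous_functionals Q.
      (\<forall>v\<in>K. nrm v \<le> 1 \<longrightarrow> cmod (\<psi> (coset v) - \<phi> (coset v)) < e) \<longrightarrow> \<psi> \<in> U)"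
proof -
  have "(\<exists>B e. tvs_bounded Q B \<and> 0 < e \<and>
        (\<forall>\<psi>\<in>continuous_functionals Q. (\<forall>A\<in>B. cmod (\<psi> A - \<phi> A) < e) \<longrightarrow> \<psi> \<in> U)) \<longleftrightarrow>
     (\<exists>e>0. \<forall>\<psi>\<in>continuous_functionals Q.
      (\<forall>v\<in>K. nrm v \<le> 1 \<longrightarrow> cmod (\<psi> (coset v) - \<phi> (coset v)) < e) \<longrightarrow> \<psi> \<in> U)" (is "?l \<longleftrightarrow> ?r")
    if \<phi>: "\<phi> \<in> continuous_functionals Q" for \<phi>
  proof
    assume ?l
    then obtain B e where B: "tvs_bounded Q B" "0 < e"
      "\<And>\<psi>. \<psi> \<in> continuous_functionals Q \<Longrightarrow> (\<forall>A\<in>B. cmod (\<psi> A - \<phi> A) < e) \<Longrightarrow> \<psi> \<in> U" by blast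
    obtain R where R: "0 < R" "\<And>A. A \<in> B \<Longrightarrow> \<exists>v\<in>K. A = coset v \<and> nrm v \<le> R"
      using tvs_bounded_representatives[OF B(1)] by blast
    have "\<psi> \<in> U" if \<psi>: "\<psi> \<in> continuous_functionals Q"
      "\<forall>v\<in>K. nrm v \<le> 1 \<longrightarrow> cmod (\<psi> (coset v) - \<phi> (coset v)) < e / R" for \<psi>
    proof (rule B(3)[OF \<psi>(1)], intro ballI)
      fix A assume "A \<in> B"
      then obtain v where v: "v \<in> K" "A = coset v" "nrm v \<le> R" using R by blast
      \<comment> \<open>Scaling a representative of norm at most \<open>R\<close> into the unit ball
        costs the factor \<open>R\<close>, whence the radius \<open>e / R\<close>.\<close>
      define w where "w = of_real (1 / R) \<odot>\<^bsub>V\<^esub> v"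
      have "nrm w \<le> 1" unfolding w_def using v KV R by (simp add: nrm_smult norm_divide)
      moreover have w: "w \<in> K" using v K_simps by (simp add: w_def)
      ultimately have "cmod (\<psi> (coset w) - \<phi> (coset w)) < e / R" using \<psi> by blast
      moreover have "\<psi> (coset w) - \<phi> (coset w) = of_real (1 / R) * (\<psi> A - \<phi> A)"
        using functional_properties(3)[OF \<phi> v(1)] functional_properties(3)[OF \<psi>(1) v(1)] v
        unfolding w_def by (simp only: right_diff_distrib)
      ultimately have "1 / R * cmod (\<psi> A - \<phi> A) < e / R" using R by (simp add: norm_mult norm_divide)
      then show "cmod (\<psi> A - \<phi> A) < e" using R by (simp add: field_simps)
    qed
    then show ?r using B R by (intro exI[of _ "e / R"]) auto
  next
    assume ?r
    then obtain e where "0 < e" "\<forall>\<psi>\<in>continuous_functionals Q.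
      (\<forall>v\<in>K. nrm v \<le> 1 \<longrightarrow> cmod (\<psi> (coset v) - \<phi> (coset v)) < e) \<longrightarrow> \<psi> \<in> U" by blast
    then show ?l
      using tvs_bounded_image_ball by (intro exI[of _ "coset ` {v \<in> K. nrm v \<le> 1}"] exI[of _ e]) auto
  qed
  then show ?thesis unfolding openin_strong_topology by blast
qed

end

section \<open>Duality of subquotients\<close>

lemma indicator_ell:
  assumes "j \<in> I" "1 < r"
  shows "(\<lambda>i. if i = j then 1 else 0) \<in> ell r I"
proof (rule ellI_bound(1))
  fix F assume F: "finite F" "F \<subseteq> I"
  have "(\<Sum>i\<in>F. cmod (if i = j then 1 else 0) powr r) = (\<Sum>i\<in>F. if i = j then 1 else 0)"
    by (intro sum.cong) auto
  also have "\<dots> \<le> 1 powr r" using F by simp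
  finally show "(\<Sum>i\<in>F. cmod (if i = j then 1 else 0) powr r) \<le> 1 powr r" .
qed (use assms in auto)

lemma ell_pair_indicator:
  assumes "j \<in> I"
  shows "ell_pair I (\<lambda>i. if i = j then 1 else 0) x = x j"
proof -
  have "ell_pair I (\<lambda>i. if i = j then 1 else 0) x = (\<Sum>\<^sub>\<infinity>i\<in>{j}. x i)"
    unfolding ell_pair_def using assms by (intro infsum_cong_neutral) auto
  then show ?thesis by simp
qed

context conjugate_exponents
begin

text \<open>Tested on the indicators of single indices.\<close>

lemma ell_pair_nondegenerate:
  assumes "x \<in> ell q I" "\<And>y. y \<in> ell p I \<Longrightarrow> ell_pair I y x = 0"
  shows "x = (\<lambda>i. 0)"
proof
  fix j
  show "x j = 0"
  proof (cases "j \<in> I")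
    case True
    have "x j = ell_pair I (\<lambda>i. if i = j then 1 else 0) x" by (simp only: ell_pair_indicator[OF True])
    also have "\<dots> = 0" by (rule assms(2)[OF indicator_ell[OF True p1]])
    finally show ?thesis .
  qed (rule ell_outside[OF assms(1)])
qed

text \<open>\<open>A\<close> and \<open>B\<close> behave like ranges of adjoint projections. For a
  limit \<open>x\<close> of \<open>A\<close> let \<open>a\<close> be its projection. Replacing a
  test element \<open>y\<close> by its projection \<open>b\<close> gives \<open>\<langle>y,
  x\<rangle> = \<langle>b, x\<rangle> = \<langle>b, a\<rangle> = \<langle>y, a\<rangle>\<close>, so
  \<open>x = a\<close>.\<close>

lemma ell_closed_dual_range:
  assumes A: "A \<subseteq> ell q I" "A \<noteq> {}" and B: "B \<subseteq> ell p I"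
    and BA: "\<And>y. y \<in> ell p I \<Longrightarrow> \<exists>b\<in>B. \<forall>a\<in>A. ell_pair I b a = ell_pair I y a"
    and AB: "\<And>x. x \<in> ell q I \<Longrightarrow> \<exists>a\<in>A. \<forall>b\<in>B. ell_pair I b a = ell_pair I b x"
  shows "ell_closed q I A"
  unfolding ell_closed_def
proof (intro conjI A(1) ballI impI)
  fix x assume x: "x \<in> ell q I" and lim: "\<forall>e>0. \<exists>a\<in>A. ell_norm q I (\<lambda>i. x i - a i) < e"
  obtain a where a: "a \<in> A" "\<And>b. b \<in> B \<Longrightarrow> ell_pair I b a = ell_pair I b x" using AB[OF x] by blast
  have ae: "a \<in> ell q I" using a A by auto
  have "(\<lambda>i. x i - a i) = (\<lambda>i. 0)"
  proof (rule ell_pair_nondegenerate[of _ I])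
    show "(\<lambda>i. x i - a i) \<in> ell q I" using x ae q1 by (rule ell_diff)
    fix y assume y: "y \<in> ell p I"
    obtain b where b: "b \<in> B" "\<And>a. a \<in> A \<Longrightarrow> ell_pair I b a = ell_pair I y a" using BA[OF y] by blast
    have be: "b \<in> ell p I" using b B by auto
    \<comment> \<open>\<open>y\<close> and \<open>b\<close> pair equally with the elements of
      \<open>A\<close>, hence also with their limit \<open>x\<close>.\<close>
    have "ell_pair I y x - ell_pair I b x = 0"
    proof (rule complex_eq_0_if_le)
      fix e :: real assume "0 < e"
      then obtain k where k: "k \<in> A" "ell_norm q I (\<lambda>i. x i - k i) < e" using lim by blast
      have ke: "k \<in> ell q I" using k A by auto
      have d: "(\<lambda>i. x i - k i) \<in> ell q I" using x ke q1 by (rule ell_diff)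
      have "ell_pair I y x - ell_pair I b x = ell_pair I y (\<lambda>i. x i - k i) - ell_pair I b (\<lambda>i. x i - k i)"
        by (simp only: pair_diff_right[OF y x ke] pair_diff_right[OF be x ke] b(2)[OF k(1)]) simp
      then have "cmod (ell_pair I y x - ell_pair I b x)
          \<le> cmod (ell_pair I y (\<lambda>i. x i - k i)) + cmod (ell_pair I b (\<lambda>i. x i - k i))"
        by (simp only: norm_triangle_ineq4)
      also have "\<dots> \<le> ell_norm p I y * ell_norm q I (\<lambda>i. x i - k i) + ell_norm p I b * ell_norm q I (\<lambda>i. x i - k i)"
        by (intro add_mono pair_le y be d)
      also have "\<dots> \<le> ell_norm p I y * e + ell_norm p I b * e"
        using k by (intro add_mono mult_left_mono) auto
      also have "\<dots> = (ell_norm p I y + ell_norm p I b) * e" by (simp add: distrib_right)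
      finally show "cmod (ell_pair I y x - ell_pair I b x) \<le> (ell_norm p I y + ell_norm p I b) * e" .
    qed auto
    then have "ell_pair I y x = ell_pair I y a" using b(2)[OF a(1)] a(2)[OF b(1)] by simp
    then show "ell_pair I y (\<lambda>i. x i - a i) = 0" by (simp add: pair_diff_right[OF y x ae])
  qed
  then have "x = a" by (simp add: fun_eq_iff)
  then show "x \<in> A" using a by simp
qed

end

text \<open>Passes from closedness within \<open>V\<close> to closedness within all of
  \<open>ell r I\<close>, as the existence of points of minimal norm requires.\<close>

lemma (in ell_ctvs) ell_closed_image:
  assumes "ell_closed r I (J ` carrier V)" "Z \<subseteq> carrier V"
    and cl: "\<And>v. v \<in> carrier V \<Longrightarrow> (\<forall>e>0. \<exists>k\<in>Z. nrm (sub v k) < e) \<Longrightarrow> v \<in> Z"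
  shows "ell_closed r I (J ` Z)"
  unfolding ell_closed_def
proof (intro conjI ballI impI)
  show "J ` Z \<subseteq> ell r I" using assms J_ell by auto
  fix x assume x: "x \<in> ell r I" and lim: "\<forall>e>0. \<exists>k\<in>J ` Z. ell_norm r I (\<lambda>i. x i - k i) < e"
  then have "\<forall>e>0. \<exists>k\<in>J ` carrier V. ell_norm r I (\<lambda>i. x i - k i) < e"
    using assms(2) by blast
  then have "x \<in> J ` carrier V" using x assms(1) by (simp add: ell_closed_def)
  then obtain v where v: "v \<in> carrier V" "x = J v" by blast
  have "\<forall>e>0. \<exists>k\<in>Z. nrm (sub v k) < e"
  proof (intro allI impI)
    fix e :: real assume "0 < e"
    then obtain k where k: "k \<in> Z" "ell_norm r I (\<lambda>i. x i - J k i) < e" using lim by blast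
    then have "nrm (sub v k) < e" using v assms(2) by (simp add: nrm_def J_sub subset_iff)
    with k(1) show "\<exists>k\<in>Z. nrm (sub v k) < e" by blast
  qed
  then show "x \<in> J ` Z" using cl v by blast
qed

lemma (in ell_ctvs) csubspace_image:
  assumes "csubspace V Z"
  shows "J ` Z \<noteq> {}" "x \<in> J ` Z \<Longrightarrow> y \<in> J ` Z \<Longrightarrow> (\<lambda>i. x i + y i) \<in> J ` Z"
    "x \<in> J ` Z \<Longrightarrow> (\<lambda>i. c * x i) \<in> J ` Z"
proof -
  note Z = csubspaceD[OF assms]
  show "J ` Z \<noteq> {}" using Z(2) by auto
  show "(\<lambda>i. x i + y i) \<in> J ` Z" if xy: "x \<in> J ` Z" "y \<in> J ` Z" for x y
  proof -
    obtain u v where uv: "u \<in> Z" "v \<in> Z" "x = J u" "y = J v" using xy by blast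
    then have "(\<lambda>i. x i + y i) = J (u \<oplus>\<^bsub>V\<^esub> v)" using Z(1) by (simp add: J_add)
    then show ?thesis using Z(3)[OF uv(1,2)] by (rule image_eqI)
  qed
  show "(\<lambda>i. c * x i) \<in> J ` Z" if x: "x \<in> J ` Z" for x
  proof -
    obtain u where u: "u \<in> Z" "x = J u" using x by blast
    then have "(\<lambda>i. c * x i) = J (c \<odot>\<^bsub>V\<^esub> u)" using Z(1) by (simp add: J_smult)
    then show ?thesis using Z(4)[OF u(1)] by (rule image_eqI)
  qed
qed

text \<open>
  \<open>F\<^sub>i\<close> being only projective, \<open>V\<close> and \<open>W\<close> need not be full \<open>\<ell>\<close>-spaces.  That they are still dual
  to each other amounts to both being complemented, with adjoint projections; the last two
  assumptions are what this provides.
\<close>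

locale ell_dual_pair = conjugate_exponents p q + V: ell_ctvs V JV q I + W: ell_ctvs W JW p I
  for p q :: real and V :: "'v ctvs" and JV :: "'v \<Rightarrow> 'i \<Rightarrow> complex"
    and W :: "'w ctvs" and JW :: "'w \<Rightarrow> 'i \<Rightarrow> complex" and I :: "'i set" +
  fixes D :: real
  assumes D: "0 \<le> D"
    and W_represents: "y \<in> ell p I \<Longrightarrow> \<exists>w\<in>carrier W. ell_norm p I (JW w) \<le> D * ell_norm p I y \<and>
        (\<forall>v\<in>carrier V. ell_pair I (JW w) (JV v) = ell_pair I y (JV v))"
    and V_represents: "x \<in> ell q I \<Longrightarrow> \<exists>v\<in>carrier V. \<forall>w\<in>carrier W.
        ell_pair I (JW w) (JV v) = ell_pair I (JW w) x"
begin

definition pairing :: "'w \<Rightarrow> 'v \<Rightarrow> complex" where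
  "pairing w v = ell_pair I (JW w) (JV v)"

lemma pairing_le: "w \<in> carrier W \<Longrightarrow> v \<in> carrier V \<Longrightarrow> cmod (pairing w v) \<le> W.nrm w * V.nrm v"
  unfolding pairing_def W.nrm_def V.nrm_def by (intro pair_le W.J_ell V.J_ell)

lemma pairing_right:
  assumes "w \<in> carrier W" "v \<in> carrier V"
  shows "pairing w (c \<odot>\<^bsub>V\<^esub> v) = c * pairing w v"
    and "v' \<in> carrier V \<Longrightarrow> pairing w (v \<oplus>\<^bsub>V\<^esub> v') = pairing w v + pairing w v'"
    and "v' \<in> carrier V \<Longrightarrow> pairing w (V.sub v v') = pairing w v - pairing w v'"
  unfolding pairing_def using assms
  by (simp_all add: V.J_simps pair_add_right pair_scale_right pair_diff_right W.J_ell V.J_ell)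

lemma pairing_left:
  assumes "v \<in> carrier V" "w \<in> carrier W"
  shows "pairing (c \<odot>\<^bsub>W\<^esub> w) v = c * pairing w v"
    and "w' \<in> carrier W \<Longrightarrow> pairing (w \<oplus>\<^bsub>W\<^esub> w') v = pairing w v + pairing w' v"
    and "w' \<in> carrier W \<Longrightarrow> pairing (W.sub w w') v = pairing w v - pairing w' v"
proof -
  interpret S: conjugate_exponents q p by (rule swap)
  show "pairing (c \<odot>\<^bsub>W\<^esub> w) v = c * pairing w v"
    and "w' \<in> carrier W \<Longrightarrow> pairing (w \<oplus>\<^bsub>W\<^esub> w') v = pairing w v + pairing w' v"
    and "w' \<in> carrier W \<Longrightarrow> pairing (W.sub w w') v = pairing w v - pairing w' v"
    unfolding pairing_def ell_pair_commute[of I _ "JV v"] using assms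
    by (simp_all add: W.J_simps S.pair_add_right S.pair_scale_right S.pair_diff_right W.J_ell V.J_ell)
qed

lemma closed_range_V: "ell_closed q I (JV ` carrier V)"
proof (rule ell_closed_dual_range[of _ I "JW ` carrier W"])
  show "JV ` carrier V \<subseteq> ell q I" "JW ` carrier W \<subseteq> ell p I" using V.J_ell W.J_ell by auto
  show "JV ` carrier V \<noteq> {}" using V.zero_closed by auto
  show "\<exists>b\<in>JW ` carrier W. \<forall>a\<in>JV ` carrier V. ell_pair I b a = ell_pair I y a"
    if "y \<in> ell p I" for y using W_represents[OF that] by auto
  show "\<exists>a\<in>JV ` carrier V. \<forall>b\<in>JW ` carrier W. ell_pair I b a = ell_pair I b x"
    if "x \<in> ell q I" for x using V_represents[OF that] by auto
qed

lemma closed_range_W: "ell_closed p I (JW ` carrier W)"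
proof (rule conjugate_exponents.ell_closed_dual_range[OF swap, of _ I "JV ` carrier V"])
  show "JV ` carrier V \<subseteq> ell q I" "JW ` carrier W \<subseteq> ell p I" using V.J_ell W.J_ell by auto
  show "JW ` carrier W \<noteq> {}" using W.zero_closed by auto
  show "\<exists>b\<in>JV ` carrier V. \<forall>a\<in>JW ` carrier W. ell_pair I b a = ell_pair I y a"
    if "y \<in> ell q I" for y
    using V_represents[OF that] by (simp add: ell_pair_commute)
  show "\<exists>a\<in>JW ` carrier W. \<forall>b\<in>JV ` carrier V. ell_pair I b a = ell_pair I b x"
    if "x \<in> ell p I" for x
    using W_represents[OF that] by (simp add: ell_pair_commute[of I "JV _"]) blast
qed

text \<open>The functional is moved to the image of \<open>Z\<close>, where it is represented in
  \<open>ell p I\<close> with the same bound \<open>C\<close>; projecting the representative to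
  \<open>W\<close> keeps its pairings with \<open>V\<close> and costs the factor \<open>D\<close>.
  Since \<open>V\<close> carries the exponent \<open>q\<close>, the exponents are exchanged
  here.\<close>

lemma functional_on_closed_subspace:
  assumes Z: "csubspace V Z" and cl: "\<And>v. v \<in> carrier V \<Longrightarrow> (\<forall>e>0. \<exists>k\<in>Z. V.nrm (V.sub v k) < e) \<Longrightarrow> v \<in> Z"
    and f_add: "\<And>u v. u \<in> Z \<Longrightarrow> v \<in> Z \<Longrightarrow> f (u \<oplus>\<^bsub>V\<^esub> v) = f u + f v"
    and f_scale: "\<And>c v. v \<in> Z \<Longrightarrow> f (c \<odot>\<^bsub>V\<^esub> v) = c * f v"
    and f_le: "\<And>v. v \<in> Z \<Longrightarrow> cmod (f v) \<le> C * V.nrm v" and C: "0 \<le> C"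
  obtains w where "w \<in> carrier W" "W.nrm w \<le> D * C" "\<And>v. v \<in> Z \<Longrightarrow> pairing w v = f v"
proof -
  define h where "h = inv_into Z JV"
  note ZV = csubspaceD[OF Z]
  have h: "h (JV v) = v" if "v \<in> Z" for v
    unfolding h_def by (rule inv_into_f_f[OF inj_on_subset[OF V.J_inj]]) (use ZV(1) that in auto)
  interpret S: conjugate_exponents q p by (rule swap)
  have ZV': "Z \<subseteq> carrier V" using ZV(1) by auto
  note im = V.csubspace_image[OF Z]
  have 1: "f (h (\<lambda>i. x i + y i)) = f (h x) + f (h y)" if xy: "x \<in> JV ` Z" "y \<in> JV ` Z" for x y
  proof -
    obtain u v where uv: "u \<in> Z" "v \<in> Z" "x = JV u" "y = JV v" using xy by auto
    have "(\<lambda>i. x i + y i) = JV (u \<oplus>\<^bsub>V\<^esub> v)" using uv ZV(1) by (simp add: V.J_add)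
    then show ?thesis using uv ZV(3) f_add by (simp add: h)
  qed
  have 2: "f (h (\<lambda>i. c * x i)) = c * f (h x)" if x: "x \<in> JV ` Z" for x c
  proof -
    obtain u where u: "u \<in> Z" "x = JV u" using x by auto
    have "(\<lambda>i. c * x i) = JV (c \<odot>\<^bsub>V\<^esub> u)" using u ZV(1) by (simp add: V.J_smult)
    then show ?thesis using u ZV(4) f_scale by (simp add: h)
  qed
  have 3: "cmod (f (h x)) \<le> C * ell_norm q I x" if "x \<in> JV ` Z" for x
    using that f_le h by (auto simp: V.nrm_def)
  obtain y where y: "y \<in> ell p I" "ell_norm p I y \<le> C" "\<And>z. z \<in> JV ` Z \<Longrightarrow> ell_pair I z y = f (h z)"
    using S.functional_represented[OF V.ell_closed_image[OF closed_range_V ZV' cl] im(1) im(2) im(3) 1 2 3 C]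
    by blast
  obtain w where w: "w \<in> carrier W" "ell_norm p I (JW w) \<le> D * ell_norm p I y"
    "\<And>v. v \<in> carrier V \<Longrightarrow> ell_pair I (JW w) (JV v) = ell_pair I y (JV v)"
    using W_represents[OF y(1)] by blast
  show ?thesis
  proof (rule that[OF w(1)])
    show "W.nrm w \<le> D * C"
      using w(2) mult_left_mono[OF y(2) D] by (simp add: W.nrm_def)
    show "pairing w v = f v" if "v \<in> Z" for v
      using w(3)[of v] y(3)[of "JV v"] that ZV(1) h by (simp add: pairing_def ell_pair_commute)
  qed
qed

text \<open>The separating element found in \<open>ell q I\<close> is projected to \<open>V\<close>,
  which preserves its pairings with all of \<open>W\<close>.\<close>

lemma separating_element:
  assumes Z: "csubspace W Z" and cl: "\<And>v. v \<in> carrier W \<Longrightarrow> (\<forall>e>0. \<exists>k\<in>Z. W.nrm (W.sub v k) < e) \<Longrightarrow> v \<in> Z"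
    and w: "w \<in> carrier W" "w \<notin> Z"
  obtains v where "v \<in> carrier V" "\<And>z. z \<in> Z \<Longrightarrow> pairing z v = 0" "pairing w v \<noteq> 0"
proof -
  note ZW = csubspaceD[OF Z]
  have ZW': "Z \<subseteq> carrier W" using ZW(1) by auto
  note im = W.csubspace_image[OF Z]
  have "JW w \<notin> JW ` Z" using w ZW(1) by (auto dest: inj_onD[OF W.J_inj])
  then obtain u where u: "u \<in> ell q I" "\<And>z. z \<in> JW ` Z \<Longrightarrow> ell_pair I z u = 0" "ell_pair I (JW w) u \<noteq> 0"
    using separating_functional[OF W.ell_closed_image[OF closed_range_W ZW' cl] im(1) im(2) im(3) W.J_ell[OF w(1)]]
    by blast
  obtain v where v: "v \<in> carrier V" "\<And>w. w \<in> carrier W \<Longrightarrow> ell_pair I (JW w) (JV v) = ell_pair I (JW w) u"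
    using V_represents[OF u(1)] by blast
  show ?thesis
    using u v w ZW(1) by (intro that[OF v(1)]) (auto simp: pairing_def)
qed

end

section \<open>The duality map between two subquotients\<close>

text \<open>In the application \<open>B\<close> consists of boundaries and \<open>C\<close> of
  coboundaries, and their orthogonality comes from \<open>d \<circ> d = 0\<close>. The annihilators
  \<open>Z\<close> and \<open>Y\<close> will be the cycles and the cocycles.\<close>

locale ell_dual_subspaces = ell_dual_pair p q V JV W JW I D
  for p q :: real and V :: "'v ctvs" and JV :: "'v \<Rightarrow> 'i \<Rightarrow> complex"
    and W :: "'w ctvs" and JW :: "'w \<Rightarrow> 'i \<Rightarrow> complex" and I :: "'i set" and D +
  fixes B :: "'v set" and C :: "'w set"
  assumes B: "csubspace V B" and C: "csubspace W C"
    and CB: "w \<in> C \<Longrightarrow> v \<in> B \<Longrightarrow> pairing w v = 0"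
begin

definition "Z = {v \<in> carrier V. \<forall>w\<in>C. pairing w v = 0}"
definition "Y = {w \<in> carrier W. \<forall>v\<in>B. pairing w v = 0}"
abbreviation "clB \<equiv> topo V closure_of B"
abbreviation "clC \<equiv> topo W closure_of C"

lemma BV: "B \<subseteq> carrier V" and CW: "C \<subseteq> carrier W"
  using B C by (auto simp: csubspace_def)

text \<open>Continuity of the pairing; the form is that required by
  \<open>functional_on_closed_subspace\<close>.\<close>

lemma Z_closed:
  assumes "v \<in> carrier V" "\<forall>e>0. \<exists>k\<in>Z. V.nrm (V.sub v k) < e" shows "v \<in> Z"
proof -
  have "pairing w v = 0" if w: "w \<in> C" for w
  proof (rule complex_eq_0_if_le)
    have wW: "w \<in> carrier W" using w CW by auto
    fix e :: real assume "0 < e"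
    then obtain k where k: "k \<in> Z" "V.nrm (V.sub v k) < e" using assms by blast
    have kV: "k \<in> carrier V" "pairing w k = 0" using k w by (auto simp: Z_def)
    have "cmod (pairing w v) = cmod (pairing w (V.sub v k))"
      by (simp add: pairing_right(3)[OF wW assms(1) kV(1)] kV(2))
    also have "\<dots> \<le> W.nrm w * V.nrm (V.sub v k)" by (intro pairing_le wW V.sub_closed assms(1) kV(1))
    also have "\<dots> \<le> W.nrm w * e" using k by (intro mult_left_mono) auto
    finally show "cmod (pairing w v) \<le> W.nrm w * e" .
  qed simp
  then show ?thesis using assms(1) by (simp add: Z_def)
qed

lemma Y_closed:
  assumes "w \<in> carrier W" "\<forall>e>0. \<exists>k\<in>Y. W.nrm (W.sub w k) < e" shows "w \<in> Y"
proof -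
  have "pairing w v = 0" if v: "v \<in> B" for v
  proof (rule complex_eq_0_if_le)
    have vV: "v \<in> carrier V" using v BV by auto
    fix e :: real assume "0 < e"
    then obtain k where k: "k \<in> Y" "W.nrm (W.sub w k) < e" using assms by blast
    have kW: "k \<in> carrier W" "pairing k v = 0" using k v by (auto simp: Y_def)
    have "cmod (pairing w v) = cmod (pairing (W.sub w k) v)"
      by (simp add: pairing_left(3)[OF vV assms(1) kW(1)] kW(2))
    also have "\<dots> \<le> W.nrm (W.sub w k) * V.nrm v" by (intro pairing_le vV W.sub_closed assms(1) kW(1))
    also have "\<dots> \<le> e * V.nrm v" using k by (intro mult_right_mono) auto
    finally show "cmod (pairing w v) \<le> V.nrm v * e" by (simp add: mult.commute)
  qed simp
  then show ?thesis using assms(1) by (simp add: Y_def)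
qed

lemma pairing_zero: "w \<in> carrier W \<Longrightarrow> pairing w \<zero>\<^bsub>V\<^esub> = 0" "v \<in> carrier V \<Longrightarrow> pairing \<zero>\<^bsub>W\<^esub> v = 0"
  by (simp_all add: pairing_def V.J_zero W.J_zero)

lemma csubspace_Z: "csubspace V Z"
  using CW by (auto simp: csubspace_def Z_def V.closeds pairing_right pairing_zero subset_iff)

lemma csubspace_Y: "csubspace W Y"
  using BV by (auto simp: csubspace_def Y_def W.closeds pairing_left pairing_zero subset_iff)

lemma clB_Z: "clB \<subseteq> Z"
proof
  fix v assume "v \<in> clB"
  then have v: "v \<in> carrier V" "\<forall>e>0. \<exists>k\<in>B. V.nrm (V.sub v k) < e"
    using V.closure_of_iff[OF BV] by auto
  have "B \<subseteq> Z" using CB BV by (auto simp: Z_def)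
  with v show "v \<in> Z" by (intro Z_closed) blast+
qed

lemma clC_Y: "clC \<subseteq> Y"
proof
  fix v assume "v \<in> clC"
  then have v: "v \<in> carrier W" "\<forall>e>0. \<exists>k\<in>C. W.nrm (W.sub v k) < e"
    using W.closure_of_iff[OF CW] by auto
  have "C \<subseteq> Y" using CB CW by (auto simp: Y_def)
  with v show "v \<in> Y" by (intro Y_closed) blast+
qed

sublocale V: ell_subquotient V JV q I Z clB
  by unfold_locales (rule csubspace_Z V.csubspace_closure[OF B] clB_Z)+

sublocale W: ell_subquotient W JW p I Y clC
  by unfold_locales (rule csubspace_Y W.csubspace_closure[OF C] clC_Y)+

lemma pairing_clB: "w \<in> Y \<Longrightarrow> v \<in> clB \<Longrightarrow> pairing w v = 0"
proof (rule complex_eq_0_if_le[where C = "W.nrm w"])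
  assume w: "w \<in> Y" and v: "v \<in> clB"
  then have wW: "w \<in> carrier W" by (simp add: Y_def)
  fix e :: real assume "0 < e"
  then obtain k where k: "k \<in> B" "V.nrm (V.sub v k) < e" using v V.closure_of_iff[OF BV] by blast
  have V: "v \<in> carrier V" "k \<in> carrier V" using v k BV V.closure_of_iff[OF BV] by auto
  have "pairing w k = 0" using w k by (simp add: Y_def)
  then have "cmod (pairing w v) = cmod (pairing w (V.sub v k))"
    using pairing_right(3)[OF wW V] by simp
  also have "\<dots> \<le> W.nrm w * V.nrm (V.sub v k)" by (intro pairing_le wW V.sub_closed V)
  also have "\<dots> \<le> W.nrm w * e" using k by (intro mult_left_mono) auto
  finally show "cmod (pairing w v) \<le> W.nrm w * e" .
qed simp

lemma pairing_clC: "w \<in> clC \<Longrightarrow> v \<in> Z \<Longrightarrow> pairing w v = 0"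
proof (rule complex_eq_0_if_le[where C = "V.nrm v"])
  assume w: "w \<in> clC" and v: "v \<in> Z"
  then have vV: "v \<in> carrier V" by (simp add: Z_def)
  fix e :: real assume "0 < e"
  then obtain k where k: "k \<in> C" "W.nrm (W.sub w k) < e" using w W.closure_of_iff[OF CW] by blast
  have W: "w \<in> carrier W" "k \<in> carrier W" using w k CW W.closure_of_iff[OF CW] by auto
  have "pairing k v = 0" using v k by (simp add: Z_def)
  then have "cmod (pairing w v) = cmod (pairing (W.sub w k) v)"
    using pairing_left(3)[OF vV W] by simp
  also have "\<dots> \<le> W.nrm (W.sub w k) * V.nrm v" by (intro pairing_le vV W.sub_closed W)
  also have "\<dots> \<le> e * V.nrm v" using k by (intro mult_right_mono) auto
  finally show "cmod (pairing w v) \<le> V.nrm v * e" by (simp add: mult.commute)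
qed simp

text \<open>Representatives are picked by \<open>SOME\<close>; \<open>duality_coset\<close> shows
  that the choice is immaterial. The restriction to the carrier is demanded by
  \<open>continuous_functionals\<close>.\<close>

definition duality :: "'w set \<Rightarrow> 'v set \<Rightarrow> complex" where
  "duality A = (\<lambda>E\<in>carrier V.Q. pairing (SOME w. w \<in> Y \<and> A = W.coset w) (SOME v. v \<in> Z \<and> E = V.coset v))"

text \<open>Two representatives differ by an element of \<open>clC\<close> or \<open>clB\<close>,
  and by continuity these annihilate \<open>Z\<close> and \<open>Y\<close>, respectively.\<close>

lemma duality_coset:
  assumes w: "w \<in> Y" and v: "v \<in> Z"
  shows "duality (W.coset w) (V.coset v) = pairing w v"
proof -
  define w' where "w' = (SOME w'. w' \<in> Y \<and> W.coset w = W.coset w')"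
  define v' where "v' = (SOME v'. v' \<in> Z \<and> V.coset v = V.coset v')"
  have w': "w' \<in> Y" "W.coset w = W.coset w'"
    using someI[of "\<lambda>w'. w' \<in> Y \<and> W.coset w = W.coset w'" w] w by (auto simp: w'_def)
  have v': "v' \<in> Z" "V.coset v = V.coset v'"
    using someI[of "\<lambda>v'. v' \<in> Z \<and> V.coset v = V.coset v'" v] v by (auto simp: v'_def)
  have c: "w \<in> carrier W" "w' \<in> carrier W" "v \<in> carrier V" "v' \<in> carrier V"
    using w w' v v' by (auto simp: Y_def Z_def)
  have "W.sub w w' \<in> clC" "V.sub v v' \<in> clB"
    using W.coset_eq_iff[OF c(1,2)] V.coset_eq_iff[OF c(3,4)] w' v' by auto
  then have "pairing (W.sub w w') v = 0" "pairing w' (V.sub v v') = 0"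
    using pairing_clC pairing_clB v w' by auto
  then have "pairing w v = pairing w' v'"
    using pairing_left(3)[OF c(3,1,2)] pairing_right(3)[OF c(2,3,4)] by simp
  moreover have "V.coset v \<in> carrier V.Q" using v by (simp add: V.carrier_Q)
  ultimately show ?thesis by (simp add: duality_def w'_def v'_def)
qed

lemma duality_extensional: "duality A \<in> extensional (carrier V.Q)"
  by (simp add: duality_def)

lemma duality_functional: "w \<in> Y \<Longrightarrow> duality (W.coset w) \<in> continuous_functionals V.Q"
proof (rule V.functionalI[OF duality_extensional])
  assume w: "w \<in> Y"
  then have wW: "w \<in> carrier W" by (simp add: Y_def)
  show "duality (W.coset w) (V.coset (u \<oplus>\<^bsub>V\<^esub> v)) = duality (W.coset w) (V.coset u) + duality (W.coset w) (V.coset v)"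
    if "u \<in> Z" "v \<in> Z" for u v
    using that V.K_simps(2) V.KV pairing_right(2)[OF wW] by (simp add: duality_coset w)
  show "duality (W.coset w) (V.coset (c \<odot>\<^bsub>V\<^esub> v)) = c * duality (W.coset w) (V.coset v)"
    if "v \<in> Z" for c v
    using that V.K_simps(3) V.KV pairing_right(1)[OF wW] by (simp add: duality_coset w)
  show "cmod (duality (W.coset w) (V.coset v)) \<le> W.nrm w * V.nrm v" if "v \<in> Z" for v
    using that V.KV pairing_le[OF wW] by (simp add: duality_coset w)
qed simp

text \<open>If \<open>w - w'\<close> lay outside \<open>clC\<close>, some \<open>v\<close> in
  \<open>V\<close> would separate it from \<open>clC\<close>. Such a \<open>v\<close> annihilates
  \<open>C\<close>, so it is a member of \<open>Z\<close> at which the two functionals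
  differ.\<close>

lemma duality_inj:
  assumes w: "w \<in> Y" "w' \<in> Y" and eq: "duality (W.coset w) = duality (W.coset w')"
  shows "W.coset w = W.coset w'"
proof -
  have c: "w \<in> carrier W" "w' \<in> carrier W" using w by (auto simp: Y_def)
  have "W.sub w w' \<in> clC"
  proof (rule ccontr)
    assume "W.sub w w' \<notin> clC"
    then obtain v where v: "v \<in> carrier V" "\<And>z. z \<in> clC \<Longrightarrow> pairing z v = 0" "pairing (W.sub w w') v \<noteq> 0"
      using separating_element[OF W.N W.closure_closed[OF CW] W.sub_closed[OF c]] by blast
    have "v \<in> Z" using v(1,2) W.subset_closure[OF CW] by (auto simp: Z_def)
    then have "pairing w v = pairing w' v" using duality_coset w eq by metis
    then show False using v pairing_left(3)[OF v(1) c] by simp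
  qed
  then show ?thesis by (simp add: W.coset_eq_iff c)
qed

text \<open>The functional is pulled back to \<open>Z\<close> and represented by some
  \<open>w\<close>. It vanishes on the coset of each member of \<open>B\<close>, so \<open>w\<close>
  lies in \<open>Y\<close>. The bound \<open>D * M\<close> is what later yields openness of the
  duality map.\<close>

lemma duality_surj:
  assumes \<psi>: "\<psi> \<in> continuous_functionals V.Q" and le: "\<And>v. v \<in> Z \<Longrightarrow> cmod (\<psi> (V.coset v)) \<le> M * V.nrm v"
    and M: "0 \<le> M"
  obtains w where "w \<in> Y" "W.nrm w \<le> D * M" "\<And>v. v \<in> Z \<Longrightarrow> pairing w v = \<psi> (V.coset v)"
    "duality (W.coset w) = \<psi>"
proof -
  note fp = V.functional_properties[OF \<psi>]
  obtain w where w: "w \<in> carrier W" "W.nrm w \<le> D * M" "\<And>v. v \<in> Z \<Longrightarrow> pairing w v = \<psi> (V.coset v)"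
    using functional_on_closed_subspace[OF csubspace_Z Z_closed fp(2) fp(3) le M] by blast
  have "pairing w v = 0" if v: "v \<in> B" for v
  proof -
    have "v \<in> clB" using v V.subset_closure[OF BV] by auto
    then have vZ: "v \<in> Z" using clB_Z by auto
    have "V.coset v = V.coset \<zero>\<^bsub>V\<^esub>"
      using \<open>v \<in> clB\<close> vZ V.KV V.zero_closed by (simp add: V.coset_eq_iff V.sub_zero)
    \<comment> \<open>Homogeneity with the scalar 0 will show that \<open>\<psi>\<close> vanishes on
      the zero coset.\<close>
    also have "\<dots> = V.coset (0 \<odot>\<^bsub>V\<^esub> v)"
    proof -
      have "\<zero>\<^bsub>V\<^esub> = 0 \<odot>\<^bsub>V\<^esub> v" using V.KV[OF vZ] by (simp add: V.J_eq_iff V.closeds V.J_simps)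
      then show ?thesis by simp
    qed
    finally show ?thesis using fp(3)[OF vZ, of 0] w(3)[OF vZ] by simp
  qed
  then have wY: "w \<in> Y" using w(1) by (simp add: Y_def)
  have "duality (W.coset w) = \<psi>"
  proof (rule extensionalityI[OF duality_extensional fp(1)])
    fix A assume "A \<in> carrier V.Q"
    then show "duality (W.coset w) A = \<psi> A" using w(3) by (auto simp: V.carrier_Q duality_coset wY)
  qed
  with wY w(2,3) show ?thesis by (rule that)
qed

text \<open>One direction is the estimate of the pairing by the norms. The other replaces the open
  mapping theorem: a functional close to \<open>duality (W.coset w)\<close> comes from a coset with
  a representative close to \<open>w\<close>, which the norm-controlled representation
  supplies.\<close>

lemma duality_openin:
  assumes U: "U \<subseteq> carrier W.Q"
  shows "openin (topo W.Q) U \<longleftrightarrow> openin (strong_topology V.Q) (duality ` U)"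
proof
  assume op: "openin (topo W.Q) U"
  show "openin (strong_topology V.Q) (duality ` U)"
    unfolding V.openin_strong_Q
  proof (intro conjI ballI)
    show "duality ` U \<subseteq> continuous_functionals V.Q"
      using U duality_functional by (auto simp: W.carrier_Q)
    fix \<phi> assume "\<phi> \<in> duality ` U"
    then obtain w where w: "w \<in> Y" "W.coset w \<in> U" "\<phi> = duality (W.coset w)"
      using U by (auto simp: W.carrier_Q)
    then obtain e where e: "0 < e" "\<And>x. x \<in> Y \<Longrightarrow> W.nrm (W.sub x w) < e \<Longrightarrow> W.coset x \<in> U"
      using op[unfolded W.openin_Q, THEN conjunct2, rule_format] by blast
    \<comment> \<open>The representative \<open>t\<close> found below has norm at most
      \<open>D * d\<close>, which has to be less than \<open>e\<close>; the summand 1 allows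
      \<open>D = 0\<close>.\<close>
    define d where "d = e / (2 * (D + 1))"
    have d: "0 < d" using e D by (simp add: d_def)
    have De: "D * d < e"
    proof -
      have "D * d \<le> (D + 1) * d" using d by (intro mult_right_mono) auto
      also have "\<dots> = e / 2" using D by (simp add: d_def field_simps)
      also have "\<dots> < e" using e by simp
      finally show ?thesis .
    qed
    have "\<psi> \<in> duality ` U" if \<psi>: "\<psi> \<in> continuous_functionals V.Q"
      "\<forall>v\<in>Z. V.nrm v \<le> 1 \<longrightarrow> cmod (\<psi> (V.coset v) - \<phi> (V.coset v)) < d" for \<psi>
    proof -
      obtain M where M: "0 \<le> M" "\<forall>v\<in>Z. cmod (\<psi> (V.coset v)) \<le> M * V.nrm v"
        using V.functional_properties(4)[OF \<psi>(1)] by blast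
      obtain x where x: "x \<in> Y" "\<And>v. v \<in> Z \<Longrightarrow> pairing x v = \<psi> (V.coset v)" "duality (W.coset x) = \<psi>"
        using duality_surj[OF \<psi>(1) M(2)[rule_format] M(1)] by blast
      have c: "x \<in> carrier W" "w \<in> carrier W" using x w by (auto simp: Y_def)
      \<comment> \<open>\<open>s\<close> represents the difference of the two functionals, but its
        own norm is not under control.\<close>
      define s where "s = W.sub x w"
      have s: "s \<in> Y" using x w W.K_simps(4) by (simp add: s_def)
      have eqs: "pairing s v = \<psi> (V.coset v) - \<phi> (V.coset v)" if "v \<in> Z" for v
        using that V.KV pairing_left(3)[OF _ c] x w by (simp add: s_def duality_coset)
      have "cmod (duality (W.coset s) (V.coset v)) \<le> d * V.nrm v" if v: "v \<in> Z" for v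
      proof (cases "V.nrm v = 0")
        case True
        have "cmod (pairing s v) \<le> W.nrm s * V.nrm v"
          using s v V.KV by (intro pairing_le) (auto simp: Y_def)
        then show ?thesis using True by (simp add: duality_coset s v)
      next
        case False
        then have pos: "0 < V.nrm v" by (simp add: less_le)
        define u where "u = of_real (1 / V.nrm v) \<odot>\<^bsub>V\<^esub> v"
        have u: "u \<in> Z" "V.nrm u = 1" using v V.KV V.K_simps(3) pos
          by (simp_all add: u_def V.nrm_smult norm_divide)
        have "cmod (pairing s u) < d" using \<psi>(2) u by (simp add: eqs)
        moreover have "pairing s u = of_real (1 / V.nrm v) * pairing s v"
          unfolding u_def using s v V.KV by (intro pairing_right(1)) (auto simp: Y_def)
        ultimately show ?thesis using pos by (simp add: norm_mult norm_divide duality_coset s v field_simps)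
      qed
      note bound = this
      \<comment> \<open>Representing the same functional afresh gives \<open>t\<close> of controlled
        norm. It differs from \<open>s\<close> by an element of \<open>clC\<close>, so
        \<open>w + t\<close> and \<open>x\<close> have the same coset.\<close>
      obtain t where t: "t \<in> Y" "W.nrm t \<le> D * d" "duality (W.coset t) = duality (W.coset s)"
        using duality_surj[OF duality_functional[OF s] bound less_imp_le[OF d]] by blast
      have tc: "t \<in> carrier W" "s \<in> carrier W" using t s by (auto simp: Y_def)
      have "W.sub (w \<oplus>\<^bsub>W\<^esub> t) w = t" using tc c by (simp add: W.J_eq_iff W.closeds W.J_simps)
      then have "W.coset (w \<oplus>\<^bsub>W\<^esub> t) \<in> U"
        using t De w W.K_simps(2) by (intro e(2)) auto
      moreover have "W.coset (w \<oplus>\<^bsub>W\<^esub> t) = W.coset x"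
      proof -
        have "W.sub t s \<in> clC" using duality_inj[OF t(1) s t(3)] tc by (simp add: W.coset_eq_iff)
        moreover have "W.sub (w \<oplus>\<^bsub>W\<^esub> t) x = W.sub t s"
          using tc c by (simp add: s_def W.J_eq_iff W.closeds W.J_simps) (simp add: fun_eq_iff)
        ultimately have "W.sub (w \<oplus>\<^bsub>W\<^esub> t) x \<in> clC" by simp
        then show ?thesis using W.coset_eq_iff[OF W.add_closed[OF c(2) tc(1)] c(1)] by simp
      qed
      ultimately show ?thesis using x(3) by auto
    qed
    then show "\<exists>e>0. \<forall>\<psi>\<in>continuous_functionals V.Q.
        (\<forall>v\<in>Z. V.nrm v \<le> 1 \<longrightarrow> cmod (\<psi> (V.coset v) - \<phi> (V.coset v)) < e) \<longrightarrow> \<psi> \<in> duality ` U"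
      using d by (intro exI[of _ d]) auto
  qed
next
  assume op: "openin (strong_topology V.Q) (duality ` U)"
  show "openin (topo W.Q) U"
    unfolding W.openin_Q
  proof (intro conjI U ballI impI)
    fix w assume w: "w \<in> Y" "W.coset w \<in> U"
    then have "duality (W.coset w) \<in> duality ` U" by blast
    with op[unfolded V.openin_strong_Q, THEN conjunct2, rule_format] obtain e where e: "0 < e"
      "\<forall>\<psi>\<in>continuous_functionals V.Q.
        (\<forall>v\<in>Z. V.nrm v \<le> 1 \<longrightarrow> cmod (\<psi> (V.coset v) - duality (W.coset w) (V.coset v)) < e) \<longrightarrow> \<psi> \<in> duality ` U"
      by blast
    have "W.coset x \<in> U" if x: "x \<in> Y" "W.nrm (W.sub x w) < e" for x
    proof -
      have c: "x \<in> carrier W" "w \<in> carrier W" using x w by (auto simp: Y_def)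
      have "duality (W.coset x) \<in> duality ` U"
      proof (rule e(2)[rule_format, OF duality_functional[OF x(1)]])
        fix v assume v: "v \<in> Z" "V.nrm v \<le> 1"
        have "cmod (pairing (W.sub x w) v) \<le> W.nrm (W.sub x w) * V.nrm v"
          using v c V.KV by (intro pairing_le W.sub_closed) auto
        also have "\<dots> \<le> W.nrm (W.sub x w) * 1" using v by (intro mult_left_mono) auto
        also have "\<dots> < e" using x by simp
        finally show "cmod (duality (W.coset x) (V.coset v) - duality (W.coset w) (V.coset v)) < e"
          using pairing_left(3)[OF _ c] v V.KV x w by (simp add: duality_coset)
      qed
      then obtain A where A: "A \<in> U" "duality (W.coset x) = duality A" by blast
      then obtain a where a: "a \<in> Y" "A = W.coset a" using U by (auto simp: W.carrier_Q)
      then have "W.coset x = A" using duality_inj[OF x(1) a(1)] A(2) by simp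
      then show ?thesis using A(1) by simp
    qed
    then show "\<exists>e>0. \<forall>x\<in>Y. W.nrm (W.sub x w) < e \<longrightarrow> W.coset x \<in> U" using e(1) by blast
  qed
qed

theorem duality_isomorphism: "ctvs_isomorphic W.Q (dual_ctvs V.Q)"
proof -
  have ts: "topspace (strong_topology V.Q) = continuous_functionals V.Q"
  proof
    show "topspace (strong_topology V.Q) \<subseteq> continuous_functionals V.Q"
      using openin_topspace[of "strong_topology V.Q"] unfolding openin_strong_topology by (rule conjunct1)
    have "openin (strong_topology V.Q) (continuous_functionals V.Q)"
      unfolding V.openin_strong_Q by (auto intro: exI[of _ 1])
    then show "continuous_functionals V.Q \<subseteq> topspace (strong_topology V.Q)" by (rule openin_subset)
  qed
  have inj: "inj_on duality (carrier W.Q)"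
  proof (rule inj_onI)
    fix A E assume "A \<in> carrier W.Q" "E \<in> carrier W.Q" "duality A = duality E"
    moreover from this obtain a b where ab: "a \<in> Y" "A = W.coset a" "b \<in> Y" "E = W.coset b"
      unfolding W.carrier_Q by blast
    ultimately show "A = E" using duality_inj[OF ab(1,3)] unfolding ab(2,4) by blast
  qed
  have im: "duality ` carrier W.Q = continuous_functionals V.Q"
  proof
    show "duality ` carrier W.Q \<subseteq> continuous_functionals V.Q"
      using duality_functional by (auto simp: W.carrier_Q)
    show "continuous_functionals V.Q \<subseteq> duality ` carrier W.Q"
    proof
      fix \<psi> assume \<psi>: "\<psi> \<in> continuous_functionals V.Q"
      obtain M where M: "0 \<le> M" "\<forall>v\<in>Z. cmod (\<psi> (V.coset v)) \<le> M * V.nrm v"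
        using V.functional_properties(4)[OF \<psi>] by blast
      obtain x where "x \<in> Y" "duality (W.coset x) = \<psi>"
        using duality_surj[OF \<psi> M(2)[rule_format] M(1)] by blast
      then show "\<psi> \<in> duality ` carrier W.Q" by (auto simp: W.carrier_Q)
    qed
  qed
  have lin: "duality \<in> module_maps UNIV W.Q (dual_ctvs V.Q)"
    unfolding module_maps_def
  proof (intro CollectI conjI ballI)
    show "duality \<in> carrier W.Q \<rightarrow> carrier (dual_ctvs V.Q)" using im by (auto simp: dual_ctvs_def)
    fix A assume A: "A \<in> carrier W.Q"
    then obtain a where a: "a \<in> Y" "A = W.coset a" by (auto simp: W.carrier_Q)
    show "duality (A \<oplus>\<^bsub>W.Q\<^esub> E) = duality A \<oplus>\<^bsub>dual_ctvs V.Q\<^esub> duality E" if E: "E \<in> carrier W.Q" for E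
    proof -
      obtain b where b: "b \<in> Y" "E = W.coset b" using E by (auto simp: W.carrier_Q)
      show ?thesis
      proof (rule extensionalityI[OF duality_extensional])
        show "duality A \<oplus>\<^bsub>dual_ctvs V.Q\<^esub> duality E \<in> extensional (carrier V.Q)" by (simp add: dual_ctvs_def)
        fix F assume "F \<in> carrier V.Q"
        then obtain v where v: "v \<in> Z" "F = V.coset v" by (auto simp: V.carrier_Q)
        show "duality (A \<oplus>\<^bsub>W.Q\<^esub> E) F = (duality A \<oplus>\<^bsub>dual_ctvs V.Q\<^esub> duality E) F"
          using a b v V.KV W.KV W.K_simps(2) \<open>F \<in> carrier V.Q\<close>
          by (simp add: dual_ctvs_def W.add_Q duality_coset pairing_left(2))
      qed
    qed
    show "duality (c \<odot>\<^bsub>W.Q\<^esub> A) = c \<odot>\<^bsub>dual_ctvs V.Q\<^esub> duality A" for c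
    proof (rule extensionalityI[OF duality_extensional])
      show "c \<odot>\<^bsub>dual_ctvs V.Q\<^esub> duality A \<in> extensional (carrier V.Q)" by (simp add: dual_ctvs_def)
      fix F assume "F \<in> carrier V.Q"
      then obtain v where v: "v \<in> Z" "F = V.coset v" by (auto simp: V.carrier_Q)
      show "duality (c \<odot>\<^bsub>W.Q\<^esub> A) F = (c \<odot>\<^bsub>dual_ctvs V.Q\<^esub> duality A) F"
        using a v V.KV W.KV W.K_simps(3) \<open>F \<in> carrier V.Q\<close>
        by (simp add: dual_ctvs_def W.smult_Q duality_coset pairing_left(1))
    qed
  qed
  have "homeomorphic_map (topo W.Q) (strong_topology V.Q) duality"
  proof (rule bijective_open_imp_homeomorphic_map)
    show "continuous_map (topo W.Q) (strong_topology V.Q) duality"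
      unfolding continuous_map W.topspace_Q ts
    proof (intro conjI allI impI)
      show "duality ` carrier W.Q \<subseteq> continuous_functionals V.Q" using im by simp
      fix T assume T: "openin (strong_topology V.Q) T"
      then have "T \<subseteq> duality ` carrier W.Q" using im openin_subset ts by blast
      then have "duality ` {x \<in> carrier W.Q. duality x \<in> T} = T" by auto
      then show "openin (topo W.Q) {x \<in> carrier W.Q. duality x \<in> T}"
        using duality_openin[of "{x \<in> carrier W.Q. duality x \<in> T}"] T by simp
    qed
    show "open_map (topo W.Q) (strong_topology V.Q) duality"
      unfolding open_map_def
    proof (intro allI impI)
      fix U assume U: "openin (topo W.Q) U"
      then have "U \<subseteq> carrier W.Q" using openin_subset W.topspace_Q by blast
      with U show "openin (strong_topology V.Q) (duality ` U)" by (simp add: duality_openin)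
    qed
    show "duality ` topspace (topo W.Q) = topspace (strong_topology V.Q)" by (simp add: W.topspace_Q ts im)
    show "inj_on duality (topspace (topo W.Q))" by (simp add: W.topspace_Q inj)
  qed
  then show ?thesis
    unfolding ctvs_isomorphic_def using lin inj im
    by (intro exI[of _ duality]) (simp add: dual_ctvs_def bij_betw_def)
qed

end

section \<open>The action of the group ring on \<open>\<ell>\<^sup>r(G)\<close>\<close>

text \<open>A common form for the action of the group ring, the coordinates of tensors and the
  pairing with tensors: each is an additive extension to formal sums with complex values.\<close>

definition frag_eval :: "('x \<Rightarrow>\<^sub>0 int) \<Rightarrow> ('x \<Rightarrow> complex) \<Rightarrow> complex" where
  "frag_eval a F = (\<Sum>x\<in>Poly_Mapping.keys a. of_int (Poly_Mapping.lookup a x) * F x)"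

lemma frag_eval_superset:
  assumes "finite X" "Poly_Mapping.keys a \<subseteq> X"
  shows "frag_eval a F = (\<Sum>x\<in>X. of_int (Poly_Mapping.lookup a x) * F x)"
  unfolding frag_eval_def using assms by (intro sum.mono_neutral_left) (auto simp: in_keys_iff)

lemma frag_eval_0 [simp]: "frag_eval 0 F = 0"
  by (simp add: frag_eval_def)

lemma frag_eval_of [simp]: "frag_eval (frag_of x) F = F x"
  by (simp add: frag_eval_def)

lemma frag_eval_diff: "frag_eval (a - b) F = frag_eval a F - frag_eval b F"
proof -
  let ?X = "Poly_Mapping.keys a \<union> Poly_Mapping.keys b"
  show ?thesis
    using keys_diff[of a b]
    by (simp add: frag_eval_superset[of ?X] lookup_minus left_diff_distrib sum_subtractf)
qed

lemma frag_eval_add: "frag_eval (a + b) F = frag_eval a F + frag_eval b F"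
  using frag_eval_diff[of a "0 - b" F] frag_eval_diff[of 0 b F] by simp

lemma frag_eval_sum: "frag_eval (\<Sum>s\<in>S. a s) F = (\<Sum>s\<in>S. frag_eval (a s) F)"
  by (induction S rule: infinite_finite_induct) (simp_all add: frag_eval_add)

lemma frag_eval_cong: "(\<And>x. x \<in> Poly_Mapping.keys a \<Longrightarrow> F x = F' x) \<Longrightarrow> frag_eval a F = frag_eval a F'"
  by (simp add: frag_eval_def)

lemma frag_eval_zero_fun [simp]: "frag_eval a (\<lambda>x. 0) = 0"
  by (simp add: frag_eval_def)

lemma frag_eval_fun_add: "frag_eval a (\<lambda>x. F x + F' x) = frag_eval a F + frag_eval a F'"
  by (simp add: frag_eval_def distrib_left sum.distrib)

lemma frag_eval_fun_scale: "frag_eval a (\<lambda>x. c * F x) = c * frag_eval a F"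
  by (simp add: frag_eval_def sum_distrib_left mult.left_commute)

lemma frag_eval_swap: "frag_eval a (\<lambda>x. frag_eval b (\<lambda>y. F x y)) = frag_eval b (\<lambda>y. frag_eval a (\<lambda>x. F x y))"
  unfolding frag_eval_def sum_distrib_left
  by (subst sum.swap) (simp add: mult.left_commute)

lemma frag_eval_extend: "frag_eval (frag_extend k a) F = frag_eval a (\<lambda>x. frag_eval (k x) F)"
proof -
  have "Poly_Mapping.keys a \<subseteq> UNIV" by simp
  then show ?thesis
    by (induction a rule: frag_induction) (simp_all add: frag_extend_diff frag_eval_diff)
qed

text \<open>The scalar multiplication of \<open>lr_module G r\<close>. It is the same for every
  \<open>r\<close>, so that one set of rules serves \<open>p\<close> and \<open>q\<close>.\<close>

definition gact :: "('g, 'm) monoid_scheme \<Rightarrow> ('g \<Rightarrow>\<^sub>0 int) \<Rightarrow> ('g \<Rightarrow> complex) \<Rightarrow> 'g \<Rightarrow> complex" where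
  "gact G a f = (\<lambda>g. if g \<in> carrier G then frag_eval a (\<lambda>h. f (inv\<^bsub>G\<^esub> h \<otimes>\<^bsub>G\<^esub> g)) else 0)"

lemma carrier_group_ring: "a \<in> carrier (group_ring G) \<longleftrightarrow> Poly_Mapping.keys a \<subseteq> carrier G"
  by (simp add: group_ring_def)

lemma group_ring_simps [simp]:
  "a \<oplus>\<^bsub>group_ring G\<^esub> b = a + b" "\<zero>\<^bsub>group_ring G\<^esub> = 0"
  by (simp_all add: group_ring_def)

lemma lr_space_eq_ell: "lr_space G r = ell r (carrier G)"
  by (simp add: lr_space_def ell_def)

lemma lr_norm_eq_ell: "lr_norm G r = ell_norm r (carrier G)"
  by (simp add: fun_eq_iff lr_norm_def ell_norm_def)

lemma lr_module_simps [simp]: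
  "carrier (lr_module G r) = ell r (carrier G)"
  "\<zero>\<^bsub>lr_module G r\<^esub> = (\<lambda>g. 0)"
  "f \<oplus>\<^bsub>lr_module G r\<^esub> f' = (\<lambda>g. f g + f' g)"
  "a \<odot>\<^bsub>lr_module G r\<^esub> f = gact G a f"
  by (simp_all add: lr_module_def lr_space_eq_ell gact_def frag_eval_def cong: if_cong)

lemma gact_add_left: "gact G (a + b) f = (\<lambda>g. gact G a f g + gact G b f g)"
  by (simp add: gact_def fun_eq_iff frag_eval_add)

lemma gact_add_right: "gact G a (\<lambda>g. f g + f' g) = (\<lambda>g. gact G a f g + gact G a f' g)"
  by (simp add: gact_def fun_eq_iff frag_eval_fun_add)

lemma gact_scale: "gact G a (\<lambda>g. c * f g) = (\<lambda>g. c * gact G a f g)"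
  by (simp add: gact_def fun_eq_iff frag_eval_fun_scale)

lemma gact_diff_right: "gact G a (\<lambda>g. f g - f' g) = (\<lambda>g. gact G a f g - gact G a f' g)"
  using gact_add_right[of G a f "\<lambda>g. (- 1) * f' g"] by (simp only: gact_scale) simp

lemma gact_zero_right [simp]: "gact G a (\<lambda>g. 0) = (\<lambda>g. 0)"
  by (simp add: gact_def cong: if_cong)

lemma gact_sum_right:
  "gact G a (\<lambda>g. \<Sum>s\<in>S. f s g) = (\<lambda>g. \<Sum>s\<in>S. gact G a (f s) g)"
  by (induction S rule: infinite_finite_induct) (simp_all add: gact_add_right)

context group
begin

lemma translate_bij: "h \<in> carrier G \<Longrightarrow> bij_betw (\<lambda>g. inv h \<otimes> g) (carrier G) (carrier G)"
  by (rule bij_betw_byWitness[where f' = "\<lambda>g. h \<otimes> g"]) (auto simp: m_assoc[symmetric])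

lemma translate_ell:
  assumes h: "h \<in> carrier G" and f: "f \<in> ell r (carrier G)"
  shows "(\<lambda>g. if g \<in> carrier G then f (inv h \<otimes> g) else 0) \<in> ell r (carrier G)"
    and "ell_norm r (carrier G) (\<lambda>g. if g \<in> carrier G then f (inv h \<otimes> g) else 0) = ell_norm r (carrier G) f"
proof -
  let ?t = "\<lambda>g. if g \<in> carrier G then f (inv h \<otimes> g) else 0"
  have "(\<lambda>g. cmod (?t g) powr r) summable_on carrier G \<longleftrightarrow>
      (\<lambda>g. cmod (f (inv h \<otimes> g)) powr r) summable_on carrier G"
    by (intro summable_on_cong) auto
  also have "\<dots> \<longleftrightarrow> (\<lambda>g. cmod (f g) powr r) summable_on carrier G"
    by (rule summable_on_reindex_bij_betw[OF translate_bij[OF h]])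
  finally show "?t \<in> ell r (carrier G)" using f by (auto simp: ell_def)
  have "(\<Sum>\<^sub>\<infinity>g\<in>carrier G. cmod (?t g) powr r) = (\<Sum>\<^sub>\<infinity>g\<in>carrier G. cmod (f (inv h \<otimes> g)) powr r)"
    by (intro infsum_cong) auto
  also have "\<dots> = (\<Sum>\<^sub>\<infinity>g\<in>carrier G. cmod (f g) powr r)"
    by (rule infsum_reindex_bij_betw[OF translate_bij[OF h]])
  finally show "ell_norm r (carrier G) ?t = ell_norm r (carrier G) f" by (simp add: ell_norm_def)
qed

text \<open>Bounds the operator norm of \<open>gact G a\<close>, because translations are
  isometries.\<close>

definition gact_bound :: "('a \<Rightarrow>\<^sub>0 int) \<Rightarrow> real" where
  "gact_bound a = (\<Sum>h\<in>Poly_Mapping.keys a. \<bar>of_int (Poly_Mapping.lookup a h)\<bar>)"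

lemma gact_bound_nonneg [simp]: "0 \<le> gact_bound a"
  by (simp add: gact_bound_def sum_nonneg)

lemma gact_ell:
  assumes a: "a \<in> carrier (group_ring G)" and f: "f \<in> ell r (carrier G)" and r: "1 < r"
  shows "gact G a f \<in> ell r (carrier G)"
    and "ell_norm r (carrier G) (gact G a f) \<le> gact_bound a * ell_norm r (carrier G) f"
proof -
  define t where "t = (\<lambda>h g. if g \<in> carrier G then f (inv h \<otimes> g) else 0)"
  have eq: "gact G a f = (\<lambda>g. \<Sum>h\<in>Poly_Mapping.keys a. of_int (Poly_Mapping.lookup a h) * t h g)"
    by (auto simp: gact_def frag_eval_def t_def fun_eq_iff)
  have t: "t h \<in> ell r (carrier G)" "ell_norm r (carrier G) (t h) = ell_norm r (carrier G) f"
    if "h \<in> Poly_Mapping.keys a" for h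
  proof -
    have "h \<in> carrier G" using that a by (auto simp: carrier_group_ring)
    from translate_ell[OF this f] show "t h \<in> ell r (carrier G)"
      "ell_norm r (carrier G) (t h) = ell_norm r (carrier G) f" by (simp_all add: t_def)
  qed
  show "gact G a f \<in> ell r (carrier G)"
    unfolding eq using t r by (intro ell_sum ell_scale) auto
  have "ell_norm r (carrier G) (gact G a f)
      \<le> (\<Sum>h\<in>Poly_Mapping.keys a. ell_norm r (carrier G) (\<lambda>g. of_int (Poly_Mapping.lookup a h) * t h g))"
    unfolding eq using t r by (intro ell_sum ell_scale) auto
  also have "\<dots> = gact_bound a * ell_norm r (carrier G) f"
    unfolding gact_bound_def sum_distrib_right using r t by (intro sum.cong refl) (simp add: ell_norm_scale)
  finally show "ell_norm r (carrier G) (gact G a f) \<le> gact_bound a * ell_norm r (carrier G) f" .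
qed

lemma conj_closed: "a \<in> carrier (group_ring G) \<Longrightarrow> group_ring_conj G a \<in> carrier (group_ring G)"
  unfolding carrier_group_ring group_ring_conj_def
  using keys_frag_extend[of "\<lambda>g. frag_of (inv g)" a] by (fastforce simp: subset_iff)

lemma conj_conj: "a \<in> carrier (group_ring G) \<Longrightarrow> group_ring_conj G (group_ring_conj G a) = a"
proof -
  assume "a \<in> carrier (group_ring G)"
  then have "Poly_Mapping.keys a \<subseteq> carrier G" by (simp add: carrier_group_ring)
  then show ?thesis
    by (induction a rule: frag_induction) (simp_all add: group_ring_conj_def frag_extend_diff)
qed

lemma frag_eval_conj: "frag_eval (group_ring_conj G a) F = frag_eval a (\<lambda>g. F (inv g))"
  by (simp add: group_ring_conj_def frag_eval_extend)

lemma gact_conj: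
  assumes "a \<in> carrier (group_ring G)" "g \<in> carrier G"
  shows "gact G (group_ring_conj G a) f g = frag_eval a (\<lambda>h. f (h \<otimes> g))"
  using assms by (auto simp: gact_def frag_eval_conj carrier_group_ring subset_iff intro!: frag_eval_cong)

lemma gact_mult:
  assumes a: "a \<in> carrier (group_ring G)" and b: "b \<in> carrier (group_ring G)"
  shows "gact G (a \<otimes>\<^bsub>group_ring G\<^esub> b) f = gact G a (gact G b f)"
proof
  fix g
  have "frag_eval a (\<lambda>x. frag_eval b (\<lambda>y. f (inv (x \<otimes> y) \<otimes> g)))
      = frag_eval a (\<lambda>x. gact G b f (inv x \<otimes> g))" if g: "g \<in> carrier G"
    using a b g
    by (intro frag_eval_cong) (auto simp: gact_def carrier_group_ring subset_iff inv_mult_group m_assoc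
        intro!: frag_eval_cong)
  then show "gact G (a \<otimes>\<^bsub>group_ring G\<^esub> b) f g = gact G a (gact G b f) g"
    by (simp add: gact_def[of G _ f] gact_def[of G a] group_ring_def frag_eval_extend)
qed

text \<open>\<open>group_ring_conj\<close> reverses products. Stated for the actions, this amounts
  to interchanging two finite sums.\<close>

lemma gact_conj_mult:
  assumes a: "a \<in> carrier (group_ring G)" and b: "b \<in> carrier (group_ring G)"
    and ab: "a \<otimes>\<^bsub>group_ring G\<^esub> b \<in> carrier (group_ring G)"
  shows "gact G (group_ring_conj G (a \<otimes>\<^bsub>group_ring G\<^esub> b)) f
    = gact G (group_ring_conj G b) (gact G (group_ring_conj G a) f)"
proof
  fix g
  show "gact G (group_ring_conj G (a \<otimes>\<^bsub>group_ring G\<^esub> b)) f g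
    = gact G (group_ring_conj G b) (gact G (group_ring_conj G a) f) g"
  proof (cases "g \<in> carrier G")
    case g: True
    have "gact G (group_ring_conj G (a \<otimes>\<^bsub>group_ring G\<^esub> b)) f g
        = frag_eval a (\<lambda>x. frag_eval b (\<lambda>y. f ((x \<otimes> y) \<otimes> g)))"
      unfolding gact_conj[OF ab g] by (simp add: group_ring_def frag_eval_extend)
    also have "\<dots> = frag_eval b (\<lambda>y. frag_eval a (\<lambda>x. f ((x \<otimes> y) \<otimes> g)))"
      by (rule frag_eval_swap)
    also have "\<dots> = frag_eval b (\<lambda>y. gact G (group_ring_conj G a) f (y \<otimes> g))"
    proof (rule frag_eval_cong)
      fix y assume "y \<in> Poly_Mapping.keys b"
      then have y: "y \<in> carrier G" using b by (auto simp: carrier_group_ring)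
      show "frag_eval a (\<lambda>x. f ((x \<otimes> y) \<otimes> g)) = gact G (group_ring_conj G a) f (y \<otimes> g)"
        unfolding gact_conj[OF a m_closed[OF y g]] using a y g
        by (intro frag_eval_cong) (auto simp: carrier_group_ring subset_iff m_assoc)
    qed
    also have "\<dots> = gact G (group_ring_conj G b) (gact G (group_ring_conj G a) f) g"
      by (rule gact_conj[OF b g, symmetric])
    finally show ?thesis .
  qed (simp add: gact_def)
qed

text \<open>Translations by \<open>h\<close> and by its inverse are adjoint. With the convention
  that makes left modules right modules, this is what lets the pairing of homomorphisms and tensors
  respect the balancing relation.\<close>

lemma pair_gact:
  assumes pq: "conjugate_exponents p q" and a: "a \<in> carrier (group_ring G)"
    and \<phi>: "\<phi> \<in> ell p (carrier G)" and f: "f \<in> ell q (carrier G)"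
  shows "ell_pair (carrier G) (gact G a \<phi>) f = ell_pair (carrier G) \<phi> (gact G (group_ring_conj G a) f)"
proof -
  interpret conjugate_exponents p q by (rule pq)
  interpret S: conjugate_exponents q p by (rule swap)
  define t where "t = (\<lambda>h g. if g \<in> carrier G then \<phi> (inv h \<otimes> g) else 0)"
  define u where "u = (\<lambda>h g. if g \<in> carrier G then f (h \<otimes> g) else 0)"
  have hG: "h \<in> carrier G" if "h \<in> Poly_Mapping.keys a" for h
    using that a by (auto simp: carrier_group_ring)
  have eq1: "gact G a \<phi> = (\<lambda>g. \<Sum>h\<in>Poly_Mapping.keys a. of_int (Poly_Mapping.lookup a h) * t h g)"
    by (auto simp: gact_def frag_eval_def t_def fun_eq_iff)
  have eq2: "gact G (group_ring_conj G a) f = (\<lambda>g. \<Sum>h\<in>Poly_Mapping.keys a. of_int (Poly_Mapping.lookup a h) * u h g)"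
  proof
    fix g show "gact G (group_ring_conj G a) f g = (\<Sum>h\<in>Poly_Mapping.keys a. of_int (Poly_Mapping.lookup a h) * u h g)"
      by (cases "g \<in> carrier G") (simp_all add: gact_conj[OF a] frag_eval_def u_def, simp add: gact_def)
  qed
  have t: "t h \<in> ell p (carrier G)" if "h \<in> Poly_Mapping.keys a" for h
    unfolding t_def using translate_ell(1)[OF hG[OF that] \<phi>] .
  have u: "u h \<in> ell q (carrier G)" if "h \<in> Poly_Mapping.keys a" for h
    using translate_ell(1)[OF inv_closed[OF hG[OF that]] f] hG[OF that]
    by (simp add: u_def cong: if_cong)
  have tu: "ell_pair (carrier G) f (t h) = ell_pair (carrier G) \<phi> (u h)" if "h \<in> Poly_Mapping.keys a" for h
  proof -
    have h: "h \<in> carrier G" using hG[OF that] .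
    \<comment> \<open>The substitution \<open>g \<mapsto> inv h \<otimes> g\<close> moves the
      translation from \<open>f\<close> to \<open>\<phi>\<close>.\<close>
    have "ell_pair (carrier G) \<phi> (u h) = (\<Sum>\<^sub>\<infinity>g\<in>carrier G. \<phi> (inv h \<otimes> g) * u h (inv h \<otimes> g))"
      unfolding ell_pair_def by (rule infsum_reindex_bij_betw[OF translate_bij[OF h], symmetric])
    also have "\<dots> = ell_pair (carrier G) f (t h)"
      unfolding ell_pair_def using h
      by (intro infsum_cong) (simp add: t_def u_def m_assoc[symmetric] mult.commute)
    finally show ?thesis by simp
  qed
  have "ell_pair (carrier G) (gact G a \<phi>) f = ell_pair (carrier G) f (gact G a \<phi>)" by (rule ell_pair_commute)
  also have "\<dots> = (\<Sum>h\<in>Poly_Mapping.keys a. of_int (Poly_Mapping.lookup a h) * ell_pair (carrier G) f (t h))"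
    unfolding eq1 using t f by (subst S.pair_sum_right) (auto intro: ell_scale simp: S.pair_scale_right)
  also have "\<dots> = (\<Sum>h\<in>Poly_Mapping.keys a. of_int (Poly_Mapping.lookup a h) * ell_pair (carrier G) \<phi> (u h))"
    by (simp add: tu)
  also have "\<dots> = ell_pair (carrier G) \<phi> (gact G (group_ring_conj G a) f)"
    unfolding eq2 using u \<phi> by (subst pair_sum_right) (auto intro: ell_scale simp: pair_scale_right)
  finally show ?thesis .
qed

end

section \<open>Finite dual bases\<close>

text \<open>A separate notion, since \<open>module_maps\<close> expects a module record as its
  target and \<open>R\<close> is a ring record.\<close>

definition linear_functionals ::
  "('r, 'q) ring_scheme \<Rightarrow> ('r, 'a, 'x) module_scheme \<Rightarrow> ('a \<Rightarrow> 'r) set" where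
  "linear_functionals R M = {f \<in> carrier M \<rightarrow> carrier R.
     (\<forall>x\<in>carrier M. \<forall>y\<in>carrier M. f (x \<oplus>\<^bsub>M\<^esub> y) = f x \<oplus>\<^bsub>R\<^esub> f y) \<and>
     (\<forall>a\<in>carrier R. \<forall>x\<in>carrier M. f (a \<odot>\<^bsub>M\<^esub> x) = a \<otimes>\<^bsub>R\<^esub> f x)}"

context left_module
begin

lemma double_eq_self: "x \<in> carrier M \<Longrightarrow> x = x \<oplus>\<^bsub>M\<^esub> x \<Longrightarrow> x = \<zero>\<^bsub>M\<^esub>"
  using M.add.l_cancel_one[of x x] by simp

lemma smult_zero_left: "x \<in> carrier M \<Longrightarrow> \<zero>\<^bsub>R\<^esub> \<odot>\<^bsub>M\<^esub> x = \<zero>\<^bsub>M\<^esub>"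
  using smult_l_distr[of "\<zero>\<^bsub>R\<^esub>" "\<zero>\<^bsub>R\<^esub>" x] smult_closed[of "\<zero>\<^bsub>R\<^esub>" x]
  by (intro double_eq_self) simp_all

lemma functional_add:
  assumes "f \<in> linear_functionals R M" "g \<in> linear_functionals R M"
  shows "(\<lambda>m. f m \<oplus>\<^bsub>R\<^esub> g m) \<in> linear_functionals R M"
  using assms unfolding linear_functionals_def
  by (auto simp: Pi_iff R.a_ac R.r_distr)

lemma functional_closed: "f \<in> linear_functionals R M \<Longrightarrow> m \<in> carrier M \<Longrightarrow> f m \<in> carrier R"
  by (auto simp: linear_functionals_def)

text \<open>Values \<open>e x\<close> may coincide for different \<open>x\<close>; their functionals
  are added. The result is indexed by elements of \<open>M\<close>, which fits the topology of
  \<open>lr_tensor\<close>, defined through finite subsets of \<open>M\<close>.\<close>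

lemma regroup_combination:
  assumes "finite X" "e \<in> X \<rightarrow> carrier M" "\<And>x. x \<in> X \<Longrightarrow> \<sigma> x \<in> linear_functionals R M"
  shows "\<exists>S c. finite S \<and> S \<subseteq> carrier M \<and> (\<forall>s\<in>S. c s \<in> linear_functionals R M) \<and>
    (\<forall>m\<in>carrier M. (\<Oplus>\<^bsub>M\<^esub>x\<in>X. \<sigma> x m \<odot>\<^bsub>M\<^esub> e x) = (\<Oplus>\<^bsub>M\<^esub>s\<in>S. c s m \<odot>\<^bsub>M\<^esub> s))"
  using assms
proof (induction X rule: finite_induct)
  case empty
  then show ?case by (intro exI[of _ "{}"]) auto
next
  case (insert x X)
  have "\<exists>S c. finite S \<and> S \<subseteq> carrier M \<and> (\<forall>s\<in>S. c s \<in> linear_functionals R M) \<and>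
    (\<forall>m\<in>carrier M. (\<Oplus>\<^bsub>M\<^esub>x\<in>X. \<sigma> x m \<odot>\<^bsub>M\<^esub> e x) = (\<Oplus>\<^bsub>M\<^esub>s\<in>S. c s m \<odot>\<^bsub>M\<^esub> s))"
    using insert.prems by (intro insert.IH) auto
  then obtain S c where Sc: "finite S \<and> S \<subseteq> carrier M \<and> (\<forall>s\<in>S. c s \<in> linear_functionals R M) \<and>
    (\<forall>m\<in>carrier M. (\<Oplus>\<^bsub>M\<^esub>x\<in>X. \<sigma> x m \<odot>\<^bsub>M\<^esub> e x) = (\<Oplus>\<^bsub>M\<^esub>s\<in>S. c s m \<odot>\<^bsub>M\<^esub> s))"
    by blast
  then have S: "finite S" "S \<subseteq> carrier M" and c: "\<And>s. s \<in> S \<Longrightarrow> c s \<in> linear_functionals R M"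
    and eq: "\<And>m. m \<in> carrier M \<Longrightarrow> (\<Oplus>\<^bsub>M\<^esub>x\<in>X. \<sigma> x m \<odot>\<^bsub>M\<^esub> e x) = (\<Oplus>\<^bsub>M\<^esub>s\<in>S. c s m \<odot>\<^bsub>M\<^esub> s)"
    by auto
  have ex: "e x \<in> carrier M" and \<sigma>x: "\<sigma> x \<in> linear_functionals R M" using insert by auto
  have cM: "c s m \<odot>\<^bsub>M\<^esub> s \<in> carrier M" if "s \<in> S" "m \<in> carrier M" for s m
    using that S c by (auto intro!: smult_closed functional_closed)
  have ins: "(\<Oplus>\<^bsub>M\<^esub>y\<in>insert x X. \<sigma> y m \<odot>\<^bsub>M\<^esub> e y)
      = \<sigma> x m \<odot>\<^bsub>M\<^esub> e x \<oplus>\<^bsub>M\<^esub> (\<Oplus>\<^bsub>M\<^esub>s\<in>S. c s m \<odot>\<^bsub>M\<^esub> s)" if m: "m \<in> carrier M" for m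
    using insert m by (subst M.finsum_insert) (auto simp: eq Pi_iff intro!: smult_closed functional_closed)
  show ?case
  proof (cases "e x \<in> S")
    case True
    define S' where "S' = S - {e x}"
    have S': "S = insert (e x) S'" "e x \<notin> S'" "finite S'" "S' \<subseteq> S" using True S by (auto simp: S'_def)
    define c' where "c' = c(e x := (\<lambda>m. \<sigma> x m \<oplus>\<^bsub>R\<^esub> c (e x) m))"
    have c': "c' s \<in> linear_functionals R M" if "s \<in> S" for s
      using that c \<sigma>x True by (auto simp: c'_def functional_add)
    have "(\<Oplus>\<^bsub>M\<^esub>y\<in>insert x X. \<sigma> y m \<odot>\<^bsub>M\<^esub> e y) = (\<Oplus>\<^bsub>M\<^esub>s\<in>S. c' s m \<odot>\<^bsub>M\<^esub> s)" if m: "m \<in> carrier M" for m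
    proof -
      have fin: "(\<lambda>s. c s m \<odot>\<^bsub>M\<^esub> s) \<in> S' \<rightarrow> carrier M" using cM m S' by auto
      have "(\<Oplus>\<^bsub>M\<^esub>s\<in>S. c' s m \<odot>\<^bsub>M\<^esub> s) = c' (e x) m \<odot>\<^bsub>M\<^esub> e x \<oplus>\<^bsub>M\<^esub> (\<Oplus>\<^bsub>M\<^esub>s\<in>S'. c' s m \<odot>\<^bsub>M\<^esub> s)"
        unfolding S'(1) using S' ex m c' S
        by (intro M.finsum_insert) (auto intro!: smult_closed functional_closed)
      also have "(\<Oplus>\<^bsub>M\<^esub>s\<in>S'. c' s m \<odot>\<^bsub>M\<^esub> s) = (\<Oplus>\<^bsub>M\<^esub>s\<in>S'. c s m \<odot>\<^bsub>M\<^esub> s)"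
        using fin S'(2) by (intro M.finsum_cong) (auto simp: c'_def simp_implies_def)
      also have "c' (e x) m \<odot>\<^bsub>M\<^esub> e x = \<sigma> x m \<odot>\<^bsub>M\<^esub> e x \<oplus>\<^bsub>M\<^esub> c (e x) m \<odot>\<^bsub>M\<^esub> e x"
        using m ex \<sigma>x c[OF True] by (simp add: c'_def smult_l_distr functional_closed)
      also have "\<dots> \<oplus>\<^bsub>M\<^esub> (\<Oplus>\<^bsub>M\<^esub>s\<in>S'. c s m \<odot>\<^bsub>M\<^esub> s)
          = \<sigma> x m \<odot>\<^bsub>M\<^esub> e x \<oplus>\<^bsub>M\<^esub> (c (e x) m \<odot>\<^bsub>M\<^esub> e x \<oplus>\<^bsub>M\<^esub> (\<Oplus>\<^bsub>M\<^esub>s\<in>S'. c s m \<odot>\<^bsub>M\<^esub> s))"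
        using m ex \<sigma>x c[OF True] fin by (intro M.a_assoc smult_closed functional_closed M.finsum_closed) auto
      also have "c (e x) m \<odot>\<^bsub>M\<^esub> e x \<oplus>\<^bsub>M\<^esub> (\<Oplus>\<^bsub>M\<^esub>s\<in>S'. c s m \<odot>\<^bsub>M\<^esub> s) = (\<Oplus>\<^bsub>M\<^esub>s\<in>S. c s m \<odot>\<^bsub>M\<^esub> s)"
        unfolding S'(1) using S' fin cM[OF True m] by (intro M.finsum_insert[symmetric]) auto
      finally show ?thesis using ins[OF m] by simp
    qed
    then show ?thesis using S c' by blast
  next
    case False
    define c' where "c' = c(e x := \<sigma> x)"
    have "(\<Oplus>\<^bsub>M\<^esub>y\<in>insert x X. \<sigma> y m \<odot>\<^bsub>M\<^esub> e y) = (\<Oplus>\<^bsub>M\<^esub>s\<in>insert (e x) S. c' s m \<odot>\<^bsub>M\<^esub> s)"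
      if m: "m \<in> carrier M" for m
    proof -
      have fin: "(\<lambda>s. c s m \<odot>\<^bsub>M\<^esub> s) \<in> S \<rightarrow> carrier M" using cM m by auto
      have eqc: "(\<Oplus>\<^bsub>M\<^esub>s\<in>S. c' s m \<odot>\<^bsub>M\<^esub> s) = (\<Oplus>\<^bsub>M\<^esub>s\<in>S. c s m \<odot>\<^bsub>M\<^esub> s)"
        using fin False by (intro M.finsum_cong) (auto simp: c'_def simp_implies_def)
      have "(\<Oplus>\<^bsub>M\<^esub>s\<in>insert (e x) S. c' s m \<odot>\<^bsub>M\<^esub> s) = c' (e x) m \<odot>\<^bsub>M\<^esub> e x \<oplus>\<^bsub>M\<^esub> (\<Oplus>\<^bsub>M\<^esub>s\<in>S. c' s m \<odot>\<^bsub>M\<^esub> s)"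
        using S False ex \<sigma>x m fin
        by (intro M.finsum_insert) (auto simp: c'_def Pi_iff intro!: smult_closed functional_closed)
      then show ?thesis using ins[OF m] eqc by (simp add: c'_def)
    qed
    moreover have "\<forall>s\<in>insert (e x) S. c' s \<in> linear_functionals R M" using c \<sigma>x by (auto simp: c'_def)
    ultimately show ?thesis using S ex
      by (intro exI[of _ "insert (e x) S"] exI[of _ c']) auto
  qed
qed

text \<open>A map on a free module is determined by its values on the basis; the induction splits
  off one point of the support at a time.\<close>

lemma free_module_map_eq:
  assumes t: "t \<in> module_maps (carrier R) (free_module R X) M" and fin: "finite Y" "Y \<subseteq> X"
    and f: "f \<in> carrier (free_module R X)" "\<And>x. x \<notin> Y \<Longrightarrow> f x = \<zero>\<^bsub>R\<^esub>"
  shows "t f = (\<Oplus>\<^bsub>M\<^esub>x\<in>Y. f x \<odot>\<^bsub>M\<^esub> t (\<lambda>y. if y = x then \<one>\<^bsub>R\<^esub> else \<zero>\<^bsub>R\<^esub>))"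
  using fin f
proof (induction Y arbitrary: f rule: finite_induct)
  case empty
  let ?z = "\<lambda>x. \<zero>\<^bsub>R\<^esub>"
  have "f = ?z" using empty by auto
  have z: "?z \<in> carrier (free_module R X)" by (simp add: free_module_def)
  have "t ?z = t (?z \<oplus>\<^bsub>free_module R X\<^esub> ?z)" by (simp add: free_module_def)
  also have "\<dots> = t ?z \<oplus>\<^bsub>M\<^esub> t ?z" using t z by (simp add: module_maps_def)
  finally have "t ?z = t ?z \<oplus>\<^bsub>M\<^esub> t ?z" .
  moreover have "t ?z \<in> carrier M" using t z by (auto simp: module_maps_def)
  ultimately have "t ?z = \<zero>\<^bsub>M\<^esub>" by (rule double_eq_self[rotated])
  then show ?case using \<open>f = ?z\<close> by simp
next
  case (insert x Y)
  define \<delta> :: "'e \<Rightarrow> 'e \<Rightarrow> 'a" where "\<delta> = (\<lambda>x y. if y = x then \<one>\<^bsub>R\<^esub> else \<zero>\<^bsub>R\<^esub>)"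
  define f' where "f' = f(x := \<zero>\<^bsub>R\<^esub>)"
  have xX: "x \<in> X" using insert by auto
  have fx: "f x \<in> carrier R" using insert.prems xX by (simp add: free_module_def)
  have \<delta>: "\<delta> z \<in> carrier (free_module R X)" if "z \<in> X" for z
    using that by (auto simp: free_module_def \<delta>_def)
  have f': "f' \<in> carrier (free_module R X)"
  proof -
    have "{y. f' y \<noteq> \<zero>\<^bsub>R\<^esub>} \<subseteq> {y. f y \<noteq> \<zero>\<^bsub>R\<^esub>}" by (auto simp: f'_def)
    then have "finite {y. f' y \<noteq> \<zero>\<^bsub>R\<^esub>}" using insert.prems finite_subset by (auto simp: free_module_def)
    then show ?thesis using insert.prems by (auto simp: free_module_def f'_def)
  qed
  have f_eq: "f = (f x \<odot>\<^bsub>free_module R X\<^esub> \<delta> x) \<oplus>\<^bsub>free_module R X\<^esub> f'"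
    using insert.prems fx by (auto simp: free_module_def f'_def \<delta>_def fun_eq_iff)
  have sc: "f x \<odot>\<^bsub>free_module R X\<^esub> \<delta> x \<in> carrier (free_module R X)"
    using fx xX by (auto simp: free_module_def \<delta>_def intro: finite_subset[of _ "{x}"])
  have tM: "t (\<delta> z) \<in> carrier M" if "z \<in> X" for z using t \<delta>[OF that] by (auto simp: module_maps_def)
  have "t f = t (f x \<odot>\<^bsub>free_module R X\<^esub> \<delta> x) \<oplus>\<^bsub>M\<^esub> t f'"
    using t sc f' by (subst f_eq) (simp add: module_maps_def)
  also have "t (f x \<odot>\<^bsub>free_module R X\<^esub> \<delta> x) = f x \<odot>\<^bsub>M\<^esub> t (\<delta> x)"
    using t fx \<delta>[OF xX] by (simp add: module_maps_def)
  also have "t f' = (\<Oplus>\<^bsub>M\<^esub>y\<in>Y. f' y \<odot>\<^bsub>M\<^esub> t (\<delta> y))"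
    unfolding \<delta>_def
  proof (rule insert.IH[OF _ f'])
    show "f' y = \<zero>\<^bsub>R\<^esub>" if "y \<notin> Y" for y using insert.prems(3) that by (simp add: f'_def)
  qed (use insert.prems in auto)
  also have "\<dots> = (\<Oplus>\<^bsub>M\<^esub>y\<in>Y. f y \<odot>\<^bsub>M\<^esub> t (\<delta> y))"
    using insert tM by (intro M.finsum_cong)
      (auto simp: f'_def simp_implies_def free_module_def subset_iff intro!: smult_closed)
  also have "f x \<odot>\<^bsub>M\<^esub> t (\<delta> x) \<oplus>\<^bsub>M\<^esub> \<dots> = (\<Oplus>\<^bsub>M\<^esub>y\<in>insert x Y. f y \<odot>\<^bsub>M\<^esub> t (\<delta> y))"
    using insert tM fx xX by (intro M.finsum_insert[symmetric])
      (auto simp: free_module_def subset_iff intro!: smult_closed)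
  finally show ?case by (simp add: \<delta>_def)
qed

end

text \<open>The free module of which \<open>M\<close> is a retract may have an infinite basis
  \<open>X\<close>. The supports of the images of the finitely many generators lie in a finite
  \<open>Y\<close>, and then so do those of all \<open>s m\<close>. Expanding
  \<open>t (s m) = m\<close> over \<open>Y\<close> gives the coordinates \<open>s m x\<close> and
  the elements \<open>e x\<close>.\<close>

lemma finite_dual_basis:
  fixes R :: "('r, 'q) ring_scheme" and M :: "('r, 'b, 'x) module_scheme"
  assumes proj: "projective_module R M" and fg: "finitely_generated R M"
  obtains S c where "finite S" "S \<subseteq> carrier M" "\<And>s. s \<in> S \<Longrightarrow> c s \<in> linear_functionals R M"
    "\<And>m. m \<in> carrier M \<Longrightarrow> m = (\<Oplus>\<^bsub>M\<^esub>s\<in>S. c s m \<odot>\<^bsub>M\<^esub> s)"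
proof -
  interpret left_module R M using proj by (simp add: projective_module_def)
  obtain X :: "'b set" and s t where s: "s \<in> module_maps (carrier R) M (free_module R X)"
    and t: "t \<in> module_maps (carrier R) (free_module R X) M" and ts: "\<And>x. x \<in> carrier M \<Longrightarrow> t (s x) = x"
    using proj[unfolded projective_module_def, THEN conjunct2] by blast
  obtain S0 where S0: "finite S0" "S0 \<subseteq> carrier M"
    "\<And>x. x \<in> carrier M \<Longrightarrow> \<exists>a\<in>S0 \<rightarrow> carrier R. x = (\<Oplus>\<^bsub>M\<^esub>s\<in>S0. a s \<odot>\<^bsub>M\<^esub> s)"
    using fg unfolding finitely_generated_def by blast
  have sF: "s m \<in> carrier (free_module R X)" if "m \<in> carrier M" for m
    using s that by (auto simp: module_maps_def)
  have s_add: "s (m \<oplus>\<^bsub>M\<^esub> m') x = s m x \<oplus>\<^bsub>R\<^esub> s m' x" if "m \<in> carrier M" "m' \<in> carrier M" for m m' x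
    using s that by (simp add: module_maps_def) (simp add: free_module_def)
  have s_smult: "s (a \<odot>\<^bsub>M\<^esub> m) x = (if x \<in> X then a \<otimes>\<^bsub>R\<^esub> s m x else \<zero>\<^bsub>R\<^esub>)"
    if "a \<in> carrier R" "m \<in> carrier M" for a m x
    using s that by (simp add: module_maps_def) (simp add: free_module_def)
  define Y where "Y = (\<Union>g\<in>S0. {x. s g x \<noteq> \<zero>\<^bsub>R\<^esub>})"
  have sF': "finite {x. s m x \<noteq> \<zero>\<^bsub>R\<^esub>}" "x \<notin> X \<Longrightarrow> s m x = \<zero>\<^bsub>R\<^esub>" if "m \<in> carrier M" for m x
    using sF[OF that] by (simp_all add: free_module_def)
  have "finite Y" unfolding Y_def using S0(1,2) sF'(1) by (intro finite_UN_I) auto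
  moreover have "Y \<subseteq> X" unfolding Y_def using S0(2) sF'(2) by blast
  ultimately have Y: "finite Y" "Y \<subseteq> X" .
  have supp: "s m x = \<zero>\<^bsub>R\<^esub>" if m: "m \<in> carrier M" and x: "x \<notin> Y" for m x
  proof -
    obtain a where a: "a \<in> S0 \<rightarrow> carrier R" "m = (\<Oplus>\<^bsub>M\<^esub>g\<in>S0. a g \<odot>\<^bsub>M\<^esub> g)" using S0(3)[OF m] by blast
    have "s (\<Oplus>\<^bsub>M\<^esub>g\<in>T. a g \<odot>\<^bsub>M\<^esub> g) x = \<zero>\<^bsub>R\<^esub>" if "finite T" "T \<subseteq> S0" for T
      using that
    proof (induction T rule: finite_induct)
      case empty
      have "s (\<zero>\<^bsub>R\<^esub> \<odot>\<^bsub>M\<^esub> \<zero>\<^bsub>M\<^esub>) x = \<zero>\<^bsub>R\<^esub>"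
        using sF[of "\<zero>\<^bsub>M\<^esub>"] by (subst s_smult) (auto simp: free_module_def)
      then show ?case by (simp add: smult_zero_left)
    next
      case (insert g T)
      have g: "g \<in> carrier M" "a g \<in> carrier R" "s g x = \<zero>\<^bsub>R\<^esub>"
        using insert S0 a x by (auto simp: Y_def)
      have fin: "(\<lambda>g. a g \<odot>\<^bsub>M\<^esub> g) \<in> T \<rightarrow> carrier M"
        using insert.prems S0 a by (auto intro!: smult_closed)
      have "(\<Oplus>\<^bsub>M\<^esub>g\<in>insert g T. a g \<odot>\<^bsub>M\<^esub> g) = a g \<odot>\<^bsub>M\<^esub> g \<oplus>\<^bsub>M\<^esub> (\<Oplus>\<^bsub>M\<^esub>g\<in>T. a g \<odot>\<^bsub>M\<^esub> g)"
        using insert g fin by (intro M.finsum_insert) (auto intro!: smult_closed)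
      then show ?case using insert g fin
        by (simp add: s_add s_smult smult_closed M.finsum_closed)
    qed
    from this[OF S0(1)] show ?thesis using a by simp
  qed
  define e where "e = (\<lambda>x. t (\<lambda>y. if y = x then \<one>\<^bsub>R\<^esub> else \<zero>\<^bsub>R\<^esub>))"
  have e: "e \<in> Y \<rightarrow> carrier M"
  proof
    fix x assume "x \<in> Y"
    then have "(\<lambda>y. if y = x then \<one>\<^bsub>R\<^esub> else \<zero>\<^bsub>R\<^esub>) \<in> carrier (free_module R X)"
      using Y by (auto simp: free_module_def)
    then show "e x \<in> carrier M" using t by (auto simp: module_maps_def e_def)
  qed
  have \<sigma>: "(\<lambda>m. s m x) \<in> linear_functionals R M" if "x \<in> Y" for x
    using that Y sF by (auto simp: linear_functionals_def s_add s_smult free_module_def subset_iff)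
  obtain S c where S: "finite S" "S \<subseteq> carrier M" "\<forall>s\<in>S. c s \<in> linear_functionals R M"
    and eq: "\<forall>m\<in>carrier M. (\<Oplus>\<^bsub>M\<^esub>x\<in>Y. s m x \<odot>\<^bsub>M\<^esub> e x) = (\<Oplus>\<^bsub>M\<^esub>s\<in>S. c s m \<odot>\<^bsub>M\<^esub> s)"
    using regroup_combination[OF Y(1) e, of "\<lambda>x m. s m x"] \<sigma> by blast
  show ?thesis
  proof (rule that[OF S(1,2)])
    show "c s \<in> linear_functionals R M" if "s \<in> S" for s using S that by blast
    fix m assume m: "m \<in> carrier M"
    have "t (s m) = (\<Oplus>\<^bsub>M\<^esub>x\<in>Y. s m x \<odot>\<^bsub>M\<^esub> e x)"
      unfolding e_def using supp[OF m] by (intro free_module_map_eq[OF t Y sF[OF m]])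
    then show "m = (\<Oplus>\<^bsub>M\<^esub>s\<in>S. c s m \<odot>\<^bsub>M\<^esub> s)" using eq m ts by simp
  qed
qed

section \<open>Tensor products with \<open>\<ell>\<^sup>r(G)\<close>\<close>

text \<open>Serves every module of the resolution, in particular \<open>F (Suc n)\<close>, for which
  no finite generating set is given.\<close>

locale gmodule = group G + M: left_module "group_ring G" M
  for G :: "('g, 'm) monoid_scheme" (structure) and M :: "('g \<Rightarrow>\<^sub>0 int, 'a) module" +
  fixes r :: real
  assumes r1: "1 < r"
begin

abbreviation "Rel \<equiv> tensor_relations G r M"
abbreviation "ten \<equiv> tensor_coset G r M"
abbreviation "LG \<equiv> ell r (carrier G)"

definition gens :: "('a \<times> ('g \<Rightarrow> complex) \<Rightarrow>\<^sub>0 int) set" where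
  "gens = {frag_of (x \<oplus>\<^bsub>M\<^esub> x', f) - frag_of (x, f) - frag_of (x', f) | x x' f.
          x \<in> carrier M \<and> x' \<in> carrier M \<and> f \<in> LG} \<union>
       {frag_of (x, \<lambda>g. f g + f' g) - frag_of (x, f) - frag_of (x, f') | x f f'.
          x \<in> carrier M \<and> f \<in> LG \<and> f' \<in> LG} \<union>
       {frag_of (group_ring_conj G a \<odot>\<^bsub>M\<^esub> x, f) - frag_of (x, gact G a f) | a x f.
          a \<in> carrier (group_ring G) \<and> x \<in> carrier M \<and> f \<in> LG}"

lemma Rel_eq: "Rel = generate (free_Abelian_group (carrier M \<times> LG)) gens"
  by (simp add: tensor_relations_def gens_def)

lemma keys_diff3: "Poly_Mapping.keys (frag_of a - frag_of b - frag_of c) \<subseteq> {a, b, c}"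
  using keys_diff[of "frag_of a - frag_of b" "frag_of c"] keys_diff[of "frag_of a" "frag_of b"] by auto

lemma keys_diff2: "Poly_Mapping.keys (frag_of a - frag_of b) \<subseteq> {a, b}"
  using keys_diff[of "frag_of a" "frag_of b"] by auto

lemma conj_smult_closed:
  "a \<in> carrier (group_ring G) \<Longrightarrow> x \<in> carrier M \<Longrightarrow> group_ring_conj G a \<odot>\<^bsub>M\<^esub> x \<in> carrier M"
  by (intro M.smult_closed conj_closed)

lemma gensE:
  assumes "z \<in> gens"
  obtains
      x x' f where "z = frag_of (x \<oplus>\<^bsub>M\<^esub> x', f) - frag_of (x, f) - frag_of (x', f)"
        "x \<in> carrier M" "x' \<in> carrier M" "f \<in> LG"
    | x f f' where "z = frag_of (x, \<lambda>g. f g + f' g) - frag_of (x, f) - frag_of (x, f')"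
        "x \<in> carrier M" "f \<in> LG" "f' \<in> LG"
    | a x f where "z = frag_of (group_ring_conj G a \<odot>\<^bsub>M\<^esub> x, f) - frag_of (x, gact G a f)"
        "a \<in> carrier (group_ring G)" "x \<in> carrier M" "f \<in> LG"
  using assms unfolding gens_def by blast

lemma gens_carrier: "gens \<subseteq> carrier (free_Abelian_group (carrier M \<times> LG))"
proof
  fix z assume "z \<in> gens"
  then have "Poly_Mapping.keys z \<subseteq> carrier M \<times> LG"
  proof (cases rule: gensE)
    case (1 x x' f)
    show ?thesis unfolding 1(1) by (rule order_trans[OF keys_diff3]) (use 1 M.add.m_closed in simp)
  next
    case (2 x f f')
    show ?thesis unfolding 2(1) by (rule order_trans[OF keys_diff3]) (use 2 ell_add[OF _ _ r1] in simp)
  next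
    case (3 a x f)
    show ?thesis unfolding 3(1)
      by (rule order_trans[OF keys_diff2]) (use 3 conj_smult_closed gact_ell(1)[OF _ _ r1] in simp)
  qed
  then show "z \<in> carrier (free_Abelian_group (carrier M \<times> LG))" by simp
qed

lemma Rel_subgroup: "subgroup Rel (free_Abelian_group (carrier M \<times> LG))"
  unfolding Rel_eq by (intro group.generate_is_subgroup group_free_Abelian_group gens_carrier)

lemma Rel_keys: "z \<in> Rel \<Longrightarrow> Poly_Mapping.keys z \<subseteq> carrier M \<times> LG"
  by (drule subsetD[OF subgroup.subset[OF Rel_subgroup]]) simp

lemma Rel_zero: "0 \<in> Rel"
  using subgroup.one_closed[OF Rel_subgroup] by simp

lemma Rel_add: "z \<in> Rel \<Longrightarrow> w \<in> Rel \<Longrightarrow> z + w \<in> Rel"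
  using subgroup.m_closed[OF Rel_subgroup] by simp

lemma Rel_uminus: "z \<in> Rel \<Longrightarrow> - z \<in> Rel"
  using subgroup.m_inv_closed[OF Rel_subgroup, of z] Rel_keys by simp

lemma Rel_diff: "z \<in> Rel \<Longrightarrow> w \<in> Rel \<Longrightarrow> z - w \<in> Rel"
  using Rel_add[of z "- w"] Rel_uminus by simp

lemma Rel_sum: "(\<And>s. s \<in> S \<Longrightarrow> z s \<in> Rel) \<Longrightarrow> (\<Sum>s\<in>S. z s) \<in> Rel"
  by (induction S rule: infinite_finite_induct) (simp_all add: Rel_zero Rel_add)

lemma Rel_gens:
  "x \<in> carrier M \<Longrightarrow> x' \<in> carrier M \<Longrightarrow> f \<in> LG \<Longrightarrow>
    frag_of (x \<oplus>\<^bsub>M\<^esub> x', f) - frag_of (x, f) - frag_of (x', f) \<in> Rel"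
  "x \<in> carrier M \<Longrightarrow> f \<in> LG \<Longrightarrow> f' \<in> LG \<Longrightarrow>
    frag_of (x, \<lambda>g. f g + f' g) - frag_of (x, f) - frag_of (x, f') \<in> Rel"
  "a \<in> carrier (group_ring G) \<Longrightarrow> x \<in> carrier M \<Longrightarrow> f \<in> LG \<Longrightarrow>
    frag_of (group_ring_conj G a \<odot>\<^bsub>M\<^esub> x, f) - frag_of (x, gact G a f) \<in> Rel"
  unfolding Rel_eq gens_def by (rule generate.incl, blast)+

text \<open>Used to show that additive maps send relations to relations or to 0: only the three
  kinds of generators have to be computed.\<close>

lemma Rel_induct [consumes 1, case_names zero uminus add left right balanced]:
  assumes "z \<in> Rel" and zero: "P 0" and uminus: "\<And>z. P z \<Longrightarrow> P (- z)"
    and add: "\<And>z w. P z \<Longrightarrow> P w \<Longrightarrow> P (z + w)"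
    and "\<And>x x' f. x \<in> carrier M \<Longrightarrow> x' \<in> carrier M \<Longrightarrow> f \<in> LG \<Longrightarrow>
      P (frag_of (x \<oplus>\<^bsub>M\<^esub> x', f) - frag_of (x, f) - frag_of (x', f))"
    and "\<And>x f f'. x \<in> carrier M \<Longrightarrow> f \<in> LG \<Longrightarrow> f' \<in> LG \<Longrightarrow>
      P (frag_of (x, \<lambda>g. f g + f' g) - frag_of (x, f) - frag_of (x, f'))"
    and "\<And>a x f. a \<in> carrier (group_ring G) \<Longrightarrow> x \<in> carrier M \<Longrightarrow> f \<in> LG \<Longrightarrow>
      P (frag_of (group_ring_conj G a \<odot>\<^bsub>M\<^esub> x, f) - frag_of (x, gact G a f))"
  shows "P z"
proof -
  have gen: "P h" if "h \<in> gens" for h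
    using that by (cases rule: gensE) (simp_all only: assms(5-7))
  show ?thesis
    using assms(1) unfolding Rel_eq
  proof (induction z rule: generate.induct)
    case (inv h)
    have "Poly_Mapping.keys h \<subseteq> carrier M \<times> LG" using subsetD[OF gens_carrier inv] by simp
    then show ?case using uminus[OF gen[OF inv]] by simp
  qed (use zero add gen in auto)
qed

lemma ten_eq_image: "ten z = (\<lambda>h. h + z) ` Rel"
  by (auto simp: tensor_coset_def r_coset_def)

lemma mem_ten_iff: "w \<in> ten z \<longleftrightarrow> w - z \<in> Rel"
  unfolding ten_eq_image by (auto simp: image_iff intro: bexI[of _ "w - z"])

lemma ten_eq_iff: "ten z = ten w \<longleftrightarrow> z - w \<in> Rel"
proof
  assume "ten z = ten w"
  moreover have "z \<in> ten z" by (simp add: mem_ten_iff Rel_zero)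
  ultimately show "z - w \<in> Rel" by (simp add: mem_ten_iff)
next
  assume zw: "z - w \<in> Rel"
  have "x - z \<in> Rel \<longleftrightarrow> x - w \<in> Rel" for x
    using Rel_add[of "x - z" "z - w"] Rel_diff[of "x - w" "z - w"] zw by auto
  then show "ten z = ten w" by (auto simp: mem_ten_iff)
qed

lemma carrier_lr_tensor:
  "carrier (lr_tensor G r M) = ten ` {z. Poly_Mapping.keys z \<subseteq> carrier M \<times> LG}"
  by (auto simp: lr_tensor_def Let_def RCOSETS_def tensor_coset_def lr_space_eq_ell)

lemma zero_lr_tensor: "\<zero>\<^bsub>lr_tensor G r M\<^esub> = ten 0"
  by (simp add: lr_tensor_def Let_def ten_eq_image)

lemma add_lr_tensor: "ten z \<oplus>\<^bsub>lr_tensor G r M\<^esub> ten w = ten (z + w)"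
proof -
  have "ten z \<oplus>\<^bsub>lr_tensor G r M\<^esub> ten w = {a + b |a b. a \<in> ten z \<and> b \<in> ten w}"
    by (auto simp: lr_tensor_def Let_def set_mult_def)
  also have "\<dots> = ten (z + w)"
  proof (intro equalityI subsetI)
    fix x assume "x \<in> {a + b |a b. a \<in> ten z \<and> b \<in> ten w}"
    then obtain a b where "x = a + b" "a - z \<in> Rel" "b - w \<in> Rel" by (auto simp: mem_ten_iff)
    then show "x \<in> ten (z + w)" using Rel_add[of "a - z" "b - w"] by (simp add: mem_ten_iff algebra_simps)
  next
    fix x assume "x \<in> ten (z + w)"
    then have "x - w \<in> ten z" "w \<in> ten w" by (simp_all add: mem_ten_iff algebra_simps Rel_zero)
    then show "x \<in> {a + b |a b. a \<in> ten z \<and> b \<in> ten w}"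
      by (intro CollectI exI[of _ "x - w"] exI[of _ w]) simp
  qed
  finally show ?thesis .
qed

lemma openin_lr_tensor:
  "openin (topo (lr_tensor G r M)) U \<longleftrightarrow> U \<subseteq> carrier (lr_tensor G r M) \<and>
    (\<forall>S. finite S \<and> S \<subseteq> carrier M \<longrightarrow> openin (product_topology (\<lambda>_. lr_topology G r) S)
      {f \<in> topspace (product_topology (\<lambda>_. lr_topology G r) S). ten (\<Sum>s\<in>S. frag_of (s, f s)) \<in> U})"
  by (simp add: lr_tensor_def Let_def openin_final_topology)

text \<open>Biadditivity with both summands zero yields minus the element in question.\<close>

lemma Rel_zero_right: "x \<in> carrier M \<Longrightarrow> frag_of (x, \<lambda>g. 0) \<in> Rel"
  using Rel_uminus[OF Rel_gens(2)[of x "\<lambda>g. 0" "\<lambda>g. 0"]] by simp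

lemma Rel_diff_right:
  assumes "x \<in> carrier M" "f \<in> LG" "f' \<in> LG"
  shows "frag_of (x, \<lambda>g. f g - f' g) - (frag_of (x, f) - frag_of (x, f')) \<in> Rel"
  using Rel_uminus[OF Rel_gens(2)[OF assms(1) ell_diff[OF assms(2,3) r1] assms(3)]]
  by (simp add: algebra_simps)

lemma Rel_zero_left: "f \<in> LG \<Longrightarrow> frag_of (\<zero>\<^bsub>M\<^esub>, f) \<in> Rel"
  using Rel_uminus[OF Rel_gens(1)[of "\<zero>\<^bsub>M\<^esub>" "\<zero>\<^bsub>M\<^esub>" f]] by simp

lemma Rel_finsum_left:
  assumes "finite S" "x \<in> S \<rightarrow> carrier M" "f \<in> LG"
  shows "frag_of (\<Oplus>\<^bsub>M\<^esub>s\<in>S. x s, f) - (\<Sum>s\<in>S. frag_of (x s, f)) \<in> Rel"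
  using assms(1,2)
proof (induction S rule: finite_induct)
  case empty
  then show ?case using Rel_zero_left[OF assms(3)] by simp
next
  case (insert s S)
  have m: "x s \<in> carrier M" "(\<Oplus>\<^bsub>M\<^esub>s\<in>S. x s) \<in> carrier M"
    using insert.prems by (auto intro!: M.finsum_closed)
  have "(\<Oplus>\<^bsub>M\<^esub>s\<in>insert s S. x s) = x s \<oplus>\<^bsub>M\<^esub> (\<Oplus>\<^bsub>M\<^esub>s\<in>S. x s)"
    using insert by (intro M.finsum_insert) auto
  then have "frag_of (\<Oplus>\<^bsub>M\<^esub>s\<in>insert s S. x s, f) - (\<Sum>s\<in>insert s S. frag_of (x s, f))
      = (frag_of (x s \<oplus>\<^bsub>M\<^esub> (\<Oplus>\<^bsub>M\<^esub>s\<in>S. x s), f) - frag_of (x s, f) - frag_of (\<Oplus>\<^bsub>M\<^esub>s\<in>S. x s, f))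
        + (frag_of (\<Oplus>\<^bsub>M\<^esub>s\<in>S. x s, f) - (\<Sum>s\<in>S. frag_of (x s, f)))"
    using insert by simp
  also have "\<dots> \<in> Rel"
    using insert by (intro Rel_add Rel_gens(1) m assms) auto
  finally show ?case .
qed

end

section \<open>Maps between tensor products\<close>

text \<open>The map on representatives inside \<open>tensor_map\<close>, named so that it can be
  computed before passing to cosets.\<close>

definition tensor_lift ::
  "('a \<Rightarrow> 'b) \<Rightarrow> (('g \<Rightarrow> complex) \<Rightarrow> 'g \<Rightarrow> complex) \<Rightarrow>
     ('a \<times> ('g \<Rightarrow> complex) \<Rightarrow>\<^sub>0 int) \<Rightarrow> ('b \<times> ('g \<Rightarrow> complex) \<Rightarrow>\<^sub>0 int)" where
  "tensor_lift u v = frag_extend (\<lambda>(x, f). frag_of (u x, v f))"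

lemma tensor_lift_simps [simp]:
  "tensor_lift u v 0 = 0" "tensor_lift u v (frag_of (x, f)) = frag_of (u x, v f)"
  "tensor_lift u v (z + w) = tensor_lift u v z + tensor_lift u v w"
  "tensor_lift u v (z - w) = tensor_lift u v z - tensor_lift u v w"
  "tensor_lift u v (- z) = - tensor_lift u v z"
  by (simp_all add: tensor_lift_def frag_extend_add frag_extend_diff frag_extend_minus)

lemma keys_tensor_lift:
  assumes "Poly_Mapping.keys z \<subseteq> X \<times> L" "u ` X \<subseteq> X'" "v ` L \<subseteq> L'"
  shows "Poly_Mapping.keys (tensor_lift u v z) \<subseteq> X' \<times> L'"
proof
  fix y assume "y \<in> Poly_Mapping.keys (tensor_lift u v z)"
  then obtain w where w: "w \<in> Poly_Mapping.keys z" "y \<in> Poly_Mapping.keys (case w of (x, f) \<Rightarrow> frag_of (u x, v f))"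
    using keys_frag_extend[of "\<lambda>(x, f). frag_of (u x, v f)" z] unfolding tensor_lift_def by blast
  obtain x f where xf: "w = (x, f)" by (cases w)
  then have "y = (u x, v f)" "x \<in> X" "f \<in> L" using w assms(1) by auto
  then show "y \<in> X' \<times> L'" using assms(2,3) by auto
qed

lemma tensor_lift_compose:
  "tensor_lift u v (tensor_lift u' v' z) = tensor_lift (u \<circ> u') (v \<circ> v') z"
proof -
  have "Poly_Mapping.keys z \<subseteq> UNIV" by simp
  then show ?thesis by (induction z rule: frag_induction) auto
qed

lemma tensor_lift_in_Rel:
  assumes M: "gmodule G M r" and N: "gmodule G N r"
    and u: "u \<in> module_maps (carrier (group_ring G)) M N"
    and v: "\<And>f. f \<in> ell r (carrier G) \<Longrightarrow> v f \<in> ell r (carrier G)"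
    and v_add: "\<And>f f'. f \<in> ell r (carrier G) \<Longrightarrow> f' \<in> ell r (carrier G) \<Longrightarrow> v (\<lambda>g. f g + f' g) = (\<lambda>g. v f g + v f' g)"
    and v_act: "\<And>a f. a \<in> carrier (group_ring G) \<Longrightarrow> f \<in> ell r (carrier G) \<Longrightarrow> v (gact G a f) = gact G a (v f)"
    and z: "z \<in> tensor_relations G r M"
  shows "tensor_lift u v z \<in> tensor_relations G r N"
proof -
  interpret M: gmodule G M r by (rule M)
  interpret N: gmodule G N r by (rule N)
  have uN: "u x \<in> carrier N" if "x \<in> carrier M" for x using u that by (auto simp: module_maps_def)
  show ?thesis
    using z
  proof (induction z rule: M.Rel_induct)
    case (left x x' f)
    then show ?case using N.Rel_gens(1)[of "u x" "u x'" "v f"] u uN v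
      by (simp add: module_maps_def)
  next
    case (right x f f')
    then show ?case using N.Rel_gens(2)[of "u x" "v f" "v f'"] uN v by (simp add: v_add)
  next
    case (balanced a x f)
    then have "u (group_ring_conj G a \<odot>\<^bsub>M\<^esub> x) = group_ring_conj G a \<odot>\<^bsub>N\<^esub> u x"
      using u M.conj_closed by (simp add: module_maps_def)
    then show ?case using balanced N.Rel_gens(3)[of a "u x" "v f"] uN v by (simp add: v_act)
  qed (simp_all add: N.Rel_zero N.Rel_add N.Rel_uminus)
qed

text \<open>All representatives of a coset have the same image coset, so the union in
  \<open>tensor_map\<close> collapses.\<close>

lemma tensor_map_coset:
  assumes M: "gmodule G M r" and N: "gmodule G N r"
    and u: "u \<in> module_maps (carrier (group_ring G)) M N"
    and v: "\<And>f. f \<in> ell r (carrier G) \<Longrightarrow> v f \<in> ell r (carrier G)"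
    and v_add: "\<And>f f'. f \<in> ell r (carrier G) \<Longrightarrow> f' \<in> ell r (carrier G) \<Longrightarrow> v (\<lambda>g. f g + f' g) = (\<lambda>g. v f g + v f' g)"
    and v_act: "\<And>a f. a \<in> carrier (group_ring G) \<Longrightarrow> f \<in> ell r (carrier G) \<Longrightarrow> v (gact G a f) = gact G a (v f)"
  shows "tensor_map G r N u v (tensor_coset G r M z) = tensor_coset G r N (tensor_lift u v z)"
proof -
  interpret M: gmodule G M r by (rule M)
  interpret N: gmodule G N r by (rule N)
  have "tensor_coset G r N (tensor_lift u v w) = tensor_coset G r N (tensor_lift u v z)"
    if w: "w \<in> tensor_coset G r M z" for w
  proof -
    have "w - z \<in> tensor_relations G r M" using w by (simp add: M.mem_ten_iff)
    then have "tensor_lift u v (w - z) \<in> tensor_relations G r N"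
      by (intro tensor_lift_in_Rel[OF M N u v v_add v_act])
    then show ?thesis by (simp add: N.ten_eq_iff)
  qed
  moreover have "z \<in> tensor_coset G r M z" by (simp add: M.mem_ten_iff M.Rel_zero)
  ultimately show ?thesis unfolding tensor_map_def tensor_lift_def[symmetric] by blast
qed

context gmodule
begin

lemma id_module_map: "id \<in> module_maps (carrier (group_ring G)) M M"
  by (simp add: module_maps_def)

lemma smult_lr_tensor: "c \<odot>\<^bsub>lr_tensor G r M\<^esub> ten z = ten (tensor_lift id (\<lambda>f g. c * f g) z)"
proof -
  have "c \<odot>\<^bsub>lr_tensor G r M\<^esub> ten z = tensor_map G r M id (\<lambda>f g. c * f g) (ten z)"
    by (simp add: lr_tensor_def Let_def)
  also have "\<dots> = ten (tensor_lift id (\<lambda>f g. c * f g) z)"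
    by (rule tensor_map_coset[OF gmodule_axioms gmodule_axioms id_module_map])
      (simp_all add: ell_scale gact_scale distrib_left)
  finally show ?thesis .
qed

lemma keys_scale:
  assumes "Poly_Mapping.keys z \<subseteq> carrier M \<times> LG"
  shows "Poly_Mapping.keys (tensor_lift id (\<lambda>f g. c * f g) z) \<subseteq> carrier M \<times> LG"
  by (rule keys_tensor_lift[OF assms]) (auto simp: ell_scale)

end

section \<open>Families indexed by a finite set\<close>

lemma ell_slice:
  assumes x: "x \<in> ell r (S \<times> T)" and s: "s \<in> S" and r: "1 < r"
  shows "(\<lambda>t. x (s, t)) \<in> ell r T" "ell_norm r T (\<lambda>t. x (s, t)) \<le> ell_norm r (S \<times> T) x"
proof -
  have b: "(\<Sum>t\<in>F. cmod (x (s, t)) powr r) \<le> ell_norm r (S \<times> T) x powr r" if F: "finite F" "F \<subseteq> T" for F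
  proof -
    have "(\<Sum>t\<in>F. cmod (x (s, t)) powr r) = (\<Sum>i\<in>Pair s ` F. cmod (x i) powr r)"
      by (simp add: sum.reindex inj_on_def)
    also have "\<dots> \<le> ell_norm r (S \<times> T) x powr r"
      using x r F s by (intro sum_le_ell_norm) auto
    finally show ?thesis .
  qed
  have o: "x (s, t) = 0" if "t \<notin> T" for t using x that by (auto intro: ell_outside)
  show "(\<lambda>t. x (s, t)) \<in> ell r T" "ell_norm r T (\<lambda>t. x (s, t)) \<le> ell_norm r (S \<times> T) x"
    using ellI_bound[OF o _ _ b] r by auto
qed

text \<open>The family is the sum of its slices extended by 0, to which the triangle inequality
  applies. The sum of the norms is a crude bound, but equivalent to the norm for finite
  \<open>S\<close>.\<close>

lemma ell_assemble:
  assumes S: "finite S" and f: "\<And>s. s \<in> S \<Longrightarrow> f s \<in> ell r T" and r: "1 < r"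
  shows "(\<lambda>(s, t). if s \<in> S then f s t else 0) \<in> ell r (S \<times> T)"
    and "ell_norm r (S \<times> T) (\<lambda>(s, t). if s \<in> S then f s t else 0) \<le> (\<Sum>s\<in>S. ell_norm r T (f s))"
proof -
  define e where "e = (\<lambda>s (s', t). if s' = s then f s t else 0)"
  have e: "e s \<in> ell r (S \<times> T)" "ell_norm r (S \<times> T) (e s) \<le> ell_norm r T (f s)" if s: "s \<in> S" for s
  proof -
    have b: "(\<Sum>i\<in>F. cmod (e s i) powr r) \<le> ell_norm r T (f s) powr r" if F: "finite F" "F \<subseteq> S \<times> T" for F
    proof -
      have "(\<Sum>i\<in>F. cmod (e s i) powr r) = (\<Sum>i\<in>F \<inter> Pair s ` T. cmod (e s i) powr r)"
      proof (intro sum.mono_neutral_right ballI)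
        fix i assume i: "i \<in> F - F \<inter> Pair s ` T"
        obtain a b where ab: "i = (a, b)" by (cases i)
        then have "a \<noteq> s" using i F(2) by blast
        then show "cmod (e s i) powr r = 0" by (simp add: ab e_def)
      qed (use F in auto)
      also have "\<dots> = (\<Sum>i\<in>Pair s ` {t. (s, t) \<in> F}. cmod (e s i) powr r)"
        using F by (intro sum.cong) auto
      also have "\<dots> = (\<Sum>t\<in>{t. (s, t) \<in> F}. cmod (f s t) powr r)"
        by (simp add: sum.reindex inj_on_def e_def)
      also have "\<dots> \<le> ell_norm r T (f s) powr r"
      proof (rule sum_le_ell_norm[OF f[OF s]])
        have "{t. (s, t) \<in> F} \<subseteq> snd ` F" by force
        then show "finite {t. (s, t) \<in> F}" using F finite_surj by blast
      qed (use r F in auto)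
      finally show ?thesis .
    qed
    have o: "e s i = 0" if "i \<notin> S \<times> T" for i
      using that s ell_outside[OF f[OF s]] by (auto simp: e_def split: prod.splits)
    show "e s \<in> ell r (S \<times> T)" "ell_norm r (S \<times> T) (e s) \<le> ell_norm r T (f s)"
      using ellI_bound[OF o _ _ b] r by auto
  qed
  have eq: "(\<lambda>(s, t). if s \<in> S then f s t else 0) = (\<lambda>i. \<Sum>s\<in>S. e s i)"
  proof
    fix i :: "'a \<times> 'b"
    have "(\<Sum>s\<in>S. e s i) = (\<Sum>s\<in>S. if s = fst i then f s (snd i) else 0)"
      by (intro sum.cong) (auto simp: e_def split: prod.splits)
    then show "(case i of (s, t) \<Rightarrow> if s \<in> S then f s t else 0) = (\<Sum>s\<in>S. e s i)"
      using S by (simp add: split: prod.splits)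
  qed
  show "(\<lambda>(s, t). if s \<in> S then f s t else 0) \<in> ell r (S \<times> T)"
    unfolding eq using e r by (intro ell_sum) auto
  have "ell_norm r (S \<times> T) (\<lambda>(s, t). if s \<in> S then f s t else 0) \<le> (\<Sum>s\<in>S. ell_norm r (S \<times> T) (e s))"
    unfolding eq using e r by (intro ell_sum) auto
  also have "\<dots> \<le> (\<Sum>s\<in>S. ell_norm r T (f s))" using e by (intro sum_mono) auto
  finally show "ell_norm r (S \<times> T) (\<lambda>(s, t). if s \<in> S then f s t else 0) \<le> (\<Sum>s\<in>S. ell_norm r T (f s))" .
qed

text \<open>Fubini's theorem, with summability supplied by Hoelder's inequality.\<close>

lemma (in conjugate_exponents) ell_pair_slices:
  assumes S: "finite S" and x: "x \<in> ell p (S \<times> T)" and y: "y \<in> ell q (S \<times> T)"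
  shows "ell_pair (S \<times> T) x y = (\<Sum>s\<in>S. ell_pair T (\<lambda>t. x (s, t)) (\<lambda>t. y (s, t)))"
proof -
  have "(\<lambda>(s, t). x (s, t) * y (s, t)) summable_on S \<times> T"
    using pair_summable[OF x y] by (simp add: case_prod_unfold)
  then have "infsum (\<lambda>s. infsum (\<lambda>t. x (s, t) * y (s, t)) T) S = infsum (\<lambda>(s, t). x (s, t) * y (s, t)) (S \<times> T)"
    by (rule infsum_Sigma'_banach)
  then show ?thesis using S by (simp add: ell_pair_def case_prod_unfold)
qed

section \<open>The topology on \<open>\<ell>\<^sup>r(G)\<close>-valued families\<close>

lemma lr_metric:
  assumes "1 < r"
  shows "Metric_space (ell r (carrier G)) (\<lambda>f f'. ell_norm r (carrier G) (\<lambda>g. f g - f' g))"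
proof
  show "0 \<le> ell_norm r (carrier G) (\<lambda>g. x g - y g)" for x y by simp
  show "ell_norm r (carrier G) (\<lambda>g. x g - y g) = ell_norm r (carrier G) (\<lambda>g. y g - x g)" for x y
    by (rule ell_norm_minus_commute)
  fix x y z assume xyz: "x \<in> ell r (carrier G)" "y \<in> ell r (carrier G)"
  show "ell_norm r (carrier G) (\<lambda>g. x g - y g) = 0 \<longleftrightarrow> x = y"
    using ell_norm_eq_0D[OF ell_diff[OF xyz assms]] assms by (auto simp: fun_eq_iff)
  assume "z \<in> ell r (carrier G)"
  then show "ell_norm r (carrier G) (\<lambda>g. x g - z g)
      \<le> ell_norm r (carrier G) (\<lambda>g. x g - y g) + ell_norm r (carrier G) (\<lambda>g. y g - z g)"
    using ell_norm_triangle xyz assms by blast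
qed

lemma openin_lr_topology:
  assumes "1 < r"
  shows "openin (lr_topology G r) U \<longleftrightarrow> U \<subseteq> ell r (carrier G) \<and>
    (\<forall>f\<in>U. \<exists>e>0. \<forall>f'\<in>ell r (carrier G). ell_norm r (carrier G) (\<lambda>g. f' g - f g) < e \<longrightarrow> f' \<in> U)"
proof -
  interpret Metric_space "ell r (carrier G)" "\<lambda>f f'. ell_norm r (carrier G) (\<lambda>g. f g - f' g)"
    using lr_metric[OF assms] .
  have ball: "mball f e \<subseteq> U \<longleftrightarrow> (\<forall>f'\<in>ell r (carrier G). ell_norm r (carrier G) (\<lambda>g. f' g - f g) < e \<longrightarrow> f' \<in> U)"
    if "f \<in> ell r (carrier G)" for f e
    using that by (auto simp: subset_iff ell_norm_minus_commute[of r "carrier G" f])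
  show ?thesis
    unfolding lr_topology_def lr_space_eq_ell lr_norm_eq_ell openin_mtopology
    using ball by (intro conj_cong refl) (auto simp: subset_iff)
qed

lemma topspace_lr_topology: "1 < r \<Longrightarrow> topspace (lr_topology G r) = ell r (carrier G)"
  using Metric_space.topspace_mtopology[OF lr_metric[of r G]]
  by (simp add: lr_topology_def lr_space_eq_ell lr_norm_eq_ell)

lemma openin_lr_ball:
  assumes "1 < r" "f \<in> ell r (carrier G)"
  shows "openin (lr_topology G r) {f' \<in> ell r (carrier G). ell_norm r (carrier G) (\<lambda>g. f' g - f g) < e}"
  unfolding openin_lr_topology[OF assms(1)]
proof (intro conjI ballI)
  fix h assume h: "h \<in> {f' \<in> ell r (carrier G). ell_norm r (carrier G) (\<lambda>g. f' g - f g) < e}"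
  have "ell_norm r (carrier G) (\<lambda>g. k g - f g) < e"
    if "k \<in> ell r (carrier G)" "ell_norm r (carrier G) (\<lambda>g. k g - h g) < e - ell_norm r (carrier G) (\<lambda>g. h g - f g)" for k
    using ell_norm_triangle[of k r "carrier G" h f] that h assms by simp
  then show "\<exists>d>0. \<forall>k\<in>ell r (carrier G). ell_norm r (carrier G) (\<lambda>g. k g - h g) < d \<longrightarrow>
      k \<in> {f' \<in> ell r (carrier G). ell_norm r (carrier G) (\<lambda>g. f' g - f g) < e}"
    using h by (intro exI[of _ "e - ell_norm r (carrier G) (\<lambda>g. h g - f g)"]) auto
qed auto

text \<open>For \<open>lr_hom\<close> the index set \<open>A\<close> may be infinite, so
  neighbourhoods constrain a finite set \<open>F\<close> of coordinates; a single radius for all of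
  them is obtained as a minimum.\<close>

lemma openin_lr_product:
  assumes r: "1 < r"
  shows "openin (product_topology (\<lambda>_. lr_topology G r) A) X \<longleftrightarrow>
    X \<subseteq> (\<Pi>\<^sub>E i\<in>A. ell r (carrier G)) \<and>
    (\<forall>f\<in>X. \<exists>F e. finite F \<and> F \<subseteq> A \<and> 0 < e \<and> (\<forall>f'\<in>\<Pi>\<^sub>E i\<in>A. ell r (carrier G).
      (\<forall>i\<in>F. ell_norm r (carrier G) (\<lambda>g. f' i g - f i g) < e) \<longrightarrow> f' \<in> X))"
    (is "?l \<longleftrightarrow> X \<subseteq> ?P \<and> ?R")
proof
  assume op: ?l
  then have XP: "X \<subseteq> ?P" using openin_subset topspace_lr_topology[OF r] by fastforce
  have ?R
  proof
    fix f assume f: "f \<in> X"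
    obtain U where U: "finite {i \<in> A. U i \<noteq> topspace (lr_topology G r)}"
      "\<And>i. i \<in> A \<Longrightarrow> openin (lr_topology G r) (U i)" "f \<in> Pi\<^sub>E A U" "Pi\<^sub>E A U \<subseteq> X"
      using op[unfolded openin_product_topology_alt, THEN bspec, OF f] by (elim exE conjE) auto
    define F where "F = {i \<in> A. U i \<noteq> topspace (lr_topology G r)}"
    have F: "finite F" "F \<subseteq> A" using U by (auto simp: F_def)
    have "\<exists>e>0. \<forall>h\<in>ell r (carrier G). ell_norm r (carrier G) (\<lambda>g. h g - f i g) < e \<longrightarrow> h \<in> U i"
      if i: "i \<in> F" for i
    proof -
      have "openin (lr_topology G r) (U i)" "f i \<in> U i" using i F U by auto
      then show ?thesis unfolding openin_lr_topology[OF r] by blast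
    qed
    then obtain e where e: "\<And>i. i \<in> F \<Longrightarrow> 0 < e i"
      "\<And>i h. i \<in> F \<Longrightarrow> h \<in> ell r (carrier G) \<Longrightarrow> ell_norm r (carrier G) (\<lambda>g. h g - f i g) < e i \<Longrightarrow> h \<in> U i"
      by metis
    \<comment> \<open>The element 1 keeps the minimum defined and positive when \<open>F\<close> is
      empty.\<close>
    define d where "d = Min (insert 1 (e ` F))"
    have d: "0 < d" "\<And>i. i \<in> F \<Longrightarrow> d \<le> e i" using F e(1) by (auto simp: d_def)
    have "f' \<in> X" if f': "f' \<in> ?P" "\<forall>i\<in>F. ell_norm r (carrier G) (\<lambda>g. f' i g - f i g) < d" for f'
    proof -
      have "f' i \<in> U i" if i: "i \<in> A" for i
      proof (cases "i \<in> F")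
        case True
        then show ?thesis using e(2)[OF True, of "f' i"] d(2)[OF True] f' i by force
      next
        case False
        then have "U i = ell r (carrier G)" using i topspace_lr_topology[OF r] by (simp add: F_def)
        then show ?thesis using f' i by auto
      qed
      then have "f' \<in> Pi\<^sub>E A U" using f'(1) by (auto simp: PiE_iff)
      then show ?thesis using U by auto
    qed
    then show "\<exists>F e. finite F \<and> F \<subseteq> A \<and> 0 < e \<and> (\<forall>f'\<in>?P.
      (\<forall>i\<in>F. ell_norm r (carrier G) (\<lambda>g. f' i g - f i g) < e) \<longrightarrow> f' \<in> X)"
      using F d(1) by blast
  qed
  with XP show "X \<subseteq> ?P \<and> ?R" by simp
next
  assume R: "X \<subseteq> ?P \<and> ?R"
  show ?l
    unfolding openin_product_topology_alt
  proof
    fix f assume f: "f \<in> X"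
    then obtain F e where F: "finite F" "F \<subseteq> A" "0 < e" "\<And>f'. f' \<in> ?P \<Longrightarrow>
      (\<forall>i\<in>F. ell_norm r (carrier G) (\<lambda>g. f' i g - f i g) < e) \<Longrightarrow> f' \<in> X" using R by meson
    have fP: "f \<in> ?P" using f R by blast
    define U where "U = (\<lambda>i. if i \<in> F then {h \<in> ell r (carrier G). ell_norm r (carrier G) (\<lambda>g. h g - f i g) < e}
      else ell r (carrier G))"
    have 1: "{i \<in> A. U i \<noteq> topspace (lr_topology G r)} \<subseteq> F"
      by (auto simp: U_def topspace_lr_topology[OF r])
    have 2: "openin (lr_topology G r) (U i)" if "i \<in> A" for i
    proof (cases "i \<in> F")
      case True
      have "f i \<in> ell r (carrier G)" using fP that by auto
      from openin_lr_ball[OF r this] show ?thesis using True by (simp add: U_def)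
    next
      case False
      then show ?thesis using openin_topspace[of "lr_topology G r"] by (simp add: U_def topspace_lr_topology[OF r])
    qed
    have 3: "f \<in> Pi\<^sub>E A U" using fP F(3) by (auto simp: PiE_iff U_def)
    have 4: "Pi\<^sub>E A U \<subseteq> X"
    proof
      fix f' assume f': "f' \<in> Pi\<^sub>E A U"
      have "f' \<in> ?P" using f' by (auto simp: PiE_iff U_def split: if_splits)
      moreover have "\<forall>i\<in>F. ell_norm r (carrier G) (\<lambda>g. f' i g - f i g) < e"
      proof
        fix i assume i: "i \<in> F"
        then have "f' i \<in> U i" using f' F(2) by auto
        then show "ell_norm r (carrier G) (\<lambda>g. f' i g - f i g) < e" using i by (simp add: U_def)
      qed
      ultimately show "f' \<in> X" by (rule F(4))
    qed
    show "\<exists>U. finite {i \<in> A. U i \<noteq> topspace (lr_topology G r)} \<and>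
      (\<forall>i\<in>A. openin (lr_topology G r) (U i)) \<and> f \<in> Pi\<^sub>E A U \<and> Pi\<^sub>E A U \<subseteq> X"
      using finite_subset[OF 1 F(1)] 2 3 4 by blast
  qed
qed

section \<open>Coordinates from a finite dual basis\<close>

text \<open>A finitely generated projective module in the form in which it is used. \<open>S\<close>
  generates \<open>M\<close> but need not be a basis; \<open>c\<close> is a linear section of the
  surjection from the free module on \<open>S\<close>.\<close>

locale dual_basis = group G + M: left_module "group_ring G" M
  for G :: "('g, 'm) monoid_scheme" (structure) and M :: "('g \<Rightarrow>\<^sub>0 int, 'a) module" +
  fixes S :: "'a set" and c :: "'a \<Rightarrow> 'a \<Rightarrow> 'g \<Rightarrow>\<^sub>0 int"
  assumes finite_S: "finite S" and S_carrier: "S \<subseteq> carrier M"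
    and c_lin: "s \<in> S \<Longrightarrow> c s \<in> linear_functionals (group_ring G) M"
    and expand: "m \<in> carrier M \<Longrightarrow> m = (\<Oplus>\<^bsub>M\<^esub>s\<in>S. c s m \<odot>\<^bsub>M\<^esub> s)"
begin

lemma gmodule: "1 < r \<Longrightarrow> gmodule G M r"
  by unfold_locales

lemma c_closed: "s \<in> S \<Longrightarrow> m \<in> carrier M \<Longrightarrow> c s m \<in> carrier (group_ring G)"
  by (rule M.functional_closed[OF c_lin])

lemma c_add: "s \<in> S \<Longrightarrow> m \<in> carrier M \<Longrightarrow> m' \<in> carrier M \<Longrightarrow> c s (m \<oplus>\<^bsub>M\<^esub> m') = c s m + c s m'"
  using c_lin[of s] by (simp add: linear_functionals_def)

lemma c_smult: "s \<in> S \<Longrightarrow> m \<in> carrier M \<Longrightarrow> a \<in> carrier (group_ring G) \<Longrightarrow>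
    c s (a \<odot>\<^bsub>M\<^esub> m) = a \<otimes>\<^bsub>group_ring G\<^esub> c s m"
  using c_lin[of s] by (simp add: linear_functionals_def)

text \<open>The coordinates of \<open>m \<otimes> f\<close>. Moving the coefficients of
  \<open>m = \<Sum>s. c s m \<odot> s\<close> across the tensor sign turns each \<open>c s m\<close>
  into its conjugate, acting on \<open>f\<close>.\<close>

definition coord :: "'a \<Rightarrow> ('g \<Rightarrow> complex) \<Rightarrow> 'a \<times> 'g \<Rightarrow> complex" where
  "coord m f = (\<lambda>(s, g). if s \<in> S then gact G (group_ring_conj G (c s m)) f g else 0)"

lemma conj_add: "group_ring_conj G (a + b) = group_ring_conj G a + group_ring_conj G b"
  by (simp add: group_ring_conj_def frag_extend_add)

lemma coord_add_left: "m \<in> carrier M \<Longrightarrow> m' \<in> carrier M \<Longrightarrow>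
    coord (m \<oplus>\<^bsub>M\<^esub> m') f = (\<lambda>i. coord m f i + coord m' f i)"
  by (auto simp: coord_def c_add conj_add gact_add_left fun_eq_iff)

lemma coord_add_right: "coord m (\<lambda>g. f g + f' g) = (\<lambda>i. coord m f i + coord m f' i)"
  by (auto simp: coord_def gact_add_right fun_eq_iff)

lemma coord_diff_right: "coord m (\<lambda>g. f g - f' g) = (\<lambda>i. coord m f i - coord m f' i)"
  by (auto simp: coord_def gact_diff_right fun_eq_iff)

lemma coord_scale: "coord m (\<lambda>g. k * f g) = (\<lambda>i. k * coord m f i)"
  by (auto simp: coord_def gact_scale fun_eq_iff)

text \<open>\<open>c s\<close> is linear, and conjugation reverses products and is an involution;
  this is compatibility with the balancing relation.\<close>

lemma coord_balanced:
  assumes "m \<in> carrier M" "a \<in> carrier (group_ring G)"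
  shows "coord (group_ring_conj G a \<odot>\<^bsub>M\<^esub> m) f = coord m (gact G a f)"
proof -
  have "gact G (group_ring_conj G (c s (group_ring_conj G a \<odot>\<^bsub>M\<^esub> m))) f
      = gact G (group_ring_conj G (c s m)) (gact G a f)" if s: "s \<in> S" for s
  proof -
    have cs: "c s (group_ring_conj G a \<odot>\<^bsub>M\<^esub> m) = group_ring_conj G a \<otimes>\<^bsub>group_ring G\<^esub> c s m"
      using assms s conj_closed by (simp add: c_smult)
    moreover have "c s (group_ring_conj G a \<odot>\<^bsub>M\<^esub> m) \<in> carrier (group_ring G)"
      using assms s conj_closed M.smult_closed by (intro c_closed) auto
    ultimately show ?thesis
      using gact_conj_mult[OF conj_closed[OF assms(2)] c_closed[OF s assms(1)], of f] conj_conj[OF assms(2)]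
      by simp
  qed
  then show ?thesis by (auto simp: coord_def fun_eq_iff)
qed

definition coord_bound :: "'a \<Rightarrow> real" where
  "coord_bound m = (\<Sum>s\<in>S. gact_bound (group_ring_conj G (c s m)))"

lemma coord_bound_nonneg: "0 \<le> coord_bound m"
  by (simp add: coord_bound_def sum_nonneg)

lemma coord_ell:
  assumes m: "m \<in> carrier M" and f: "f \<in> ell r (carrier G)" and r: "1 < r"
  shows "coord m f \<in> ell r (S \<times> carrier G)"
    and "ell_norm r (S \<times> carrier G) (coord m f) \<le> coord_bound m * ell_norm r (carrier G) f"
proof -
  have g: "gact G (group_ring_conj G (c s m)) f \<in> ell r (carrier G)"
    "ell_norm r (carrier G) (gact G (group_ring_conj G (c s m)) f)
      \<le> gact_bound (group_ring_conj G (c s m)) * ell_norm r (carrier G) f" if "s \<in> S" for s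
    using gact_ell[OF conj_closed[OF c_closed[OF that m]] f r] by auto
  show "coord m f \<in> ell r (S \<times> carrier G)"
    unfolding coord_def using g(1) by (intro ell_assemble finite_S r)
  have "ell_norm r (S \<times> carrier G) (coord m f)
      \<le> (\<Sum>s\<in>S. ell_norm r (carrier G) (gact G (group_ring_conj G (c s m)) f))"
    unfolding coord_def using g(1) by (intro ell_assemble finite_S r)
  also have "\<dots> \<le> coord_bound m * ell_norm r (carrier G) f"
    unfolding coord_bound_def sum_distrib_right using g(2) by (intro sum_mono)
  finally show "ell_norm r (S \<times> carrier G) (coord m f) \<le> coord_bound m * ell_norm r (carrier G) f" .
qed

definition coords :: "('a \<times> ('g \<Rightarrow> complex) \<Rightarrow>\<^sub>0 int) \<Rightarrow> 'a \<times> 'g \<Rightarrow> complex" where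
  "coords z = (\<lambda>i. frag_eval z (\<lambda>(m, f). coord m f i))"

lemma coords_simps:
  "coords 0 = (\<lambda>i. 0)" "coords (frag_of (m, f)) = coord m f"
  "coords (z + w) = (\<lambda>i. coords z i + coords w i)"
  "coords (z - w) = (\<lambda>i. coords z i - coords w i)"
  "coords (\<Sum>s\<in>A. y s) = (\<lambda>i. \<Sum>s\<in>A. coords (y s) i)"
  by (simp_all add: coords_def frag_eval_add frag_eval_diff frag_eval_sum)

lemma coords_uminus: "coords (- z) = (\<lambda>i. - coords z i)"
  using coords_simps(4)[of 0 z] by (simp add: coords_simps)

lemma coords_scale: "coords (tensor_lift id (\<lambda>f g. k * f g) z) = (\<lambda>i. k * coords z i)"
  unfolding coords_def tensor_lift_def frag_eval_extend
  by (simp add: case_prod_unfold coord_scale frag_eval_fun_scale)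

lemma coords_Rel:
  assumes "1 < r" "z \<in> tensor_relations G r M"
  shows "coords z = (\<lambda>i. 0)"
proof -
  interpret gm: gmodule G M r by (rule gmodule[OF assms(1)])
  show ?thesis using assms(2)
  proof (induction z rule: gm.Rel_induct)
    case (left x x' f)
    then show ?case by (simp add: coords_simps coord_add_left)
  next
    case (right x f f')
    then show ?case by (simp add: coords_simps coord_add_right)
  next
    case (balanced a x f)
    then show ?case by (simp add: coords_simps coord_balanced)
  qed (simp_all add: coords_simps coords_uminus)
qed

lemma coords_ell:
  assumes "Poly_Mapping.keys z \<subseteq> carrier M \<times> ell r (carrier G)" "1 < r"
  shows "coords z \<in> ell r (S \<times> carrier G)"
  using assms(1)
proof (induction z rule: free_Abelian_group_induct[consumes 1, case_names zero diff gen])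
  case (gen x)
  then show ?case using assms(2) by (cases x) (auto simp: coords_simps intro: coord_ell)
qed (use assms(2) in \<open>auto simp: coords_simps intro: ell_diff\<close>)

lemma coords_slice_ell:
  assumes "Poly_Mapping.keys z \<subseteq> carrier M \<times> ell r (carrier G)" "1 < r" "s \<in> S"
  shows "(\<lambda>g. coords z (s, g)) \<in> ell r (carrier G)"
  using ell_slice(1)[OF coords_ell[OF assms(1,2)] assms(3,2)] .

text \<open>Gives injectivity of the coordinates and a section of the map from families to tensors.
  On a generator the relation is the dual basis expansion followed by the balancing
  relation.\<close>

lemma reconstruct:
  assumes z: "Poly_Mapping.keys z \<subseteq> carrier M \<times> ell r (carrier G)" and r: "1 < r"
  shows "z - (\<Sum>s\<in>S. frag_of (s, \<lambda>g. coords z (s, g))) \<in> tensor_relations G r M"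
proof -
  interpret gm: gmodule G M r by (rule gmodule[OF r])
  show ?thesis
    using z
  proof (induction z rule: free_Abelian_group_induct[consumes 1, case_names zero diff gen])
    case zero
    have "(\<Sum>s\<in>S. frag_of (s, \<lambda>g. 0)) \<in> gm.Rel"
      using S_carrier by (intro gm.Rel_sum gm.Rel_zero_right) auto
    then show ?case using gm.Rel_uminus by (simp add: coords_simps)
  next
    case (diff x y)
    let ?s = "\<lambda>z s. frag_of (s, \<lambda>g. coords z (s, g))"
    have "(\<Sum>s\<in>S. frag_of (s, \<lambda>g. coords x (s, g) - coords y (s, g)) - (?s x s - ?s y s)) \<in> gm.Rel"
      using S_carrier diff coords_slice_ell[OF _ r] by (intro gm.Rel_sum gm.Rel_diff_right) auto
    moreover have "x - y - Z \<in> gm.Rel"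
      if h: "Z - (X - Y) \<in> gm.Rel" "x - X \<in> gm.Rel" "y - Y \<in> gm.Rel" for X Y Z
      using gm.Rel_diff[OF gm.Rel_diff[OF h(2,3)] h(1)] by simp
    ultimately show ?case
      using diff(3,4) by (simp only: coords_simps sum_subtractf)
  next
    case (gen mf)
    then obtain m f where mf: "mf = (m, f)" "m \<in> carrier M" "f \<in> ell r (carrier G)" by (cases mf) auto
    let ?a = "\<lambda>s. group_ring_conj G (c s m)"
    have co: "(\<lambda>g. coord m f (s, g)) = gact G (?a s) f" if "s \<in> S" for s
      using that by (simp add: coord_def)
    \<comment> \<open>First the expansion of \<open>m\<close> is distributed over the tensor sign;
      then each coefficient is moved to the right factor.\<close>
    have 1: "frag_of (\<Oplus>\<^bsub>M\<^esub>s\<in>S. c s m \<odot>\<^bsub>M\<^esub> s, f) - (\<Sum>s\<in>S. frag_of (c s m \<odot>\<^bsub>M\<^esub> s, f)) \<in> gm.Rel"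
      using S_carrier c_closed mf by (intro gm.Rel_finsum_left finite_S) (auto intro!: M.smult_closed)
    have 2: "(\<Sum>s\<in>S. frag_of (c s m \<odot>\<^bsub>M\<^esub> s, f) - frag_of (s, gact G (?a s) f)) \<in> gm.Rel"
    proof (rule gm.Rel_sum)
      fix s assume s: "s \<in> S"
      then have "s \<in> carrier M" using S_carrier by auto
      from gm.Rel_gens(3)[OF conj_closed[OF c_closed[OF s mf(2)]] this mf(3)]
      show "frag_of (c s m \<odot>\<^bsub>M\<^esub> s, f) - frag_of (s, gact G (?a s) f) \<in> gm.Rel"
        by (simp add: conj_conj c_closed s mf)
    qed
    have "(\<Sum>s\<in>S. frag_of (s, \<lambda>g. coord m f (s, g))) = (\<Sum>s\<in>S. frag_of (s, gact G (?a s) f))"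
      by (intro sum.cong refl) (simp add: co)
    then show ?case using gm.Rel_add[OF 1 2] expand[OF mf(2)]
      by (simp add: mf(1) coords_simps sum_subtractf)
  qed
qed

definition tensor_coords :: "('a \<times> ('g \<Rightarrow> complex) \<Rightarrow>\<^sub>0 int) set \<Rightarrow> 'a \<times> 'g \<Rightarrow> complex" where
  "tensor_coords A = coords (SOME z. z \<in> A)"

lemma tensor_coords_coset:
  assumes r: "1 < r"
  shows "tensor_coords (tensor_coset G r M z) = coords z"
proof -
  interpret gm: gmodule G M r by (rule gmodule[OF r])
  define w where "w = (SOME w. w \<in> gm.ten z)"
  have "z \<in> gm.ten z" by (simp add: gm.mem_ten_iff gm.Rel_zero)
  then have "w \<in> gm.ten z" unfolding w_def by (rule someI)
  then have "w - z \<in> gm.Rel" by (simp add: gm.mem_ten_iff)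
  then have "coords (w - z) = (\<lambda>i. 0)" by (rule coords_Rel[OF r])
  then have "coords w = coords z" by (simp add: coords_simps fun_eq_iff)
  then show ?thesis by (simp add: tensor_coords_def w_def)
qed

lemma coords_eq_imp_coset_eq:
  assumes r: "1 < r" and z: "Poly_Mapping.keys z \<subseteq> carrier M \<times> ell r (carrier G)"
    and w: "Poly_Mapping.keys w \<subseteq> carrier M \<times> ell r (carrier G)" and eq: "coords z = coords w"
  shows "tensor_coset G r M z = tensor_coset G r M w"
proof -
  interpret gm: gmodule G M r by (rule gmodule[OF r])
  show ?thesis
    using gm.Rel_diff[OF reconstruct[OF z r] reconstruct[OF w r]] eq by (simp add: gm.ten_eq_iff)
qed

lemma keys_sum_frag_of:
  assumes "\<And>s. s \<in> A \<Longrightarrow> s \<in> X \<and> f s \<in> L"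
  shows "Poly_Mapping.keys (\<Sum>s\<in>A. frag_of (s, f s)) \<subseteq> X \<times> L"
proof -
  have "(\<Sum>s\<in>A. frag_of (s, f s)) \<in> carrier (free_Abelian_group (X \<times> L))"
    using assms by (intro sum_closed_free_Abelian_group) auto
  then show ?thesis by simp
qed

text \<open>Every map from families over a finite set is Lipschitz in coordinates, so norm-open sets
  are open; for \<open>S\<close> itself the coordinates provide a continuous section, which gives
  the converse.\<close>

lemma openin_tensor_coords:
  assumes r: "1 < r"
  shows "openin (topo (lr_tensor G r M)) U \<longleftrightarrow> U \<subseteq> carrier (lr_tensor G r M) \<and>
    (\<forall>A\<in>U. \<exists>e>0. \<forall>B\<in>carrier (lr_tensor G r M).
      ell_norm r (S \<times> carrier G) (\<lambda>i. tensor_coords B i - tensor_coords A i) < e \<longrightarrow> B \<in> U)"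
    (is "_ \<longleftrightarrow> _ \<and> ?R")
proof -
  interpret gm: gmodule G M r by (rule gmodule[OF r])
  let ?P = "\<lambda>S. \<Pi>\<^sub>E s\<in>S. ell r (carrier G)"
  let ?\<Phi> = "\<lambda>S f. gm.ten (\<Sum>s\<in>S. frag_of (s, f s))"
  have ts: "topspace (product_topology (\<lambda>_. lr_topology G r) A) = ?P A" for A :: "'a set"
    by (simp add: topspace_lr_topology[OF r])
  have keys: "Poly_Mapping.keys (\<Sum>s\<in>A. frag_of (s, f s)) \<subseteq> carrier M \<times> ell r (carrier G)"
    if "A \<subseteq> carrier M" "f \<in> ?P A" for f A
    using that by (intro keys_sum_frag_of) auto
  have "?R \<longleftrightarrow> (\<forall>A. finite A \<and> A \<subseteq> carrier M \<longrightarrow>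
      openin (product_topology (\<lambda>_. lr_topology G r) A) {f \<in> ?P A. ?\<Phi> A f \<in> U})"
    if U: "U \<subseteq> carrier (lr_tensor G r M)"
  proof
    assume R: ?R
    show "\<forall>A. finite A \<and> A \<subseteq> carrier M \<longrightarrow>
      openin (product_topology (\<lambda>_. lr_topology G r) A) {f \<in> ?P A. ?\<Phi> A f \<in> U}"
    proof (intro allI impI; elim conjE)
      fix A assume A: "finite A" "A \<subseteq> carrier M"
      show "openin (product_topology (\<lambda>_. lr_topology G r) A) {f \<in> ?P A. ?\<Phi> A f \<in> U}"
        unfolding openin_lr_product[OF r]
      proof (intro conjI ballI)
        fix f assume "f \<in> {f \<in> ?P A. ?\<Phi> A f \<in> U}"
        then have f: "f \<in> ?P A" "?\<Phi> A f \<in> U" by auto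
        obtain e where e: "0 < e" "\<And>B. B \<in> carrier (lr_tensor G r M) \<Longrightarrow>
            ell_norm r (S \<times> carrier G) (\<lambda>i. tensor_coords B i - tensor_coords (?\<Phi> A f) i) < e \<Longrightarrow> B \<in> U"
          using R f(2) by meson
        \<comment> \<open>A Lipschitz constant for the map given by \<open>A\<close>; the radius
          \<open>e / (D + 1)\<close> makes sense also for \<open>D = 0\<close>.\<close>
        define D where "D = (\<Sum>a\<in>A. coord_bound a)"
        have D: "0 \<le> D" by (simp add: D_def sum_nonneg coord_bound_nonneg)
        have "?\<Phi> A f' \<in> U" if f': "f' \<in> ?P A"
          "\<forall>a\<in>A. ell_norm r (carrier G) (\<lambda>g. f' a g - f a g) < e / (D + 1)" for f'
        proof (rule e(2))
          show "?\<Phi> A f' \<in> carrier (lr_tensor G r M)"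
            using keys[OF A(2) f'(1)] by (auto simp: gm.carrier_lr_tensor)
          have d: "(\<lambda>g. f' a g - f a g) \<in> ell r (carrier G)" if "a \<in> A" for a
            using f f' that r by (intro ell_diff) auto
          have "(\<lambda>i. tensor_coords (?\<Phi> A f') i - tensor_coords (?\<Phi> A f) i)
              = (\<lambda>i. \<Sum>a\<in>A. coord a (\<lambda>g. f' a g - f a g) i)"
            by (simp add: tensor_coords_coset[OF r] coords_simps coord_diff_right sum_subtractf)
          then have "ell_norm r (S \<times> carrier G) (\<lambda>i. tensor_coords (?\<Phi> A f') i - tensor_coords (?\<Phi> A f) i)
              = ell_norm r (S \<times> carrier G) (\<lambda>i. \<Sum>a\<in>A. coord a (\<lambda>g. f' a g - f a g) i)" by simp
          also have "\<dots> \<le> (\<Sum>a\<in>A. ell_norm r (S \<times> carrier G) (coord a (\<lambda>g. f' a g - f a g)))"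
            using d A r by (intro ell_sum coord_ell) auto
          also have "\<dots> \<le> (\<Sum>a\<in>A. coord_bound a * (e / (D + 1)))"
          proof (rule sum_mono)
            fix a assume a: "a \<in> A"
            have "ell_norm r (S \<times> carrier G) (coord a (\<lambda>g. f' a g - f a g))
                \<le> coord_bound a * ell_norm r (carrier G) (\<lambda>g. f' a g - f a g)"
              using d A a r by (intro coord_ell) auto
            also have "\<dots> \<le> coord_bound a * (e / (D + 1))"
              using f'(2) a coord_bound_nonneg by (intro mult_left_mono) (auto intro: less_imp_le)
            finally show "ell_norm r (S \<times> carrier G) (coord a (\<lambda>g. f' a g - f a g)) \<le> coord_bound a * (e / (D + 1))" .
          qed
          also have "\<dots> = D * (e / (D + 1))" by (simp only: D_def sum_distrib_right)
          also have "\<dots> < (D + 1) * (e / (D + 1))"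
            using e D by (intro mult_strict_right_mono divide_pos_pos) auto
          also have "\<dots> = e" using D by simp
          finally show "ell_norm r (S \<times> carrier G) (\<lambda>i. tensor_coords (?\<Phi> A f') i - tensor_coords (?\<Phi> A f) i) < e" .
        qed
        moreover have "0 < e / (D + 1)" using e D by simp
        ultimately show "\<exists>F e. finite F \<and> F \<subseteq> A \<and> 0 < e \<and> (\<forall>f'\<in>?P A.
          (\<forall>i\<in>F. ell_norm r (carrier G) (\<lambda>g. f' i g - f i g) < e) \<longrightarrow> f' \<in> {f \<in> ?P A. ?\<Phi> A f \<in> U})"
          using A(1) by (intro exI[of _ A] exI[of _ "e / (D + 1)"]) simp
      qed auto
    qed
  next
    assume op: "\<forall>A. finite A \<and> A \<subseteq> carrier M \<longrightarrow>
      openin (product_topology (\<lambda>_. lr_topology G r) A) {f \<in> ?P A. ?\<Phi> A f \<in> U}"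
    show ?R
    proof
      fix A assume AU: "A \<in> U"
      \<comment> \<open>The section: the coordinates as a family over \<open>S\<close>. It maps back
        to \<open>B\<close>, and differences of slices are bounded by the norm.\<close>
      define slice where "slice = (\<lambda>B. \<lambda>s\<in>S. \<lambda>g. tensor_coords B (s, g))"
      have slice: "slice B \<in> ?P S" "?\<Phi> S (slice B) = B" if B: "B \<in> carrier (lr_tensor G r M)" for B
      proof -
        obtain z where z: "B = gm.ten z" "Poly_Mapping.keys z \<subseteq> carrier M \<times> ell r (carrier G)"
          using B by (auto simp: gm.carrier_lr_tensor)
        show "slice B \<in> ?P S"
          using coords_slice_ell[OF z(2) r] by (auto simp: slice_def z(1) tensor_coords_coset[OF r])
        have "(\<Sum>s\<in>S. frag_of (s, slice B s)) = (\<Sum>s\<in>S. frag_of (s, \<lambda>g. coords z (s, g)))"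
          by (intro sum.cong refl) (simp add: slice_def z(1) tensor_coords_coset[OF r])
        then show "?\<Phi> S (slice B) = B"
          using gm.Rel_uminus[OF reconstruct[OF z(2) r]] by (simp add: z(1) gm.ten_eq_iff)
      qed
      have AT: "A \<in> carrier (lr_tensor G r M)" using AU U by auto
      have opS: "openin (product_topology (\<lambda>_. lr_topology G r) S) {f \<in> ?P S. ?\<Phi> S f \<in> U}"
        using op finite_S S_carrier by blast
      have "slice A \<in> {f \<in> ?P S. ?\<Phi> S f \<in> U}" using slice[OF AT] AU by simp
      then have "\<exists>F e. finite F \<and> F \<subseteq> S \<and> 0 < e \<and> (\<forall>f'\<in>?P S.
        (\<forall>i\<in>F. ell_norm r (carrier G) (\<lambda>g. f' i g - slice A i g) < e) \<longrightarrow> f' \<in> {f \<in> ?P S. ?\<Phi> S f \<in> U})"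
        by (rule bspec[OF conjunct2[OF iffD1[OF openin_lr_product[OF r] opS]]])
      then obtain F e where F: "F \<subseteq> S" "0 < e" "\<forall>f'\<in>?P S.
        (\<forall>i\<in>F. ell_norm r (carrier G) (\<lambda>g. f' i g - slice A i g) < e) \<longrightarrow> f' \<in> {f \<in> ?P S. ?\<Phi> S f \<in> U}"
        by (elim exE conjE)
      have "B \<in> U" if B: "B \<in> carrier (lr_tensor G r M)"
        "ell_norm r (S \<times> carrier G) (\<lambda>i. tensor_coords B i - tensor_coords A i) < e" for B
      proof -
        have JB: "tensor_coords B \<in> ell r (S \<times> carrier G)" "tensor_coords A \<in> ell r (S \<times> carrier G)"
          using B(1) AT coords_ell[OF _ r] by (auto simp: gm.carrier_lr_tensor tensor_coords_coset[OF r])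
        have "ell_norm r (carrier G) (\<lambda>g. slice B i g - slice A i g) < e" if i: "i \<in> F" for i
        proof -
          have iS: "i \<in> S" using i F by auto
          have "ell_norm r (carrier G) (\<lambda>g. slice B i g - slice A i g)
              = ell_norm r (carrier G) (\<lambda>g. tensor_coords B (i, g) - tensor_coords A (i, g))"
            using iS by (simp add: slice_def)
          also have "\<dots> \<le> ell_norm r (S \<times> carrier G) (\<lambda>i. tensor_coords B i - tensor_coords A i)"
            by (rule ell_slice(2)[OF ell_diff[OF JB r] iS r])
          finally show ?thesis using B(2) by simp
        qed
        then have "slice B \<in> {f \<in> ?P S. ?\<Phi> S f \<in> U}" using F(3) slice(1)[OF B(1)] by blast
        then show ?thesis using slice(2)[OF B(1)] by simp
      qed
      then show "\<exists>e>0. \<forall>B\<in>carrier (lr_tensor G r M).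
        ell_norm r (S \<times> carrier G) (\<lambda>i. tensor_coords B i - tensor_coords A i) < e \<longrightarrow> B \<in> U"
        using F(2) by blast
    qed
  qed
  then show ?thesis unfolding gm.openin_lr_tensor ts by (intro conj_cong refl) simp
qed

lemma ell_ctvs_tensor:
  assumes r: "1 < r"
  shows "ell_ctvs (lr_tensor G r M) tensor_coords r (S \<times> carrier G)"
proof -
  interpret gm: gmodule G M r by (rule gmodule[OF r])
  show ?thesis
  proof
    fix A assume "A \<in> carrier (lr_tensor G r M)"
    then obtain z where z: "A = gm.ten z" "Poly_Mapping.keys z \<subseteq> carrier M \<times> ell r (carrier G)"
      by (auto simp: gm.carrier_lr_tensor)
    show "tensor_coords A \<in> ell r (S \<times> carrier G)"
      using coords_ell[OF z(2) r] by (simp add: z(1) tensor_coords_coset[OF r])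
    show "k \<odot>\<^bsub>lr_tensor G r M\<^esub> A \<in> carrier (lr_tensor G r M)" for k
      using gm.keys_scale[OF z(2)] by (auto simp: z(1) gm.smult_lr_tensor gm.carrier_lr_tensor)
    show "tensor_coords (k \<odot>\<^bsub>lr_tensor G r M\<^esub> A) = (\<lambda>i. k * tensor_coords A i)" for k
      by (simp add: z(1) gm.smult_lr_tensor tensor_coords_coset[OF r] coords_scale)
    fix B assume "B \<in> carrier (lr_tensor G r M)"
    then obtain w where w: "B = gm.ten w" "Poly_Mapping.keys w \<subseteq> carrier M \<times> ell r (carrier G)"
      by (auto simp: gm.carrier_lr_tensor)
    show "A \<oplus>\<^bsub>lr_tensor G r M\<^esub> B \<in> carrier (lr_tensor G r M)"
      using keys_add[of z w] z w by (auto simp: gm.add_lr_tensor gm.carrier_lr_tensor)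
    show "tensor_coords (A \<oplus>\<^bsub>lr_tensor G r M\<^esub> B) = (\<lambda>i. tensor_coords A i + tensor_coords B i)"
      by (simp add: z(1) w(1) gm.add_lr_tensor tensor_coords_coset[OF r] coords_simps)
  next
    show "inj_on tensor_coords (carrier (lr_tensor G r M))"
    proof (rule inj_onI)
      fix A B assume "A \<in> carrier (lr_tensor G r M)" "B \<in> carrier (lr_tensor G r M)"
      then obtain z w where "A = gm.ten z" "Poly_Mapping.keys z \<subseteq> carrier M \<times> ell r (carrier G)"
        "B = gm.ten w" "Poly_Mapping.keys w \<subseteq> carrier M \<times> ell r (carrier G)"
        unfolding gm.carrier_lr_tensor by blast
      moreover assume "tensor_coords A = tensor_coords B"
      ultimately show "A = B"
        using coords_eq_imp_coset_eq[OF r, of z w] by (simp add: tensor_coords_coset[OF r])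
    qed
    show "\<zero>\<^bsub>lr_tensor G r M\<^esub> \<in> carrier (lr_tensor G r M)"
      unfolding gm.zero_lr_tensor gm.carrier_lr_tensor by (rule imageI) simp
    show "tensor_coords \<zero>\<^bsub>lr_tensor G r M\<^esub> = (\<lambda>i. 0)"
      by (simp add: gm.zero_lr_tensor tensor_coords_coset[OF r] coords_simps)
  qed (rule r openin_tensor_coords[OF r])+
qed

end

section \<open>Module maps into \<open>\<ell>\<^sup>r(G)\<close>\<close>

lemma lr_hom_simps [simp]:
  "carrier (lr_hom G r M) = module_maps (carrier (group_ring G)) M (lr_module G r) \<inter> extensional (carrier M)"
  "\<zero>\<^bsub>lr_hom G r M\<^esub> = (\<lambda>x\<in>carrier M. \<lambda>g. 0)"
  "\<phi> \<oplus>\<^bsub>lr_hom G r M\<^esub> \<psi> = (\<lambda>x\<in>carrier M. \<lambda>g. \<phi> x g + \<psi> x g)"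
  "k \<odot>\<^bsub>lr_hom G r M\<^esub> \<phi> = (\<lambda>x\<in>carrier M. \<lambda>g. k * \<phi> x g)"
  by (simp_all add: lr_hom_def Let_def)

lemma topo_lr_hom: "topo (lr_hom G r M) =
    subtopology (product_topology (\<lambda>_. lr_topology G r) (carrier M)) (carrier (lr_hom G r M))"
  by (simp add: lr_hom_def Let_def)

lemma lr_homD:
  assumes "\<phi> \<in> carrier (lr_hom G r M)"
  shows "m \<in> carrier M \<Longrightarrow> \<phi> m \<in> ell r (carrier G)"
    and "m \<in> carrier M \<Longrightarrow> m' \<in> carrier M \<Longrightarrow> \<phi> (m \<oplus>\<^bsub>M\<^esub> m') = (\<lambda>g. \<phi> m g + \<phi> m' g)"
    and "a \<in> carrier (group_ring G) \<Longrightarrow> m \<in> carrier M \<Longrightarrow> \<phi> (a \<odot>\<^bsub>M\<^esub> m) = gact G a (\<phi> m)"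
    and "\<phi> \<in> extensional (carrier M)"
  using assms by (auto simp: module_maps_def)

lemma lr_homI:
  assumes "\<And>m. m \<in> carrier M \<Longrightarrow> \<phi> m \<in> ell r (carrier G)"
    and "\<And>m m'. m \<in> carrier M \<Longrightarrow> m' \<in> carrier M \<Longrightarrow> \<phi> (m \<oplus>\<^bsub>M\<^esub> m') = (\<lambda>g. \<phi> m g + \<phi> m' g)"
    and "\<And>a m. a \<in> carrier (group_ring G) \<Longrightarrow> m \<in> carrier M \<Longrightarrow> \<phi> (a \<odot>\<^bsub>M\<^esub> m) = gact G a (\<phi> m)"
    and "\<phi> \<in> extensional (carrier M)"
  shows "\<phi> \<in> carrier (lr_hom G r M)"
  using assms by (auto simp: module_maps_def)

context gmodule
begin

lemma lr_hom_zero_arg: "\<phi> \<in> carrier (lr_hom G r M) \<Longrightarrow> \<phi> \<zero>\<^bsub>M\<^esub> = (\<lambda>g. 0)"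
proof -
  assume \<phi>: "\<phi> \<in> carrier (lr_hom G r M)"
  have "\<phi> (\<zero>\<^bsub>M\<^esub> \<oplus>\<^bsub>M\<^esub> \<zero>\<^bsub>M\<^esub>) = (\<lambda>g. \<phi> \<zero>\<^bsub>M\<^esub> g + \<phi> \<zero>\<^bsub>M\<^esub> g)" by (intro lr_homD(2)[OF \<phi>]) auto
  then have "\<phi> \<zero>\<^bsub>M\<^esub> = (\<lambda>g. \<phi> \<zero>\<^bsub>M\<^esub> g + \<phi> \<zero>\<^bsub>M\<^esub> g)" by simp
  then show ?thesis by (metis (no_types, lifting) add_cancel_right_right ext)
qed

lemma lr_hom_finsum:
  assumes \<phi>: "\<phi> \<in> carrier (lr_hom G r M)" and "finite A" "x \<in> A \<rightarrow> carrier M"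
  shows "\<phi> (\<Oplus>\<^bsub>M\<^esub>s\<in>A. x s) = (\<lambda>g. \<Sum>s\<in>A. \<phi> (x s) g)"
  using assms(2,3)
proof (induction A rule: finite_induct)
  case empty
  then show ?case by (simp add: lr_hom_zero_arg[OF \<phi>])
next
  case (insert s A)
  have "(\<Oplus>\<^bsub>M\<^esub>s\<in>insert s A. x s) = x s \<oplus>\<^bsub>M\<^esub> (\<Oplus>\<^bsub>M\<^esub>s\<in>A. x s)"
    using insert by (intro M.finsum_insert) auto
  moreover have "x s \<in> carrier M" "(\<Oplus>\<^bsub>M\<^esub>s\<in>A. x s) \<in> carrier M" using insert by (auto intro!: M.finsum_closed)
  ultimately show ?case using insert lr_homD(2)[OF \<phi>] by simp
qed

lemma lr_hom_closed:
  shows "(\<lambda>x\<in>carrier M. \<lambda>g. 0) \<in> carrier (lr_hom G r M)"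
    and "\<phi> \<in> carrier (lr_hom G r M) \<Longrightarrow> \<psi> \<in> carrier (lr_hom G r M) \<Longrightarrow>
      (\<lambda>x\<in>carrier M. \<lambda>g. \<phi> x g + \<psi> x g) \<in> carrier (lr_hom G r M)"
    and "\<phi> \<in> carrier (lr_hom G r M) \<Longrightarrow> (\<lambda>x\<in>carrier M. \<lambda>g. k * \<phi> x g) \<in> carrier (lr_hom G r M)"
proof -
  show "(\<lambda>x\<in>carrier M. \<lambda>g. 0) \<in> carrier (lr_hom G r M)"
    by (rule lr_homI) (auto simp: M.smult_closed)
  show "(\<lambda>x\<in>carrier M. \<lambda>g. \<phi> x g + \<psi> x g) \<in> carrier (lr_hom G r M)"
    if \<phi>: "\<phi> \<in> carrier (lr_hom G r M)" and \<psi>: "\<psi> \<in> carrier (lr_hom G r M)"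
    by (rule lr_homI)
      (simp_all add: M.smult_closed lr_homD[OF \<phi>] lr_homD[OF \<psi>] ell_add r1 gact_add_right fun_eq_iff)
  show "(\<lambda>x\<in>carrier M. \<lambda>g. k * \<phi> x g) \<in> carrier (lr_hom G r M)"
    if \<phi>: "\<phi> \<in> carrier (lr_hom G r M)"
    by (rule lr_homI)
      (simp_all add: M.smult_closed lr_homD[OF \<phi>] ell_scale gact_scale distrib_left fun_eq_iff)
qed

end

context dual_basis
begin

text \<open>\<open>\<phi>\<close> is applied to the dual basis expansion of \<open>m\<close>. This
  is why the values on \<open>S\<close> can serve as coordinates.\<close>

lemma lr_hom_expand:
  assumes r: "1 < r" and \<phi>: "\<phi> \<in> carrier (lr_hom G r M)" and m: "m \<in> carrier M"
  shows "\<phi> m = (\<lambda>g. \<Sum>s\<in>S. gact G (c s m) (\<phi> s) g)"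
proof -
  interpret gm: gmodule G M r by (rule gmodule[OF r])
  have "\<phi> m = \<phi> (\<Oplus>\<^bsub>M\<^esub>s\<in>S. c s m \<odot>\<^bsub>M\<^esub> s)" using expand[OF m] by simp
  also have "\<dots> = (\<lambda>g. \<Sum>s\<in>S. \<phi> (c s m \<odot>\<^bsub>M\<^esub> s) g)"
    using S_carrier c_closed m by (intro gm.lr_hom_finsum[OF \<phi>] finite_S) (auto intro!: M.smult_closed)
  also have "\<dots> = (\<lambda>g. \<Sum>s\<in>S. gact G (c s m) (\<phi> s) g)"
    using S_carrier c_closed m lr_homD(3)[OF \<phi>] by (intro ext sum.cong refl) (auto simp: subset_iff)
  finally show ?thesis .
qed

definition hom_coords :: "('a \<Rightarrow> 'g \<Rightarrow> complex) \<Rightarrow> 'a \<times> 'g \<Rightarrow> complex" where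
  "hom_coords \<phi> = (\<lambda>(s, g). if s \<in> S then \<phi> s g else 0)"

text \<open>The homomorphism assembled from a family \<open>y\<close>. As \<open>S\<close> need not
  be a basis, its value at \<open>s\<close> may differ from the \<open>s\<close>-th member of
  \<open>y\<close>: on families, \<open>hom_coords\<close> after \<open>combination\<close> is a
  projection onto the coordinates of homomorphisms.\<close>

definition combination :: "('a \<times> 'g \<Rightarrow> complex) \<Rightarrow> 'a \<Rightarrow> 'g \<Rightarrow> complex" where
  "combination y m = (\<lambda>g. \<Sum>s\<in>S. gact G (c s m) (\<lambda>g. y (s, g)) g)"

lemma combination_hom_coords:
  "1 < r \<Longrightarrow> \<phi> \<in> carrier (lr_hom G r M) \<Longrightarrow> m \<in> carrier M \<Longrightarrow> combination (hom_coords \<phi>) m = \<phi> m"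
  by (simp add: combination_def hom_coords_def lr_hom_expand[symmetric])

lemma hom_coords_ell:
  assumes "1 < r" "\<And>m. m \<in> carrier M \<Longrightarrow> \<phi> m \<in> ell r (carrier G)"
  shows "hom_coords \<phi> \<in> ell r (S \<times> carrier G)"
    and "ell_norm r (S \<times> carrier G) (hom_coords \<phi>) \<le> (\<Sum>s\<in>S. ell_norm r (carrier G) (\<phi> s))"
proof -
  have \<phi>: "\<phi> s \<in> ell r (carrier G)" if "s \<in> S" for s
    using that S_carrier by (intro assms(2)) auto
  show "hom_coords \<phi> \<in> ell r (S \<times> carrier G)"
    "ell_norm r (S \<times> carrier G) (hom_coords \<phi>) \<le> (\<Sum>s\<in>S. ell_norm r (carrier G) (\<phi> s))"
    unfolding hom_coords_def using ell_assemble[OF finite_S \<phi> assms(1)] by auto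
qed

definition combination_bound :: "'a \<Rightarrow> real" where
  "combination_bound m = (\<Sum>s\<in>S. gact_bound (c s m))"

lemma combination_bound_nonneg: "0 \<le> combination_bound m"
  by (simp add: combination_bound_def sum_nonneg)

lemma combination_ell:
  assumes r: "1 < r" and y: "\<And>s. s \<in> S \<Longrightarrow> (\<lambda>g. y (s, g)) \<in> ell r (carrier G)" and m: "m \<in> carrier M"
  shows "combination y m \<in> ell r (carrier G)"
    and "(\<And>s. s \<in> S \<Longrightarrow> ell_norm r (carrier G) (\<lambda>g. y (s, g)) \<le> N) \<Longrightarrow>
      ell_norm r (carrier G) (combination y m) \<le> combination_bound m * N"
proof -
  have g: "gact G (c s m) (\<lambda>g. y (s, g)) \<in> ell r (carrier G)"
    "ell_norm r (carrier G) (gact G (c s m) (\<lambda>g. y (s, g)))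
      \<le> gact_bound (c s m) * ell_norm r (carrier G) (\<lambda>g. y (s, g))" if "s \<in> S" for s
    using gact_ell[OF c_closed[OF that m] y[OF that] r] by auto
  show "combination y m \<in> ell r (carrier G)"
    unfolding combination_def using g r by (intro ell_sum)
  assume N: "\<And>s. s \<in> S \<Longrightarrow> ell_norm r (carrier G) (\<lambda>g. y (s, g)) \<le> N"
  have "ell_norm r (carrier G) (combination y m)
      \<le> (\<Sum>s\<in>S. ell_norm r (carrier G) (gact G (c s m) (\<lambda>g. y (s, g))))"
    unfolding combination_def using g r by (intro ell_sum)
  also have "\<dots> \<le> (\<Sum>s\<in>S. gact_bound (c s m) * N)"
  proof (rule sum_mono)
    fix s assume s: "s \<in> S"
    show "ell_norm r (carrier G) (gact G (c s m) (\<lambda>g. y (s, g))) \<le> gact_bound (c s m) * N"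
      using g(2)[OF s] mult_left_mono[OF N[OF s] gact_bound_nonneg] by (rule order_trans)
  qed
  also have "\<dots> = combination_bound m * N" by (simp add: combination_bound_def sum_distrib_right)
  finally show "ell_norm r (carrier G) (combination y m) \<le> combination_bound m * N" .
qed

lemma combination_lr_hom:
  assumes r: "1 < r" and y: "y \<in> ell r (S \<times> carrier G)"
  shows "restrict (combination y) (carrier M) \<in> carrier (lr_hom G r M)"
proof (rule lr_homI)
  have y': "(\<lambda>g. y (s, g)) \<in> ell r (carrier G)" if "s \<in> S" for s using ell_slice(1)[OF y that r] .
  fix m assume m: "m \<in> carrier M"
  show "restrict (combination y) (carrier M) m \<in> ell r (carrier G)"
    using combination_ell(1)[OF r y' m] m by simp
  show "restrict (combination y) (carrier M) (m \<oplus>\<^bsub>M\<^esub> m')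
      = (\<lambda>g. restrict (combination y) (carrier M) m g + restrict (combination y) (carrier M) m' g)"
    if "m' \<in> carrier M" for m'
    using m that by (simp add: combination_def c_add gact_add_left sum.distrib)
  show "restrict (combination y) (carrier M) (a \<odot>\<^bsub>M\<^esub> m) = gact G a (restrict (combination y) (carrier M) m)"
    if a: "a \<in> carrier (group_ring G)" for a
  proof -
    have "combination y (a \<odot>\<^bsub>M\<^esub> m) = (\<lambda>g. \<Sum>s\<in>S. gact G a (gact G (c s m) (\<lambda>g. y (s, g))) g)"
      unfolding combination_def using a m
      by (intro ext sum.cong refl) (simp add: c_smult gact_mult c_closed)
    also have "\<dots> = gact G a (combination y m)" by (simp add: combination_def gact_sum_right)
    finally show ?thesis using m a by (simp add: M.smult_closed)
  qed
qed simp

section \<open>The pairing of homomorphisms with tensors\<close>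

text \<open>Slice by slice, \<open>pair_gact\<close> carries the conjugate of \<open>c s m\<close>
  to the other factor, where it becomes \<open>c s m\<close>; so \<open>combination\<close> is
  adjoint to \<open>coord\<close>.\<close>

lemma pair_coord:
  assumes exps: "conjugate_exponents p q" and y: "y \<in> ell p (S \<times> carrier G)"
    and m: "m \<in> carrier M" and f: "f \<in> ell q (carrier G)"
  shows "ell_pair (S \<times> carrier G) y (coord m f) = ell_pair (carrier G) (combination y m) f"
proof -
  interpret conjugate_exponents p q by (rule exps)
  interpret sw: conjugate_exponents q p by (rule swap)
  have y': "(\<lambda>g. y (s, g)) \<in> ell p (carrier G)" if "s \<in> S" for s using ell_slice(1)[OF y that p1] .
  have "ell_pair (S \<times> carrier G) y (coord m f)
      = (\<Sum>s\<in>S. ell_pair (carrier G) (\<lambda>g. y (s, g)) (\<lambda>g. coord m f (s, g)))"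
    by (rule ell_pair_slices[OF finite_S y coord_ell(1)[OF m f q1]])
  also have "\<dots> = (\<Sum>s\<in>S. ell_pair (carrier G) f (gact G (c s m) (\<lambda>g. y (s, g))))"
  proof (intro sum.cong refl)
    fix s assume s: "s \<in> S"
    then have "(\<lambda>g. coord m f (s, g)) = gact G (group_ring_conj G (c s m)) f" by (simp add: coord_def)
    then show "ell_pair (carrier G) (\<lambda>g. y (s, g)) (\<lambda>g. coord m f (s, g))
        = ell_pair (carrier G) f (gact G (c s m) (\<lambda>g. y (s, g)))"
      using pair_gact[OF exps c_closed[OF s m] y'[OF s] f] by (simp add: ell_pair_commute[of _ f])
  qed
  also have "\<dots> = ell_pair (carrier G) f (combination y m)"
    unfolding combination_def using gact_ell(1)[OF c_closed[OF _ m] y' p1] by (intro sw.pair_sum_right[symmetric] f)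
  finally show ?thesis by (simp add: ell_pair_commute)
qed

lemma pair_coords:
  assumes exps: "conjugate_exponents p q" and y: "y \<in> ell p (S \<times> carrier G)"
    and z: "Poly_Mapping.keys z \<subseteq> carrier M \<times> ell q (carrier G)"
  shows "ell_pair (S \<times> carrier G) y (coords z) = frag_eval z (\<lambda>(m, f). ell_pair (carrier G) (combination y m) f)"
proof -
  interpret conjugate_exponents p q by (rule exps)
  show ?thesis
    using z
  proof (induction z rule: free_Abelian_group_induct[consumes 1, case_names zero diff gen])
    case zero
    then show ?case by (simp add: coords_simps)
  next
    case (diff z w)
    then show ?case
      using pair_diff_right[OF y coords_ell[OF diff(1) q1] coords_ell[OF diff(2) q1]]
      by (simp add: coords_simps frag_eval_diff)
  next
    case (gen x)
    then show ?case by (cases x) (simp add: coords_simps pair_coord[OF exps y])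
  qed
qed

text \<open>The value at any \<open>m\<close> is controlled by the values on \<open>S\<close>;
  conversely, nearness at the finitely many points of \<open>S\<close> bounds the norm.\<close>

lemma openin_hom_coords:
  assumes r: "1 < r"
  shows "openin (topo (lr_hom G r M)) U \<longleftrightarrow> U \<subseteq> carrier (lr_hom G r M) \<and>
    (\<forall>\<phi>\<in>U. \<exists>e>0. \<forall>\<psi>\<in>carrier (lr_hom G r M).
      ell_norm r (S \<times> carrier G) (\<lambda>i. hom_coords \<psi> i - hom_coords \<phi> i) < e \<longrightarrow> \<psi> \<in> U)"
    (is "_ \<longleftrightarrow> _ \<and> ?R")
proof -
  interpret gm: gmodule G M r by (rule gmodule[OF r])
  let ?H = "carrier (lr_hom G r M)"
  let ?P = "\<Pi>\<^sub>E m\<in>carrier M. ell r (carrier G)"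
  let ?T = "product_topology (\<lambda>_. lr_topology G r) (carrier M)"
  have HP: "?H \<subseteq> ?P"
  proof
    fix \<phi> assume \<phi>: "\<phi> \<in> ?H"
    then show "\<phi> \<in> ?P" using lr_homD(1)[OF \<phi>] lr_homD(4)[OF \<phi>] by (auto simp: PiE_iff)
  qed
  have op: "openin (topo (lr_hom G r M)) U \<longleftrightarrow> (\<exists>T. openin ?T T \<and> U = T \<inter> ?H)"
    unfolding topo_lr_hom openin_subtopology ..
  have S': "s \<in> carrier M" if "s \<in> S" for s using that S_carrier by auto
  show ?thesis
  proof
    assume "openin (topo (lr_hom G r M)) U"
    then obtain T where T: "openin ?T T" "U = T \<inter> ?H" unfolding op by (elim exE conjE)
    have ?R
    proof
      fix \<phi> assume "\<phi> \<in> U"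
      then have \<phi>: "\<phi> \<in> T" "\<phi> \<in> ?H" using T by auto
      have "\<exists>F e. finite F \<and> F \<subseteq> carrier M \<and> 0 < e \<and> (\<forall>\<psi>\<in>?P.
          (\<forall>m\<in>F. ell_norm r (carrier G) (\<lambda>g. \<psi> m g - \<phi> m g) < e) \<longrightarrow> \<psi> \<in> T)"
        by (rule bspec[OF conjunct2[OF iffD1[OF openin_lr_product[OF r] T(1)]] \<phi>(1)])
      then obtain F e where F: "finite F" "F \<subseteq> carrier M" "0 < e" "\<forall>\<psi>\<in>?P.
          (\<forall>m\<in>F. ell_norm r (carrier G) (\<lambda>g. \<psi> m g - \<phi> m g) < e) \<longrightarrow> \<psi> \<in> T" by (elim exE conjE)
      \<comment> \<open>Each \<open>combination_bound m\<close> with \<open>m\<close> in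
        \<open>F\<close> is at most \<open>D\<close>, so one radius serves all constrained
        points.\<close>
      define D where "D = (\<Sum>m\<in>F. combination_bound m)"
      have D: "0 \<le> D" by (simp add: D_def sum_nonneg combination_bound_nonneg)
      have "\<psi> \<in> U" if \<psi>: "\<psi> \<in> ?H"
        "ell_norm r (S \<times> carrier G) (\<lambda>i. hom_coords \<psi> i - hom_coords \<phi> i) < e / (D + 1)" for \<psi>
      proof -
        define \<delta> where "\<delta> = (\<lambda>i. hom_coords \<psi> i - hom_coords \<phi> i)"
        have \<delta>: "\<delta> \<in> ell r (S \<times> carrier G)"
          unfolding \<delta>_def by (intro ell_diff hom_coords_ell(1) r lr_homD(1)[OF \<psi>(1)] lr_homD(1)[OF \<phi>(2)])
        have "ell_norm r (carrier G) (\<lambda>g. \<psi> m g - \<phi> m g) < e" if m: "m \<in> F" for m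
        proof -
          have mM: "m \<in> carrier M" using m F by auto
          have eq: "(\<lambda>g. \<psi> m g - \<phi> m g) = combination \<delta> m"
            unfolding combination_hom_coords[OF r \<psi>(1) mM, symmetric] combination_hom_coords[OF r \<phi>(2) mM, symmetric]
            by (simp add: combination_def \<delta>_def gact_diff_right sum_subtractf)
          have "ell_norm r (carrier G) (\<lambda>g. \<psi> m g - \<phi> m g) = ell_norm r (carrier G) (combination \<delta> m)"
            by (simp only: eq)
          also have "ell_norm r (carrier G) (combination \<delta> m) \<le> combination_bound m * (e / (D + 1))"
          proof (rule combination_ell(2)[OF r _ mM])
            fix s assume s: "s \<in> S"
            show "(\<lambda>g. \<delta> (s, g)) \<in> ell r (carrier G)" by (rule ell_slice(1)[OF \<delta> s r])
            show "ell_norm r (carrier G) (\<lambda>g. \<delta> (s, g)) \<le> e / (D + 1)"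
              using ell_slice(2)[OF \<delta> s r] \<psi>(2) by (simp add: \<delta>_def)
          qed
          also have "combination_bound m * (e / (D + 1)) \<le> D * (e / (D + 1))"
          proof (rule mult_right_mono)
            show "combination_bound m \<le> D"
              unfolding D_def using F(1) m combination_bound_nonneg by (intro member_le_sum) auto
          qed (use F(3) D in simp)
          also have "\<dots> < (D + 1) * (e / (D + 1))"
            using F(3) D by (intro mult_strict_right_mono divide_pos_pos) auto
          also have "\<dots> = e" using D by simp
          finally show ?thesis .
        qed
        then have "\<psi> \<in> T" using F(4) \<psi>(1) HP by blast
        then show ?thesis using T(2) \<psi>(1) by simp
      qed
      then show "\<exists>e>0. \<forall>\<psi>\<in>?H. ell_norm r (S \<times> carrier G) (\<lambda>i. hom_coords \<psi> i - hom_coords \<phi> i) < e \<longrightarrow> \<psi> \<in> U"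
        using F(3) D by (intro exI[of _ "e / (D + 1)"]) simp
    qed
    moreover have "U \<subseteq> ?H" unfolding T(2) by (rule Int_lower2)
    ultimately show "U \<subseteq> ?H \<and> ?R" by (intro conjI)
  next
    assume R: "U \<subseteq> ?H \<and> ?R"
    define e where "e = (\<lambda>\<phi>. SOME e. 0 < e \<and> (\<forall>\<psi>\<in>?H.
      ell_norm r (S \<times> carrier G) (\<lambda>i. hom_coords \<psi> i - hom_coords \<phi> i) < e \<longrightarrow> \<psi> \<in> U))"
    have e: "0 < e \<phi> \<and> (\<forall>\<psi>\<in>?H.
      ell_norm r (S \<times> carrier G) (\<lambda>i. hom_coords \<psi> i - hom_coords \<phi> i) < e \<phi> \<longrightarrow> \<psi> \<in> U)" if "\<phi> \<in> U" for \<phi>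
      unfolding e_def by (rule someI_ex) (rule bspec[OF conjunct2[OF R] that])
    \<comment> \<open>The norm is at most the sum of \<open>card S\<close> slice norms, each below
      this radius; the summand 1 keeps the final inequality strict and covers empty
      \<open>S\<close>.\<close>
    define d where "d = (\<lambda>\<phi>. e \<phi> / (real (card S) + 1))"
    have d: "0 < d \<phi>" if "\<phi> \<in> U" for \<phi> using e[OF that] by (simp add: d_def)
    define B where "B = (\<lambda>\<phi>. \<Pi>\<^sub>E m\<in>carrier M. if m \<in> S
      then {f \<in> ell r (carrier G). ell_norm r (carrier G) (\<lambda>g. f g - \<phi> m g) < d \<phi>} else ell r (carrier G))"
    have opB: "openin ?T (B \<phi>)" if "\<phi> \<in> U" for \<phi>
      unfolding B_def
    proof (rule product_topology_basis)
      have \<phi>: "\<phi> \<in> ?H" using that R by auto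
      fix m
      show "openin (lr_topology G r) (if m \<in> S
        then {f \<in> ell r (carrier G). ell_norm r (carrier G) (\<lambda>g. f g - \<phi> m g) < d \<phi>} else ell r (carrier G))"
        using openin_lr_ball[OF r lr_homD(1)[OF \<phi> S'], of m "d \<phi>"]
          openin_topspace[of "lr_topology G r"] by (simp add: topspace_lr_topology[OF r])
    next
      show "finite {m. (if m \<in> S
        then {f \<in> ell r (carrier G). ell_norm r (carrier G) (\<lambda>g. f g - \<phi> m g) < d \<phi>} else ell r (carrier G))
          \<noteq> topspace (lr_topology G r)}"
        by (rule finite_subset[OF _ finite_S]) (auto simp: topspace_lr_topology[OF r])
    qed
    define T where "T = (\<Union>\<phi>\<in>U. B \<phi>)"
    have "openin ?T T" unfolding T_def using opB by (intro openin_Union) auto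
    moreover have "U = T \<inter> ?H"
    proof
      show "U \<subseteq> T \<inter> ?H"
      proof
        fix \<phi> assume \<phi>: "\<phi> \<in> U"
        then have \<phi>H: "\<phi> \<in> ?H" using R by auto
        have "\<phi> \<in> B \<phi>"
          unfolding B_def using lr_homD(1)[OF \<phi>H] lr_homD(4)[OF \<phi>H] d[OF \<phi>] by (auto simp: PiE_iff)
        then show "\<phi> \<in> T \<inter> ?H" using \<phi> \<phi>H by (auto simp only: T_def)
      qed
      show "T \<inter> ?H \<subseteq> U"
      proof
        fix \<psi> assume "\<psi> \<in> T \<inter> ?H"
        then obtain \<phi> where \<phi>: "\<phi> \<in> U" "\<psi> \<in> B \<phi>" and \<psi>: "\<psi> \<in> ?H" by (auto simp only: T_def)
        have \<phi>H: "\<phi> \<in> ?H" using R \<phi> by auto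
        have near: "ell_norm r (carrier G) (\<lambda>g. \<psi> s g - \<phi> s g) < d \<phi>" if s: "s \<in> S" for s
        proof -
          have "\<psi> s \<in> {f \<in> ell r (carrier G). ell_norm r (carrier G) (\<lambda>g. f g - \<phi> s g) < d \<phi>}"
            using PiE_mem[OF \<phi>(2)[unfolded B_def] S'[OF s]] s by simp
          then show ?thesis by simp
        qed
        have "(\<lambda>i. hom_coords \<psi> i - hom_coords \<phi> i) = hom_coords (\<lambda>m g. \<psi> m g - \<phi> m g)"
          by (auto simp: hom_coords_def fun_eq_iff)
        then have "ell_norm r (S \<times> carrier G) (\<lambda>i. hom_coords \<psi> i - hom_coords \<phi> i)
            = ell_norm r (S \<times> carrier G) (hom_coords (\<lambda>m g. \<psi> m g - \<phi> m g))" by simp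
        also have "\<dots> \<le> (\<Sum>s\<in>S. ell_norm r (carrier G) (\<lambda>g. \<psi> s g - \<phi> s g))"
          by (rule hom_coords_ell(2)[OF r]) (intro ell_diff r lr_homD(1)[OF \<psi>] lr_homD(1)[OF \<phi>H])
        also have "\<dots> \<le> real (card S) * d \<phi>"
          using near by (intro sum_bounded_above) (auto intro: less_imp_le)
        also have "\<dots> < (real (card S) + 1) * d \<phi>" using d[OF \<phi>(1)] by (intro mult_strict_right_mono) auto
        also have "\<dots> = e \<phi>" by (simp add: d_def)
        finally show "\<psi> \<in> U" using e[OF \<phi>(1)] \<psi> by blast
      qed
    qed
    ultimately show "openin (topo (lr_hom G r M)) U" unfolding op by (intro exI conjI)
  qed
qed

lemma ell_ctvs_hom:
  assumes r: "1 < r"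
  shows "ell_ctvs (lr_hom G r M) hom_coords r (S \<times> carrier G)"
proof -
  interpret gm: gmodule G M r by (rule gmodule[OF r])
  have S': "s \<in> carrier M" if "s \<in> S" for s using that S_carrier by auto
  show ?thesis
  proof (unfold_locales)
    show "1 < r" by (rule r)
    show "inj_on hom_coords (carrier (lr_hom G r M))"
    proof (rule inj_onI)
      fix \<phi> \<psi> assume \<phi>: "\<phi> \<in> carrier (lr_hom G r M)" and \<psi>: "\<psi> \<in> carrier (lr_hom G r M)"
        and eq: "hom_coords \<phi> = hom_coords \<psi>"
      show "\<phi> = \<psi>"
      proof (rule extensionalityI[OF lr_homD(4)[OF \<phi>] lr_homD(4)[OF \<psi>]])
        fix m assume m: "m \<in> carrier M"
        show "\<phi> m = \<psi> m"
          using combination_hom_coords[OF r \<phi> m] combination_hom_coords[OF r \<psi> m] eq by simp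
      qed
    qed
    show "\<zero>\<^bsub>lr_hom G r M\<^esub> \<in> carrier (lr_hom G r M)"
      unfolding lr_hom_simps(2) by (rule gm.lr_hom_closed)
    show "hom_coords \<zero>\<^bsub>lr_hom G r M\<^esub> = (\<lambda>i. 0)"
      unfolding lr_hom_simps(2) by (auto simp: hom_coords_def fun_eq_iff S')
    fix \<phi> assume \<phi>: "\<phi> \<in> carrier (lr_hom G r M)"
    show "hom_coords \<phi> \<in> ell r (S \<times> carrier G)"
      by (rule hom_coords_ell(1)[OF r, of \<phi>, OF lr_homD(1)[OF \<phi>]])
    show "k \<odot>\<^bsub>lr_hom G r M\<^esub> \<phi> \<in> carrier (lr_hom G r M)" for k
      unfolding lr_hom_simps(4) by (rule gm.lr_hom_closed(3)[OF \<phi>])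
    show "hom_coords (k \<odot>\<^bsub>lr_hom G r M\<^esub> \<phi>) = (\<lambda>i. k * hom_coords \<phi> i)" for k
      unfolding lr_hom_simps(4) by (auto simp: hom_coords_def fun_eq_iff S')
    fix \<psi> assume \<psi>: "\<psi> \<in> carrier (lr_hom G r M)"
    show "\<phi> \<oplus>\<^bsub>lr_hom G r M\<^esub> \<psi> \<in> carrier (lr_hom G r M)"
      unfolding lr_hom_simps(3) by (rule gm.lr_hom_closed(2)[OF \<phi> \<psi>])
    show "hom_coords (\<phi> \<oplus>\<^bsub>lr_hom G r M\<^esub> \<psi>) = (\<lambda>i. hom_coords \<phi> i + hom_coords \<psi> i)"
      unfolding lr_hom_simps(3) by (auto simp: hom_coords_def fun_eq_iff S')
  next
    show "openin (topo (lr_hom G r M)) U \<longleftrightarrow> U \<subseteq> carrier (lr_hom G r M) \<and>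
      (\<forall>u\<in>U. \<exists>e>0. \<forall>v\<in>carrier (lr_hom G r M).
        ell_norm r (S \<times> carrier G) (\<lambda>i. hom_coords v i - hom_coords u i) < e \<longrightarrow> v \<in> U)" for U
      by (rule openin_hom_coords[OF r])
  qed
qed

text \<open>On \<open>m \<otimes> f\<close> the pairing in coordinates is that of
  \<open>\<phi> m\<close> with \<open>f\<close>. The dual basis has disappeared, so pairings over
  neighbouring modules of the resolution can be compared.\<close>

lemma pair_hom_tensor:
  assumes exps: "conjugate_exponents p q" and \<phi>: "\<phi> \<in> carrier (lr_hom G p M)"
    and z: "Poly_Mapping.keys z \<subseteq> carrier M \<times> ell q (carrier G)"
  shows "ell_pair (S \<times> carrier G) (hom_coords \<phi>) (tensor_coords (tensor_coset G q M z))
    = frag_eval z (\<lambda>(m, f). ell_pair (carrier G) (\<phi> m) f)"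
proof -
  interpret conjugate_exponents p q by (rule exps)
  have "ell_pair (S \<times> carrier G) (hom_coords \<phi>) (tensor_coords (tensor_coset G q M z))
      = frag_eval z (\<lambda>(m, f). ell_pair (carrier G) (combination (hom_coords \<phi>) m) f)"
    using pair_coords[OF exps hom_coords_ell(1)[OF p1, of \<phi>, OF lr_homD(1)[OF \<phi>]] z]
    by (simp add: tensor_coords_coset[OF q1])
  also have "\<dots> = frag_eval z (\<lambda>(m, f). ell_pair (carrier G) (\<phi> m) f)"
  proof (rule frag_eval_cong)
    fix x assume "x \<in> Poly_Mapping.keys z"
    then have "fst x \<in> carrier M" using z by auto
    then show "(case x of (m, f) \<Rightarrow> ell_pair (carrier G) (combination (hom_coords \<phi>) m) f)
        = (case x of (m, f) \<Rightarrow> ell_pair (carrier G) (\<phi> m) f)"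
      by (cases x) (simp add: combination_hom_coords[OF p1 \<phi>] del: lr_hom_simps)
  qed
  finally show ?thesis .
qed

text \<open>A family \<open>y\<close> is represented by the homomorphism it assembles, a family
  \<open>x\<close> by the tensor \<open>\<Sum>s. s \<otimes> x s\<close>. The constant bounds the
  projection to homomorphisms: evaluation at each \<open>s\<close> costs
  \<open>combination_bound s\<close>.\<close>

lemma ell_dual_pair_hom_tensor:
  assumes exps: "conjugate_exponents p q"
  shows "ell_dual_pair p q (lr_tensor G q M) tensor_coords (lr_hom G p M) hom_coords (S \<times> carrier G)
    (\<Sum>s\<in>S. combination_bound s)"
proof -
  interpret conjugate_exponents p q by (rule exps)
  interpret gm: gmodule G M q by (rule gmodule[OF q1])
  have S': "s \<in> carrier M" if "s \<in> S" for s using that S_carrier by auto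
  show ?thesis
  proof (intro ell_dual_pair.intro ell_dual_pair_axioms.intro exps ell_ctvs_tensor ell_ctvs_hom p1 q1)
    show "0 \<le> (\<Sum>s\<in>S. combination_bound s)" by (simp add: sum_nonneg combination_bound_nonneg)
  next
    fix y assume y: "y \<in> ell p (S \<times> carrier G)"
    define \<phi> where "\<phi> = restrict (combination y) (carrier M)"
    have \<phi>: "\<phi> \<in> carrier (lr_hom G p M)" unfolding \<phi>_def by (rule combination_lr_hom[OF p1 y])
    have "ell_norm p (S \<times> carrier G) (hom_coords \<phi>) \<le> (\<Sum>s\<in>S. ell_norm p (carrier G) (\<phi> s))"
      by (rule hom_coords_ell(2)[OF p1, of \<phi>, OF lr_homD(1)[OF \<phi>]])
    also have "\<dots> \<le> (\<Sum>s\<in>S. combination_bound s * ell_norm p (S \<times> carrier G) y)"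
    proof (rule sum_mono)
      fix s assume s: "s \<in> S"
      have "ell_norm p (carrier G) (combination y s) \<le> combination_bound s * ell_norm p (S \<times> carrier G) y"
        using ell_slice[OF y _ p1] by (intro combination_ell(2)[OF p1 _ S'[OF s]]) auto
      then show "ell_norm p (carrier G) (\<phi> s) \<le> combination_bound s * ell_norm p (S \<times> carrier G) y"
        using S'[OF s] by (simp add: \<phi>_def)
    qed
    also have "\<dots> = (\<Sum>s\<in>S. combination_bound s) * ell_norm p (S \<times> carrier G) y"
      by (simp add: sum_distrib_right)
    finally have bound: "ell_norm p (S \<times> carrier G) (hom_coords \<phi>)
        \<le> (\<Sum>s\<in>S. combination_bound s) * ell_norm p (S \<times> carrier G) y" .
    have "ell_pair (S \<times> carrier G) (hom_coords \<phi>) (tensor_coords A) = ell_pair (S \<times> carrier G) y (tensor_coords A)"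
      if A: "A \<in> carrier (lr_tensor G q M)" for A
    proof -
      obtain z where z: "A = gm.ten z" "Poly_Mapping.keys z \<subseteq> carrier M \<times> ell q (carrier G)"
        using A by (auto simp: gm.carrier_lr_tensor)
      have "frag_eval z (\<lambda>(m, f). ell_pair (carrier G) (\<phi> m) f)
          = frag_eval z (\<lambda>(m, f). ell_pair (carrier G) (combination y m) f)"
        using z(2) by (intro frag_eval_cong) (auto simp: \<phi>_def)
      then show ?thesis
        using pair_hom_tensor[OF exps \<phi> z(2)] pair_coords[OF exps y z(2)]
        by (simp add: z(1) tensor_coords_coset[OF q1])
    qed
    with \<phi> bound show "\<exists>w\<in>carrier (lr_hom G p M).
      ell_norm p (S \<times> carrier G) (hom_coords w) \<le> (\<Sum>s\<in>S. combination_bound s) * ell_norm p (S \<times> carrier G) y \<and>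
      (\<forall>v\<in>carrier (lr_tensor G q M). ell_pair (S \<times> carrier G) (hom_coords w) (tensor_coords v)
        = ell_pair (S \<times> carrier G) y (tensor_coords v))" by blast
  next
    fix x assume x: "x \<in> ell q (S \<times> carrier G)"
    define z where "z = (\<Sum>s\<in>S. frag_of (s, \<lambda>g. x (s, g)))"
    have z: "Poly_Mapping.keys z \<subseteq> carrier M \<times> ell q (carrier G)"
      unfolding z_def using S' ell_slice(1)[OF x _ q1] by (intro keys_sum_frag_of) auto
    have "ell_pair (S \<times> carrier G) (hom_coords w) (tensor_coords (gm.ten z))
        = ell_pair (S \<times> carrier G) (hom_coords w) x" if w: "w \<in> carrier (lr_hom G p M)" for w
    proof -
      have "ell_pair (S \<times> carrier G) (hom_coords w) (tensor_coords (gm.ten z))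
          = (\<Sum>s\<in>S. ell_pair (carrier G) (w s) (\<lambda>g. x (s, g)))"
        unfolding pair_hom_tensor[OF exps w z] by (simp add: z_def frag_eval_sum)
      also have "\<dots> = (\<Sum>s\<in>S. ell_pair (carrier G) (\<lambda>g. hom_coords w (s, g)) (\<lambda>g. x (s, g)))"
        by (intro sum.cong refl) (simp add: hom_coords_def)
      also have "\<dots> = ell_pair (S \<times> carrier G) (hom_coords w) x"
        by (rule ell_pair_slices[OF finite_S hom_coords_ell(1)[OF p1, of w, OF lr_homD(1)[OF w]] x, symmetric])
      finally show ?thesis .
    qed
    moreover have "gm.ten z \<in> carrier (lr_tensor G q M)" using z by (auto simp: gm.carrier_lr_tensor)
    ultimately show "\<exists>v\<in>carrier (lr_tensor G q M). \<forall>w\<in>carrier (lr_hom G p M).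
        ell_pair (S \<times> carrier G) (hom_coords w) (tensor_coords v) = ell_pair (S \<times> carrier G) (hom_coords w) x"
      by blast
  qed
qed

end

section \<open>Cycles and cocycles\<close>

text \<open>Every element of \<open>ell p I\<close> pairs with \<open>V\<close> like some member of
  \<open>W\<close>, so \<open>W\<close> already separates the points of \<open>V\<close>.\<close>

lemma (in ell_dual_pair) pairing_nondegenerate:
  assumes v: "v \<in> carrier V" and zero: "\<And>w. w \<in> carrier W \<Longrightarrow> pairing w v = 0"
  shows "v = \<zero>\<^bsub>V\<^esub>"
proof -
  have "JV v = (\<lambda>i. 0)"
  proof (rule ell_pair_nondegenerate[OF V.J_ell[OF v]])
    fix y assume "y \<in> ell p I"
    then obtain w where "w \<in> carrier W" "ell_pair I (JW w) (JV v) = ell_pair I y (JV v)"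
      using W_represents v by blast
    then show "ell_pair I y (JV v) = 0" using zero by (simp add: pairing_def)
  qed
  then show ?thesis using v V.zero_closed by (simp add: V.J_eq_iff V.J_zero)
qed

lemma frag_eval_tensor_lift:
  "frag_eval (tensor_lift u v z) F = frag_eval z (\<lambda>(x, f). F (u x, v f))"
  by (simp add: tensor_lift_def frag_eval_extend case_prod_unfold)

lemma compose_lr_hom:
  assumes M: "gmodule G M r" and u: "u \<in> module_maps (carrier (group_ring G)) M N"
    and \<phi>: "\<phi> \<in> carrier (lr_hom G r N)"
  shows "compose (carrier M) \<phi> u \<in> carrier (lr_hom G r M)"
proof -
  interpret M: gmodule G M r by (rule M)
  have uN: "u x \<in> carrier N" if "x \<in> carrier M" for x using u that by (auto simp: module_maps_def)
  show ?thesis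
  proof (rule lr_homI)
    fix m assume m: "m \<in> carrier M"
    then show "compose (carrier M) \<phi> u m \<in> ell r (carrier G)"
      using lr_homD(1)[OF \<phi> uN] by (simp add: compose_def)
    show "compose (carrier M) \<phi> u (m \<oplus>\<^bsub>M\<^esub> m') = (\<lambda>g. compose (carrier M) \<phi> u m g + compose (carrier M) \<phi> u m' g)"
      if "m' \<in> carrier M" for m'
      using m that u lr_homD(2)[OF \<phi> uN uN] by (simp add: compose_def module_maps_def)
    show "compose (carrier M) \<phi> u (a \<odot>\<^bsub>M\<^esub> m) = gact G a (compose (carrier M) \<phi> u m)"
      if "a \<in> carrier (group_ring G)" for a
      using m that u lr_homD(3)[OF \<phi> _ uN] M.M.smult_closed by (simp add: compose_def module_maps_def)
  qed (simp add: compose_def)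
qed

lemma tensor_map_id_coset:
  assumes "gmodule G M r" "gmodule G N r" "u \<in> module_maps (carrier (group_ring G)) M N"
  shows "tensor_map G r N u id (tensor_coset G r M z) = tensor_coset G r N (tensor_lift u id z)"
  by (rule tensor_map_coset[OF assms]) simp_all

lemma csubspace_boundaries:
  assumes M: "gmodule G M r" and N: "gmodule G N r"
    and u: "u \<in> module_maps (carrier (group_ring G)) M N"
  shows "csubspace (lr_tensor G r N) (tensor_map G r N u id ` carrier (lr_tensor G r M))"
proof -
  interpret M: gmodule G M r by (rule M)
  interpret N: gmodule G N r by (rule N)
  let ?K = "{z. Poly_Mapping.keys z \<subseteq> carrier M \<times> ell r (carrier G)}"
  let ?t = "\<lambda>z. N.ten (tensor_lift u id z)"
  have B: "tensor_map G r N u id ` carrier (lr_tensor G r M) = ?t ` ?K"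
    by (simp add: M.carrier_lr_tensor image_image tensor_map_id_coset[OF M N u])
  have uN: "u ` carrier M \<subseteq> carrier N" using u by (auto simp: module_maps_def)
  show ?thesis
    unfolding B csubspace_def
  proof (intro conjI ballI allI)
    show "?t ` ?K \<subseteq> carrier (lr_tensor G r N)"
      unfolding N.carrier_lr_tensor using keys_tensor_lift[OF _ uN, of _ "ell r (carrier G)" id] by auto
    show "\<zero>\<^bsub>lr_tensor G r N\<^esub> \<in> ?t ` ?K"
      unfolding N.zero_lr_tensor by (rule image_eqI[of _ _ 0]) simp_all
  next
    fix A A' assume "A \<in> ?t ` ?K" "A' \<in> ?t ` ?K"
    then obtain z z' where z: "A = ?t z" "z \<in> ?K" "A' = ?t z'" "z' \<in> ?K" by blast
    have "z + z' \<in> ?K" using z(2,4) keys_add[of z z'] by blast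
    then show "A \<oplus>\<^bsub>lr_tensor G r N\<^esub> A' \<in> ?t ` ?K"
      by (rule rev_image_eqI) (simp add: z(1,3) N.add_lr_tensor)
  next
    fix k A assume "A \<in> ?t ` ?K"
    then obtain z where z: "A = ?t z" "z \<in> ?K" by blast
    let ?w = "tensor_lift id (\<lambda>f g. k * f g) z"
    have "?w \<in> ?K" using M.keys_scale z(2) by blast
    then show "k \<odot>\<^bsub>lr_tensor G r N\<^esub> A \<in> ?t ` ?K"
      by (rule rev_image_eqI) (simp add: z(1) N.smult_lr_tensor tensor_lift_compose)
  qed
qed

lemma csubspace_coboundaries:
  assumes M: "gmodule G M r" and N: "gmodule G N r"
    and u: "u \<in> module_maps (carrier (group_ring G)) M N"
  shows "csubspace (lr_hom G r M) ((\<lambda>\<phi>. compose (carrier M) \<phi> u) ` carrier (lr_hom G r N))"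
proof -
  interpret N: gmodule G N r by (rule N)
  let ?c = "\<lambda>\<phi>. compose (carrier M) \<phi> u"
  let ?H = "carrier (lr_hom G r N)"
  have uN: "u x \<in> carrier N" if "x \<in> carrier M" for x using u that by (auto simp: module_maps_def)
  show ?thesis
    unfolding csubspace_def
  proof (intro conjI ballI allI)
    show "?c ` ?H \<subseteq> carrier (lr_hom G r M)" using compose_lr_hom[OF M u] by blast
    have "\<zero>\<^bsub>lr_hom G r M\<^esub> = ?c (\<lambda>x\<in>carrier N. \<lambda>g. 0)"
      unfolding lr_hom_simps(2) by (auto simp: compose_def uN intro!: restrict_ext)
    then show "\<zero>\<^bsub>lr_hom G r M\<^esub> \<in> ?c ` ?H" using N.lr_hom_closed(1) by (rule image_eqI)
  next
    fix a b assume "a \<in> ?c ` ?H" "b \<in> ?c ` ?H"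
    then obtain \<phi> \<psi> where h: "a = ?c \<phi>" "\<phi> \<in> ?H" "b = ?c \<psi>" "\<psi> \<in> ?H" by blast
    have "a \<oplus>\<^bsub>lr_hom G r M\<^esub> b = ?c (\<lambda>x\<in>carrier N. \<lambda>g. \<phi> x g + \<psi> x g)"
      unfolding lr_hom_simps(3) h(1,3) by (auto simp: compose_def uN intro!: restrict_ext)
    then show "a \<oplus>\<^bsub>lr_hom G r M\<^esub> b \<in> ?c ` ?H" using N.lr_hom_closed(2)[OF h(2,4)] by (rule image_eqI)
  next
    fix k a assume "a \<in> ?c ` ?H"
    then obtain \<phi> where h: "a = ?c \<phi>" "\<phi> \<in> ?H" by blast
    have "k \<odot>\<^bsub>lr_hom G r M\<^esub> a = ?c (\<lambda>x\<in>carrier N. \<lambda>g. k * \<phi> x g)"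
      unfolding lr_hom_simps(4) h(1) by (auto simp: compose_def uN intro!: restrict_ext)
    then show "k \<odot>\<^bsub>lr_hom G r M\<^esub> a \<in> ?c ` ?H" using N.lr_hom_closed(3)[OF h(2)] by (rule image_eqI)
  qed
qed

lemma compose_eq_zero_iff:
  "compose (carrier M) \<phi> u = \<zero>\<^bsub>lr_hom G r M\<^esub> \<longleftrightarrow> (\<forall>x\<in>carrier M. \<phi> (u x) = (\<lambda>g. 0))"
  by (auto simp: compose_def fun_eq_iff restrict_def)

context dual_basis
begin

text \<open>Pairing with the boundary of \<open>x \<otimes> f\<close> gives the pairing of
  \<open>\<phi> (u x)\<close> with \<open>f\<close>; letting \<open>f\<close> vary forces
  \<open>\<phi> (u x)\<close> to vanish. \<open>N\<close> is a plain \<open>gmodule\<close> because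
  it will be \<open>F (Suc i)\<close>.\<close>

lemma cocycle_iff_annihilates_boundaries:
  assumes exps: "conjugate_exponents p q" and N: "gmodule G N q"
    and u: "u \<in> module_maps (carrier (group_ring G)) N M" and \<phi>: "\<phi> \<in> carrier (lr_hom G p M)"
  shows "compose (carrier N) \<phi> u = \<zero>\<^bsub>lr_hom G p N\<^esub> \<longleftrightarrow>
    (\<forall>A\<in>tensor_map G q M u id ` carrier (lr_tensor G q N).
      ell_pair (S \<times> carrier G) (hom_coords \<phi>) (tensor_coords A) = 0)"
    (is "_ \<longleftrightarrow> ?R")
proof -
  interpret conjugate_exponents p q by (rule exps)
  interpret N: gmodule G N q by (rule N)
  interpret gm: gmodule G M q by (rule gmodule[OF q1])
  have uM: "u x \<in> carrier M" if "x \<in> carrier N" for x using u that by (auto simp: module_maps_def)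
  have pair: "ell_pair (S \<times> carrier G) (hom_coords \<phi>) (tensor_coords (tensor_map G q M u id (N.ten z)))
      = frag_eval z (\<lambda>(x, f). ell_pair (carrier G) (\<phi> (u x)) f)"
    if z: "Poly_Mapping.keys z \<subseteq> carrier N \<times> ell q (carrier G)" for z
  proof -
    have "Poly_Mapping.keys (tensor_lift u id z) \<subseteq> carrier M \<times> ell q (carrier G)"
      using uM by (intro keys_tensor_lift[OF z]) auto
    from pair_hom_tensor[OF exps \<phi> this] show ?thesis
      by (simp add: tensor_map_id_coset[OF N gm.gmodule_axioms u] frag_eval_tensor_lift)
  qed
  show ?thesis
    unfolding compose_eq_zero_iff
  proof
    assume zero: "\<forall>x\<in>carrier N. \<phi> (u x) = (\<lambda>g. 0)"
    have "frag_eval z (\<lambda>(x, f). ell_pair (carrier G) (\<phi> (u x)) f) = frag_eval z (\<lambda>_. 0)"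
      if "Poly_Mapping.keys z \<subseteq> carrier N \<times> ell q (carrier G)" for z
      using that zero by (intro frag_eval_cong) auto
    then show ?R using pair by (auto simp: N.carrier_lr_tensor)
  next
    assume R: ?R
    show "\<forall>x\<in>carrier N. \<phi> (u x) = (\<lambda>g. 0)"
    proof
      fix x assume x: "x \<in> carrier N"
      show "\<phi> (u x) = (\<lambda>g. 0)"
      proof (rule conjugate_exponents.ell_pair_nondegenerate[OF swap lr_homD(1)[OF \<phi> uM[OF x]]])
        fix f assume f: "f \<in> ell q (carrier G)"
        have "N.ten (frag_of (x, f)) \<in> carrier (lr_tensor G q N)"
          using x f by (auto simp: N.carrier_lr_tensor)
        then show "ell_pair (carrier G) f (\<phi> (u x)) = 0"
          using R pair[of "frag_of (x, f)"] x f by (simp add: ell_pair_commute[of _ f])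
      qed
    qed
  qed
qed

text \<open>Adjointness of composition with \<open>u\<close> and \<open>u \<otimes> id\<close>: on
  formal sums both sides pair \<open>\<phi> (u m)\<close> with \<open>f\<close>.\<close>

lemma pair_coboundary:
  assumes exps: "conjugate_exponents p q" and N: "gmodule G N q"
    and u: "u \<in> module_maps (carrier (group_ring G)) M N" and \<phi>: "\<phi> \<in> carrier (lr_hom G p N)"
    and z: "Poly_Mapping.keys z \<subseteq> carrier M \<times> ell q (carrier G)"
  shows "ell_pair (S \<times> carrier G) (hom_coords (compose (carrier M) \<phi> u)) (tensor_coords (tensor_coset G q M z))
    = frag_eval (tensor_lift u id z) (\<lambda>(m, f). ell_pair (carrier G) (\<phi> m) f)"
proof -
  interpret conjugate_exponents p q by (rule exps)
  have "frag_eval z (\<lambda>(m, f). ell_pair (carrier G) (compose (carrier M) \<phi> u m) f)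
      = frag_eval z (\<lambda>(m, f). ell_pair (carrier G) (\<phi> (u m)) f)"
    using z by (intro frag_eval_cong) (auto simp: compose_def)
  then show ?thesis
    unfolding pair_hom_tensor[OF exps compose_lr_hom[OF gmodule[OF p1] u \<phi>] z] frag_eval_tensor_lift
    by simp
qed

end

text \<open>By adjointness the coboundaries test the image tensor against all homomorphisms on
  \<open>N\<close>. The dual basis of \<open>N\<close>, which will be \<open>F (i - 1)\<close>,
  ensures that a tensor killed by all of them is zero.\<close>

lemma cycle_iff_annihilated_by_coboundaries:
  assumes exps: "conjugate_exponents p q" and M: "dual_basis G M S c" and N: "dual_basis G N T d"
    and u: "u \<in> module_maps (carrier (group_ring G)) M N" and A: "A \<in> carrier (lr_tensor G q M)"
  shows "tensor_map G q N u id A = \<zero>\<^bsub>lr_tensor G q N\<^esub> \<longleftrightarrow>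
    (\<forall>\<phi>\<in>(\<lambda>\<phi>. compose (carrier M) \<phi> u) ` carrier (lr_hom G p N).
      ell_pair (S \<times> carrier G) (dual_basis.hom_coords S \<phi>) (dual_basis.tensor_coords G S c A) = 0)"
proof -
  interpret conjugate_exponents p q by (rule exps)
  interpret M: dual_basis G M S c by (rule M)
  interpret N: dual_basis G N T d by (rule N)
  interpret gM: gmodule G M q by (rule M.gmodule[OF q1])
  interpret gN: gmodule G N q by (rule N.gmodule[OF q1])
  interpret DP: ell_dual_pair p q "lr_tensor G q N" N.tensor_coords "lr_hom G p N" N.hom_coords
    "T \<times> carrier G" "\<Sum>s\<in>T. N.combination_bound s"
    by (rule N.ell_dual_pair_hom_tensor[OF exps])
  obtain z where z: "A = gM.ten z" "Poly_Mapping.keys z \<subseteq> carrier M \<times> ell q (carrier G)"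
    using A by (auto simp: gM.carrier_lr_tensor)
  have keys: "Poly_Mapping.keys (tensor_lift u id z) \<subseteq> carrier N \<times> ell q (carrier G)"
    using u by (intro keys_tensor_lift[OF z(2)]) (auto simp: module_maps_def)
  have uA: "tensor_map G q N u id A = gN.ten (tensor_lift u id z)"
    by (simp add: z(1) tensor_map_id_coset[OF gM.gmodule_axioms gN.gmodule_axioms u])
  have uA_carrier: "tensor_map G q N u id A \<in> carrier (lr_tensor G q N)"
    using keys by (auto simp: uA gN.carrier_lr_tensor)
  have pair: "ell_pair (S \<times> carrier G) (M.hom_coords (compose (carrier M) \<phi> u)) (M.tensor_coords A)
      = DP.pairing \<phi> (tensor_map G q N u id A)" if \<phi>: "\<phi> \<in> carrier (lr_hom G p N)" for \<phi>
    unfolding DP.pairing_def uA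
    using N.pair_hom_tensor[OF exps \<phi> keys] M.pair_coboundary[OF exps gN.gmodule_axioms u \<phi> z(2)]
    by (simp add: z(1))
  have "tensor_map G q N u id A = \<zero>\<^bsub>lr_tensor G q N\<^esub> \<longleftrightarrow>
      (\<forall>\<phi>\<in>carrier (lr_hom G p N). DP.pairing \<phi> (tensor_map G q N u id A) = 0)"
  proof
    assume eq: "tensor_map G q N u id A = \<zero>\<^bsub>lr_tensor G q N\<^esub>"
    show "\<forall>\<phi>\<in>carrier (lr_hom G p N). DP.pairing \<phi> (tensor_map G q N u id A) = 0"
      unfolding eq DP.pairing_def DP.V.J_zero by simp
  next
    assume zero: "\<forall>\<phi>\<in>carrier (lr_hom G p N). DP.pairing \<phi> (tensor_map G q N u id A) = 0"
    show "tensor_map G q N u id A = \<zero>\<^bsub>lr_tensor G q N\<^esub>"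
      by (rule DP.pairing_nondegenerate[OF uA_carrier bspec[OF zero]])
  qed
  then show ?thesis using pair by (simp del: lr_hom_simps)
qed

theorem proposition3p5:
  fixes G :: "('g, 'm) monoid_scheme"
    and p q :: real
    and n i :: nat
    and F :: "nat \<Rightarrow> ('g \<Rightarrow>\<^sub>0 int, 'a) module"
    and d :: "nat \<Rightarrow> 'a \<Rightarrow> 'a"
    and \<epsilon> :: "'a \<Rightarrow> int"
  assumes "1 < p" and "1 / p + 1 / q = 1"
    and "group G" and "type_FP n G"
    and "projective_resolution G F d \<epsilon>"
    and "\<forall>j\<le>n. finitely_generated (group_ring G) (F j)"
    and "i \<le> n"
  shows "ctvs_isomorphic (reduced_lr_cohomology G p F d i)
           (dual_ctvs (reduced_lr_homology G q F d i))"
proof -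
  interpret E: conjugate_exponents p q using assms(1,2) by unfold_locales
  note exps = E.conjugate_exponents_axioms
  have proj: "projective_module (group_ring G) (F j)" for j
    using assms(5) by (simp add: projective_resolution_upto_def)
  have dmap: "d (Suc j) \<in> module_maps (carrier (group_ring G)) (F (Suc j)) (F j)" for j
    using assms(5) by (simp add: projective_resolution_upto_def)
  have dd: "d (Suc j) (d (Suc (Suc j)) x) = \<zero>\<^bsub>F j\<^esub>" if "x \<in> carrier (F (Suc (Suc j)))" for j x
  proof -
    have "d (Suc (Suc j)) ` carrier (F (Suc (Suc j))) = a_kernel (F (Suc j)) (F j) (d (Suc j))"
      using assms(5) by (simp add: projective_resolution_upto_def)
    then show ?thesis using that by (auto simp: a_kernel_def')
  qed
  have gmod: "gmodule G (F j) r" if "1 < r" for j r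
    using proj[of j] assms(3) that
    by (simp add: gmodule_def gmodule_axioms_def projective_module_def)
  \<comment> \<open>Covers \<open>i\<close> and, if \<open>i > 0\<close>, its predecessor, but not
    \<open>Suc i\<close> when \<open>i = n\<close>.\<close>
  have basis: "\<exists>S c. dual_basis G (F j) S c" if "j \<le> n" for j
  proof -
    obtain S c where "finite S" "S \<subseteq> carrier (F j)" "\<And>s. s \<in> S \<Longrightarrow> c s \<in> linear_functionals (group_ring G) (F j)"
      "\<And>m. m \<in> carrier (F j) \<Longrightarrow> m = (\<Oplus>\<^bsub>F j\<^esub>s\<in>S. c s m \<odot>\<^bsub>F j\<^esub> s)"
      using finite_dual_basis[OF proj] assms(6) \<open>j \<le> n\<close> by blast
    then have "dual_basis G (F j) S c"
      using proj[of j] assms(3) unfolding dual_basis_def dual_basis_axioms_def projective_module_def by blast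
    then show ?thesis by blast
  qed
  obtain S c where "dual_basis G (F i) S c" using basis[OF assms(7)] by blast
  then interpret M: dual_basis G "F i" S c .
  interpret gM: gmodule G "F i" q by (rule gmod[OF E.q1])
  let ?V = "lr_tensor G q (F i)" and ?W = "lr_hom G p (F i)"
  let ?B = "lr_boundaries G q F d i" and ?C = "lr_coboundaries G p F d i"
  interpret DP: ell_dual_pair p q ?V M.tensor_coords ?W M.hom_coords "S \<times> carrier G" "\<Sum>s\<in>S. M.combination_bound s"
    by (rule M.ell_dual_pair_hom_tensor[OF exps])
  have B: "csubspace ?V ?B"
    unfolding lr_boundaries_def by (rule csubspace_boundaries[OF gmod[OF E.q1] gmod[OF E.q1] dmap])
  have C: "csubspace ?W ?C"
  proof (cases i)
    case 0
    have "\<zero>\<^bsub>?W\<^esub> \<oplus>\<^bsub>?W\<^esub> \<zero>\<^bsub>?W\<^esub> = \<zero>\<^bsub>?W\<^esub>" "k \<odot>\<^bsub>?W\<^esub> \<zero>\<^bsub>?W\<^esub> = \<zero>\<^bsub>?W\<^esub>" for k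
      by (auto intro!: restrict_ext)
    then have "csubspace ?W {\<zero>\<^bsub>?W\<^esub>}"
      using DP.W.zero_closed by (simp add: csubspace_def del: lr_hom_simps)
    then show ?thesis by (simp add: lr_coboundaries_def 0 del: lr_hom_simps)
  next
    case (Suc j)
    show ?thesis
      unfolding lr_coboundaries_def Suc nat.case
      by (rule csubspace_coboundaries[OF gmod[OF E.p1] gmod[OF E.p1] dmap])
  qed
  \<comment> \<open>In degree 0 the coboundaries are the zero space by definition; otherwise a
    coboundary is a cocycle by \<open>d \<circ> d = 0\<close> and thus annihilates the
    boundaries.\<close>
  have kill: "DP.pairing \<phi> A = 0" if \<phi>: "\<phi> \<in> ?C" and A: "A \<in> ?B" for \<phi> A
  proof (cases i)
    case 0
    then have "\<phi> = \<zero>\<^bsub>?W\<^esub>" using \<phi> by (simp add: lr_coboundaries_def del: lr_hom_simps)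
    then show ?thesis by (simp add: DP.pairing_def DP.W.J_zero del: lr_hom_simps)
  next
    case (Suc j)
    obtain \<psi> where \<psi>: "\<psi> \<in> carrier (lr_hom G p (F j))" "\<phi> = compose (carrier (F i)) \<psi> (d i)"
      using \<phi> unfolding lr_coboundaries_def Suc nat.case by blast
    have "compose (carrier (F (Suc i))) \<phi> (d (Suc i)) = \<zero>\<^bsub>lr_hom G p (F (Suc i))\<^esub>"
      unfolding compose_eq_zero_iff
    proof
      fix x assume x: "x \<in> carrier (F (Suc i))"
      then have "d (Suc i) x \<in> carrier (F i)" using dmap[of i] by (auto simp: module_maps_def)
      then have "\<phi> (d (Suc i) x) = \<psi> (d i (d (Suc i) x))" by (simp add: \<psi>(2) compose_def)
      also have "\<dots> = (\<lambda>g. 0)"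
        using dd[of x j] x gmodule.lr_hom_zero_arg[OF gmod[OF E.p1] \<psi>(1)] by (simp add: Suc)
      finally show "\<phi> (d (Suc i) x) = (\<lambda>g. 0)" .
    qed
    moreover have "\<phi> \<in> carrier ?W" using C \<phi> by (auto simp only: csubspace_def)
    ultimately show ?thesis
      using M.cocycle_iff_annihilates_boundaries[OF exps gmod[OF E.q1] dmap[of i], of \<phi>] A
      unfolding DP.pairing_def lr_boundaries_def by blast
  qed
  interpret DS: ell_dual_subspaces p q ?V M.tensor_coords ?W M.hom_coords "S \<times> carrier G"
    "\<Sum>s\<in>S. M.combination_bound s" ?B ?C
    by unfold_locales (fact B C kill)+
  have Y: "DS.Y = lr_cocycles G p F d i"
    unfolding DS.Y_def unfolding lr_cocycles_def a_kernel_def' DP.pairing_def lr_boundaries_def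
    using M.cocycle_iff_annihilates_boundaries[OF exps gmod[OF E.q1] dmap[of i]] by blast
  \<comment> \<open>In degree 0 all chains are cycles, matching the annihilator of the zero space;
    in higher degrees \<open>F j\<close> has a dual basis since \<open>j \<le> n\<close>.\<close>
  have Z: "DS.Z = lr_cycles G q F d i"
  proof (cases i)
    case 0
    then have "?C = {\<zero>\<^bsub>?W\<^esub>}" by (simp add: lr_coboundaries_def del: lr_hom_simps)
    then have "DS.Z = carrier ?V" unfolding DS.Z_def by (simp add: DP.pairing_def DP.W.J_zero del: lr_hom_simps)
    then show ?thesis by (simp add: lr_cycles_def 0)
  next
    case (Suc j)
    have "j \<le> n" using assms(7) Suc by simp
    then obtain T e where N: "dual_basis G (F j) T e" using basis by blast
    have di: "d i \<in> module_maps (carrier (group_ring G)) (F i) (F j)" using dmap[of j] by (simp add: Suc)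
    have "?C = (\<lambda>\<phi>. compose (carrier (F i)) \<phi> (d i)) ` carrier (lr_hom G p (F j))"
      by (simp add: lr_coboundaries_def Suc)
    moreover have "lr_cycles G q F d i = {A \<in> carrier ?V. tensor_map G q (F j) (d i) id A = \<zero>\<^bsub>lr_tensor G q (F j)\<^esub>}"
      by (simp add: lr_cycles_def Suc a_kernel_def')
    ultimately show ?thesis
      unfolding DS.Z_def DP.pairing_def
      using cycle_iff_annihilated_by_coboundaries[OF exps M.dual_basis_axioms N di] by blast
  qed
  \<comment> \<open>With \<open>Y\<close> and \<open>Z\<close> identified, the abstract subquotients
    are the reduced spaces by definition.\<close>
  have "reduced_lr_cohomology G p F d i = DS.W.Q" "reduced_lr_homology G q F d i = DS.V.Q"
    unfolding DS.W.Q_def DS.V.Q_def unfolding reduced_lr_cohomology_def reduced_lr_homology_def Y Z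
    by (rule refl)+
  then show ?thesis using DS.duality_isomorphism by simp
qed

end
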